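(* Let $(\mathcal V,\mathcal E)$ be a star-shaped network with one arbitrary but fixed boundary node $\nu_\partial\in\mathcal V_\partial$, and let $T>0$. Let $u^e=(\rho^e,v^e)$ and $\hat u^e=(\hat\rho^e,\hat v^e)$, $e\in\mathcal E$, be Lipschitz continuous solutions, on every edge $e\in\mathcal E$, of the original system $$\partial_t\rho^e+\partial_x m^e=0,\qquad \partial_t v^e+\partial_x h^e=-\gamma|v^e|v^e,\qquad 0<x<\ell^e,\ 0<t<T,$$ and of the observer system $$\partial_t\hat\rho^e+\partial_x\hat m^e=\mathcal L_\rho,\qquad \partial_t\hat v^e+\partial_x\hat h^e=-\gamma|\hat v^e|\hat v^e+\mathcal L_v,\qquad 0<x<\ell^e,\ 0<t<T,$$ respectively, with initial data $u_0^e$ and $\hat u_0^e$, with boundary conditions $$h^e(t,\nu_\partial)=\hat h^e(t,\nu_\partial)=h_b^e(t,\nu_\partial),\qquad m^e(t,\nu)=\hat m^e(t,\nu)=m_b^e(t,\nu)\quad\text{for all }\nu\in\mathcal V_\partial\setminus\{\nu_\partial\},$$ and with the source terms for density measurements $$\mathcal L_\rho=\mu\frac{c}{\sqrt{p'(\hat\rho^e)}}\hat\rho^e\big(\tilde P(\rho^e)-\tilde P(\hat\rho^e)\big),\qquad \mathcal L_v=0,\qquad \mu>0.$$ Assume that both solutions satisfy the coupling conditions at the inner node and that on all pipes $e\in\mathcal E$ the following hold. (A1) $(\rho^e,v^e)\in\big(C^0([0,T];W^{1,\infty}(0,\ell^e))\cap W^{1,\infty}(0,T;L^\infty(0,\ell^e))\big)^2$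 satisfies the original system pointwise almost everywhere, and there are $\underline\rho,\bar\rho,\tilde v>0$ with $0<\underline\rho\le\rho^e\le\bar\rho$ and $-\tilde v\le v^e\le\tilde v$ on $[0,T]\times[0,\ell^e]$. (A2) $\rho P''(\rho)\ge4|\tilde v|^2$ for all $\underline\rho\le\rho\le\bar\rho$. (A3) $(\hat\rho^e,\hat v^e)\in\big(C^0([0,T];W^{1,\infty}(0,\ell^e))\cap W^{1,\infty}(0,T;L^\infty(0,\ell^e))\big)^2$ satisfies $0<\underline\rho\le\hat\rho^e\le\bar\rho$ and $-\tilde v\le\hat v^e\le\tilde v$ on $[0,T]\times[0,\ell^e]$. (A4) The bounds $$\|\partial_t\rho^e\|_{L^\infty(0,T;L^\infty(0,\ell^e))}+\|\partial_tv^e\|_{L^\infty(0,T;L^\infty(0,\ell^e))}\le C_t,\qquad \|v^e\|_{L^\infty(0,T;L^\infty(0,\ell^e))},\ \|\hat v^e\|_{L^\infty(0,T;L^\infty(0,\ell^e))}\le\bar v$$ hold with $C_t,\bar v>0$ sufficiently small. Then there exist constants $C_1,C_2>0$ such that $$\|u(t,\cdot)-\hat u(t,\cdot)\|_{L^2(\mathcal E)}^2\le C_1\|u_0-\hat u_0\|_{L^2(\mathcal E)}^2\exp(-C_2t)$$ for all $0\le t\le T$.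
   Context: $p:(0,\infty)\to\mathbb R$ is smooth and strictly monotone with $p'>0$; the pressure potential $P$ is smooth and strictly convex with $p'(\rho)=\rho P''(\rho)$; $\gamma\ge0$ is the friction coefficient. Notation: $m^e=\rho^ev^e$, $h^e=\frac12(v^e)^2+P'(\rho^e)$, and analogously $\hat m^e,\hat h^e$; $c=\sqrt{p'(\rho_{\mathrm{ref}})}$ for a reference density $\rho_{\mathrm{ref}}>0$ and $\tilde P(\rho)=\int_{\rho_{\mathrm{ref}}}^\rho\frac{\sqrt{p'(s)}}{cs}\,ds$. A star-shaped network $(\mathcal V,\mathcal E)$ has exactly one inner node $\nu_0$; all other nodes are boundary nodes (set $\mathcal V_\partial$), and every edge $e\in\mathcal E$, identified with the interval $(0,\ell^e)$, starts in $\nu_0$ ($x=0$) and ends at a boundary node ($x=\ell^e$). All pipes have the same diameter. In the boundary conditions, $e$ is the edge incident to the respective boundary node, and they hold for $0\le t\le T$. The coupling conditions at $\nu_0$ are $\sum_{e\in\mathcal E}m^e(\nu_0)=0$ and $h^e(\nu_0)=h^f(\nu_0)$ for all $e,f\in\mathcal E$ (and the same for the observer quantities with hats). $\|u-\hat u\|_{L^2(\mathcal E)}^2=\sum_{e\in\mathcal E}\|u^e-\hat u^e\|_{L^2(0,\ell^e)}^2$. *)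

theory Defs
  imports "HOL-Analysis.Analysis" "HOL-Probability.Essential_Supremum" "Graph_Theory.Digraph"
begin

section \<open>Function spaces on \<open>(0,l)\<close> and \<open>(0,T) \<times> (0,l)\<close>\<close>

definition smooth_on_reals :: "real set \<Rightarrow> (real \<Rightarrow> real) \<Rightarrow> bool" where
  "smooth_on_reals S f \<longleftrightarrow> (\<forall>k. \<forall>x\<in>S. ((deriv ^^ k) f) differentiable (at x))"

definition strictly_convex_on :: "real set \<Rightarrow> (real \<Rightarrow> real) \<Rightarrow> bool" where
  "strictly_convex_on S f \<longleftrightarrow> convex S \<and>
     (\<forall>x\<in>S. \<forall>y\<in>S. \<forall>s. x \<noteq> y \<longrightarrow> 0 < s \<longrightarrow> s < 1 \<longrightarrow>
        f ((1 - s) * x + s * y) < (1 - s) * f x + s * f y)"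

definition test_function :: "real \<Rightarrow> (real \<Rightarrow> real) \<Rightarrow> bool" where
  "test_function b \<phi> \<longleftrightarrow> smooth_on_reals UNIV \<phi> \<and>
     (\<exists>K. compact K \<and> K \<subseteq> {0<..<b} \<and> (\<forall>x. x \<notin> K \<longrightarrow> \<phi> x = 0))"

text \<open>The essential supremum of a non-measurable function is infinite by convention.\<close>

definition Linf_norm :: "real \<Rightarrow> (real \<Rightarrow> real) \<Rightarrow> ennreal" where
  "Linf_norm l f = esssup (lebesgue_on {0<..<l}) (\<lambda>x. ennreal \<bar>f x\<bar>)"

definition Linf :: "real \<Rightarrow> (real \<Rightarrow> real) \<Rightarrow> bool" where
  "Linf l f \<longleftrightarrow> f \<in> borel_measurable (lebesgue_on {0<..<l}) \<and> Linf_norm l f < \<infinity>"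

definition weak_deriv :: "real \<Rightarrow> (real \<Rightarrow> real) \<Rightarrow> (real \<Rightarrow> real) \<Rightarrow> bool" where
  "weak_deriv l f g \<longleftrightarrow> (\<forall>\<phi>. test_function l \<phi> \<longrightarrow>
     (LINT x|lebesgue_on {0<..<l}. f x * deriv \<phi> x) = - (LINT x|lebesgue_on {0<..<l}. g x * \<phi> x))"

definition W1inf :: "real \<Rightarrow> (real \<Rightarrow> real) \<Rightarrow> bool" where
  "W1inf l f \<longleftrightarrow> Linf l f \<and> (\<exists>g. Linf l g \<and> weak_deriv l f g)"

text \<open>The chosen weak derivative is unique up to null sets, so the norm does not depend on it.\<close>

definition W1inf_norm :: "real \<Rightarrow> (real \<Rightarrow> real) \<Rightarrow> ennreal" where
  "W1inf_norm l f = Linf_norm l f + Linf_norm l (SOME g. Linf l g \<and> weak_deriv l f g)"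

definition C0_W1inf :: "real \<Rightarrow> real \<Rightarrow> (real \<Rightarrow> real \<Rightarrow> real) \<Rightarrow> bool" where
  "C0_W1inf T l u \<longleftrightarrow> (\<forall>t\<in>{0..T}. W1inf l (u t)) \<and>
     (\<forall>t\<in>{0..T}. ((\<lambda>s. W1inf_norm l (\<lambda>x. u s x - u t x)) \<longlongrightarrow> 0) (at t within {0..T}))"

text \<open>\<open>L\<^sup>\<infinity>(0,T; L\<^sup>\<infinity>(0,l))\<close> is a Bochner space: its elements are a.e. limits, in the norm of
  \<open>L\<^sup>\<infinity>(0,l)\<close>, of simple functions of \<open>t\<close>.\<close>

definition Linf_simple :: "real \<Rightarrow> real \<Rightarrow> (real \<Rightarrow> real \<Rightarrow> real) \<Rightarrow> bool" where
  "Linf_simple T l s \<longleftrightarrow> (\<exists>(n::nat) A f.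
     (\<forall>i<n. A i \<in> sets (lebesgue_on {0<..<T}) \<and> Linf l (f i)) \<and>
     s = (\<lambda>t x. \<Sum>i<n. indicator (A i) t * f i x))"

definition Linf_strongly_measurable :: "real \<Rightarrow> real \<Rightarrow> (real \<Rightarrow> real \<Rightarrow> real) \<Rightarrow> bool" where
  "Linf_strongly_measurable T l g \<longleftrightarrow> (\<exists>s :: nat \<Rightarrow> real \<Rightarrow> real \<Rightarrow> real.
     (\<forall>n. Linf_simple T l (s n)) \<and>
     (AE t in lebesgue_on {0<..<T}. (\<lambda>n. Linf_norm l (\<lambda>x. s n t x - g t x)) \<longlonglongrightarrow> 0))"

definition Linf_Linf_norm :: "real \<Rightarrow> real \<Rightarrow> (real \<Rightarrow> real \<Rightarrow> real) \<Rightarrow> ennreal" where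
  "Linf_Linf_norm T l g = esssup (lebesgue_on {0<..<T}) (\<lambda>t. Linf_norm l (g t))"

definition Linf_Linf :: "real \<Rightarrow> real \<Rightarrow> (real \<Rightarrow> real \<Rightarrow> real) \<Rightarrow> bool" where
  "Linf_Linf T l g \<longleftrightarrow> Linf_strongly_measurable T l g \<and>
     (AE t in lebesgue_on {0<..<T}. Linf l (g t)) \<and> Linf_Linf_norm T l g < \<infinity>"

text \<open>The identity \<open>\<integral> u \<phi>' dt = - \<integral> g \<phi> dt\<close> between Bochner integrals in \<open>L\<^sup>\<infinity>(0,l)\<close>, tested
  with \<open>\<psi> \<in> L\<^sup>1(0,l)\<close>; such functionals are bounded, hence commute with the Bochner integral, and
  they separate the points of \<open>L\<^sup>\<infinity>(0,l)\<close>.\<close>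

definition weak_time_deriv ::
  "real \<Rightarrow> real \<Rightarrow> (real \<Rightarrow> real \<Rightarrow> real) \<Rightarrow> (real \<Rightarrow> real \<Rightarrow> real) \<Rightarrow> bool" where
  "weak_time_deriv T l u g \<longleftrightarrow>
     (\<forall>\<phi> \<psi>. test_function T \<phi> \<longrightarrow> integrable (lebesgue_on {0<..<l}) \<psi> \<longrightarrow>
        (LINT t|lebesgue_on {0<..<T}. deriv \<phi> t * (LINT x|lebesgue_on {0<..<l}. u t x * \<psi> x)) =
        - (LINT t|lebesgue_on {0<..<T}. \<phi> t * (LINT x|lebesgue_on {0<..<l}. g t x * \<psi> x)))"

definition W1inf_Linf :: "real \<Rightarrow> real \<Rightarrow> (real \<Rightarrow> real \<Rightarrow> real) \<Rightarrow> bool" where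
  "W1inf_Linf T l u \<longleftrightarrow> Linf_Linf T l u \<and> (\<exists>g. Linf_Linf T l g \<and> weak_time_deriv T l u g)"

text \<open>Joint Lipschitz continuity on the closed rectangle fixes the representative, so that the
  values at \<open>x = 0\<close>, \<open>x = l\<close> and \<open>t = 0\<close> used below are the traces.\<close>

definition lipschitz_state :: "real \<Rightarrow> real \<Rightarrow> (real \<Rightarrow> real \<Rightarrow> real) \<Rightarrow> bool" where
  "lipschitz_state T l u \<longleftrightarrow> (\<exists>L. L-lipschitz_on ({0..T} \<times> {0..l}) (\<lambda>(t, x). u t x))"

definition L2_norm :: "real \<Rightarrow> (real \<Rightarrow> 'a::real_normed_vector) \<Rightarrow> real" where
  "L2_norm l f = sqrt (LINT x|lebesgue_on {0<..<l}. (norm (f x))\<^sup>2)"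

section \<open>Star-shaped networks\<close>

text \<open>\<open>\<nu>0\<close> is the inner node, all other nodes are boundary nodes. Every edge runs from \<open>\<nu>0\<close>
  (\<open>x = 0\<close>) to a boundary node (\<open>x = len e\<close>), and every boundary node has exactly one incident edge.\<close>

definition boundary_nodes :: "('v, 'e) pre_digraph \<Rightarrow> 'v \<Rightarrow> 'v set" where
  "boundary_nodes G \<nu>0 = verts G - {\<nu>0}"

definition star_network :: "('v, 'e) pre_digraph \<Rightarrow> 'v \<Rightarrow> ('e \<Rightarrow> real) \<Rightarrow> bool" where
  "star_network G \<nu>0 len \<longleftrightarrow> fin_digraph G \<and> \<nu>0 \<in> verts G \<and>
     (\<forall>e\<in>arcs G. tail G e = \<nu>0 \<and> 0 < len e) \<and>
     bij_betw (head G) (arcs G) (boundary_nodes G \<nu>0)"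

definition network_L2_norm ::
  "('v, 'e) pre_digraph \<Rightarrow> ('e \<Rightarrow> real) \<Rightarrow> ('e \<Rightarrow> real \<Rightarrow> 'a::real_normed_vector) \<Rightarrow> real" where
  "network_L2_norm G len f = sqrt (\<Sum>e\<in>arcs G. (L2_norm (len e) (f e))\<^sup>2)"

section \<open>Barotropic flow\<close>

definition mass_flow :: "real \<Rightarrow> real \<Rightarrow> real" where
  "mass_flow r w = r * w"

definition enthalpy :: "(real \<Rightarrow> real) \<Rightarrow> real \<Rightarrow> real \<Rightarrow> real" where
  "enthalpy P r w = w\<^sup>2 / 2 + deriv P r"

definition sound_speed :: "(real \<Rightarrow> real) \<Rightarrow> real \<Rightarrow> real" where
  "sound_speed p \<rho>ref = sqrt (deriv p \<rho>ref)"

text \<open>The interval integral is oriented, i.e. it changes sign for \<open>r < \<rho>ref\<close>.\<close>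

definition Ptilde :: "(real \<Rightarrow> real) \<Rightarrow> real \<Rightarrow> real \<Rightarrow> real" where
  "Ptilde p \<rho>ref r =
     (LBINT s=ereal \<rho>ref..ereal r. sqrt (deriv p s) / (sound_speed p \<rho>ref * s))"

definition source_density :: "(real \<Rightarrow> real) \<Rightarrow> real \<Rightarrow> real \<Rightarrow> real \<Rightarrow> real \<Rightarrow> real" where
  "source_density p \<rho>ref \<mu> r rh =
     \<mu> * (sound_speed p \<rho>ref / sqrt (deriv p rh)) * rh * (Ptilde p \<rho>ref r - Ptilde p \<rho>ref rh)"

text \<open>\<open>(\<rho>, v)\<close> satisfies the balance laws with additional sources \<open>S\<rho>\<close>, \<open>Sv\<close> pointwise almost
  everywhere; \<open>S\<rho> = Sv = 0\<close> gives the original system.\<close>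

definition solves_ae ::
  "(real \<Rightarrow> real) \<Rightarrow> real \<Rightarrow> real \<Rightarrow> real \<Rightarrow> (real \<Rightarrow> real \<Rightarrow> real) \<Rightarrow> (real \<Rightarrow> real \<Rightarrow> real) \<Rightarrow>
   (real \<Rightarrow> real \<Rightarrow> real) \<Rightarrow> (real \<Rightarrow> real \<Rightarrow> real) \<Rightarrow> bool" where
  "solves_ae P \<gamma> T l S\<rho> Sv \<rho> v \<longleftrightarrow>
     (AE (t, x) in lebesgue_on ({0<..<T} \<times> {0<..<l}).
        \<exists>\<rho>t mx vt hx.
          ((\<lambda>s. \<rho> s x) has_real_derivative \<rho>t) (at t) \<and>
          ((\<lambda>y. mass_flow (\<rho> t y) (v t y)) has_real_derivative mx) (at x) \<and>
          ((\<lambda>s. v s x) has_real_derivative vt) (at t) \<and>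
          ((\<lambda>y. enthalpy P (\<rho> t y) (v t y)) has_real_derivative hx) (at x) \<and>
          \<rho>t + mx = S\<rho> t x \<and>
          vt + hx = - \<gamma> * \<bar>v t x\<bar> * v t x + Sv t x)"

text \<open>Continuity of the total specific enthalpy and conservation of mass at \<open>\<nu>0\<close>; no
  cross-sectional areas appear because all pipes have the same diameter.\<close>

definition coupling_conditions ::
  "('v, 'e) pre_digraph \<Rightarrow> (real \<Rightarrow> real) \<Rightarrow> real \<Rightarrow>
   ('e \<Rightarrow> real \<Rightarrow> real \<Rightarrow> real) \<Rightarrow> ('e \<Rightarrow> real \<Rightarrow> real \<Rightarrow> real) \<Rightarrow> bool" where
  "coupling_conditions G P T \<rho> v \<longleftrightarrow> (\<forall>t\<in>{0..T}.
     (\<Sum>e\<in>arcs G. mass_flow (\<rho> e t 0) (v e t 0)) = 0 \<and>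
     (\<forall>e\<in>arcs G. \<forall>f\<in>arcs G. enthalpy P (\<rho> e t 0) (v e t 0) = enthalpy P (\<rho> f t 0) (v f t 0)))"

text \<open>Enthalpy \<open>hb\<close> is prescribed at \<open>\<nu>d\<close> and mass flow \<open>mb\<close> at all other boundary nodes.\<close>

definition boundary_conditions ::
  "('v, 'e) pre_digraph \<Rightarrow> ('e \<Rightarrow> real) \<Rightarrow> 'v \<Rightarrow> 'v \<Rightarrow> (real \<Rightarrow> real) \<Rightarrow> real \<Rightarrow>
   (real \<Rightarrow> 'v \<Rightarrow> real) \<Rightarrow> (real \<Rightarrow> 'v \<Rightarrow> real) \<Rightarrow>
   ('e \<Rightarrow> real \<Rightarrow> real \<Rightarrow> real) \<Rightarrow> ('e \<Rightarrow> real \<Rightarrow> real \<Rightarrow> real) \<Rightarrow> bool" where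
  "boundary_conditions G len \<nu>0 \<nu>d P T hb mb \<rho> v \<longleftrightarrow> (\<forall>t\<in>{0..T}. \<forall>e\<in>arcs G.
     (head G e = \<nu>d \<longrightarrow> enthalpy P (\<rho> e t (len e)) (v e t (len e)) = hb t \<nu>d) \<and>
     (\<forall>\<nu>\<in>boundary_nodes G \<nu>0 - {\<nu>d}.
        head G e = \<nu> \<longrightarrow> mass_flow (\<rho> e t (len e)) (v e t (len e)) = mb t \<nu>))"

end

theory Submission
  imports Defs
begin

text \<open>Write \<open>r = \<rho>h - \<rho>\<close>, \<open>w = vh - v\<close>, and \<open>dm\<close>, \<open>dh\<close> for the differences of mass flow and enthalpy. The
  relative energy \<open>\<rho>h w\<^sup>2 / 2 + r v w + (P \<rho>h - P \<rho> - P' \<rho> r)\<close> of the observer with respect to the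
  original state is equivalent to \<open>r\<^sup>2 + w\<^sup>2\<close> for small velocities. Its time derivative plus
  \<open>(dh dm)\<^sub>x\<close> involves derivatives of the original state only, so it is bounded by a negative multiple of
  \<open>r\<^sup>2\<close>, from the source term, up to terms with a small factor; on the network the contributions of
  \<open>dh dm\<close> cancel by the boundary and coupling conditions. Damping of \<open>w\<close> comes from the
  correction \<open>- \<integral> W r\<close>, where \<open>W\<close> is the antiderivative of \<open>w\<close> along the network that vanishes at the
  node with prescribed enthalpy: then \<open>W\<^sub>t = - dh\<close> up to friction, and integrating
  \<open>W dm\<^sub>x\<close> by parts leaves no boundary term but yields \<open>- \<integral> w dm\<close>, which contains \<open>- \<integral> \<rho>h w\<^sup>2\<close>. The
  relative energy plus a small multiple of the correction is a Lipschitz function of time satisfying a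
  linear differential inequality almost everywhere.\<close>

section \<open>Calculus of Lipschitz functions almost everywhere\<close>

text \<open>The gradient of the energy density \<open>\<rho> * v\<^sup>2 / 2 + P \<rho>\<close> in
  \<open>(\<rho>, v)\<close> is the pair of enthalpy and mass flow; this is why the flux of the
  relative energy is \<open>dh * dm\<close>. The obstacle is that the source damps the density error
  only, and friction does not help: it may be absent, and \<open>\<bar>v\<bar> * v\<close> is flat
  at \<open>v = 0\<close>, so that its dissipation has no lower bound by a multiple of
  \<open>w\<^sup>2\<close>. The correction repairs this at the price of terms in
  \<open>r\<^sup>2\<close> that are not small. Hence the order of choices: the weight
  \<open>\<delta>\<close> of the correction is fixed first, small against the density damping, and
  the smallness \<open>\<epsilon>\<close> of velocities and time derivatives afterwards, small
  against what \<open>\<delta>\<close> leaves. Derivatives exist almost everywhere only. Each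
  identity is therefore integrated in space at one time outside a null set, and the calculus below
  supplies the Leibniz rule and the fundamental theorem in that setting. Lipschitz constants of the
  solutions enter qualitatively, never in the final constants, and since every estimate is made at a
  fixed time, no constant depends on \<open>T\<close>.\<close>

lemma dominated_convergence_ae_real:
  fixes f :: "nat \<Rightarrow> real \<Rightarrow> real"
  assumes N: "negligible N"
    and f: "\<And>k. f k integrable_on {a..b}"
    and le: "\<And>k x. x \<in> {a..b} \<Longrightarrow> \<bar>f k x\<bar> \<le> B"
    and conv: "\<And>x. x \<in> {a..b} - N \<Longrightarrow> (\<lambda>k. f k x) \<longlonglongrightarrow> g x"
  shows "g integrable_on {a..b}" "(\<lambda>k. integral {a..b} (f k)) \<longlonglongrightarrow> integral {a..b} g"
proof -
  have sp1: "negligible {x \<in> ({a..b} - N) - {a..b}. h x \<noteq> 0}"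
    and sp2: "negligible {x \<in> {a..b} - ({a..b} - N). h x \<noteq> 0}" for h :: "real \<Rightarrow> real"
    by (auto intro: negligible_subset[OF N])
  have int_iff: "h integrable_on ({a..b} - N) \<longleftrightarrow> h integrable_on {a..b}" for h :: "real \<Rightarrow> real"
    using integrable_spike_set[OF _ sp1 sp2] integrable_spike_set[OF _ sp2 sp1] by blast
  have int_eq: "integral ({a..b} - N) h = integral {a..b} h" for h :: "real \<Rightarrow> real"
    using integral_spike_set[OF sp1 sp2] .
  have 1: "\<And>k. f k integrable_on ({a..b} - N)" using f int_iff by blast
  have 2: "(\<lambda>x. B) integrable_on ({a..b} - N)" unfolding int_iff by auto
  have 3: "\<And>k x. x \<in> {a..b} - N \<Longrightarrow> norm (f k x) \<le> B" using le by auto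
  have 4: "\<And>x. x \<in> {a..b} - N \<Longrightarrow> (\<lambda>k. f k x) \<longlonglongrightarrow> g x" using conv by blast
  show "g integrable_on {a..b}" using dominated_convergence(1)[OF 1 2 3 4] int_iff by blast
  show "(\<lambda>k. integral {a..b} (f k)) \<longlonglongrightarrow> integral {a..b} g"
    using dominated_convergence(2)[OF 1 2 3 4] int_eq by simp
qed

text \<open>The Lipschitz bound in \<open>s\<close>, uniform in \<open>x\<close>, lets the constant
  \<open>L\<close> dominate all difference quotients, so dominated convergence applies although the
  derivative at the single time \<open>t\<close> exists for almost every \<open>x\<close>
  only.\<close>

lemma leibniz_rule_ae:
  fixes f :: "real \<Rightarrow> real \<Rightarrow> real"
  assumes N: "negligible N" and d: "0 < d"
    and int: "\<And>s. \<bar>s - t\<bar> < d \<Longrightarrow> f s integrable_on {a..b}"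
    and lip: "\<And>s x. \<bar>s - t\<bar> < d \<Longrightarrow> x \<in> {a..b} \<Longrightarrow> \<bar>f s x - f t x\<bar> \<le> L * \<bar>s - t\<bar>"
    and der: "\<And>x. x \<in> {a..b} - N \<Longrightarrow> ((\<lambda>s. f s x) has_real_derivative f' x) (at t)"
  shows "f' integrable_on {a..b}"
    and "((\<lambda>s. integral {a..b} (f s)) has_real_derivative integral {a..b} f') (at t)"
proof -
  have main: "f' integrable_on {a..b} \<and>
      (\<lambda>k. (integral {a..b} (f (t + X k)) - integral {a..b} (f t)) / X k) \<longlonglongrightarrow> integral {a..b} f'"
    if X: "\<And>k. X k \<noteq> 0" "\<And>k. \<bar>X k\<bar> < d" "X \<longlonglongrightarrow> 0" for X :: "nat \<Rightarrow> real"
  proof -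
    let ?q = "\<lambda>k x. (f (t + X k) x - f t x) / X k"
    have i: "?q k integrable_on {a..b}" for k
      by (intro integrable_on_divide integrable_diff int) (use X d in auto)
    have ieq: "integral {a..b} (?q k)
        = (integral {a..b} (f (t + X k)) - integral {a..b} (f t)) / X k" for k
      by (subst integral_divide, subst integral_diff) (use X d int in auto)
    have bd: "\<bar>?q k x\<bar> \<le> L" if "x \<in> {a..b}" for k x
      using lip[of "t + X k" x] that X(1,2)[of k] by (simp add: divide_simps mult.commute)
    have c: "(\<lambda>k. ?q k x) \<longlonglongrightarrow> f' x" if "x \<in> {a..b} - N" for x
    proof -
      have "((\<lambda>h. (f (t + h) x - f t x) / h) \<longlongrightarrow> f' x) (at 0)"
        using der[OF that] by (simp add: DERIV_def)
      then show ?thesis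
        using X(1,3) unfolding tendsto_at_iff_sequentially by (auto simp: o_def)
    qed
    show ?thesis
      using dominated_convergence_ae_real[of N ?q, OF N i bd c] unfolding ieq by blast
  qed
  \<comment> \<open>Any null sequence inside the window yields integrability of the limit
    \<open>f'\<close>; this is a concrete one.\<close>
  have "(\<lambda>k. d / 2 * inverse (real (Suc k))) \<longlonglongrightarrow> d / 2 * 0"
    by (intro tendsto_intros LIMSEQ_inverse_real_of_nat)
  moreover have "d / 2 * inverse (real (Suc k)) < d" for k
    using d by (simp add: divide_simps)
  ultimately show "f' integrable_on {a..b}"
    using main[of "\<lambda>k. d / 2 * inverse (real (Suc k))"] d by auto
  show "((\<lambda>s. integral {a..b} (f s)) has_real_derivative integral {a..b} f') (at t)"
    unfolding DERIV_def
  proof (rule Lim_transform_within_open)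
    let ?g = "\<lambda>h. if \<bar>h\<bar> < d then (integral {a..b} (f (t + h)) - integral {a..b} (f t)) / h
      else integral {a..b} f'"
    show "(?g \<longlongrightarrow> integral {a..b} f') (at 0)"
      unfolding tendsto_at_iff_sequentially
    proof (intro allI impI)
      fix X :: "nat \<Rightarrow> real" assume X0: "\<forall>i. X i \<in> UNIV - {0}" and X: "X \<longlonglongrightarrow> 0"
      \<comment> \<open>\<open>main\<close> wants every term inside the window. \<open>Y\<close>
        replaces the finitely many terms outside by \<open>d / 2\<close>, which leaves the limit
        unchanged.\<close>
      define Y where "Y = (\<lambda>k. if \<bar>X k\<bar> < d then X k else d / 2)"
      have ev: "\<forall>\<^sub>F k in sequentially. \<bar>X k\<bar> < d"
        using X d by (simp add: tendsto_iff dist_real_def)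
      then have "\<forall>\<^sub>F k in sequentially. X k = Y k"
        by eventually_elim (simp add: Y_def)
      then have "Y \<longlonglongrightarrow> 0" using X tendsto_cong by fastforce
      then have lim: "(\<lambda>k. (integral {a..b} (f (t + Y k)) - integral {a..b} (f t)) / Y k)
          \<longlonglongrightarrow> integral {a..b} f'"
        using main[of Y] X0 d by (auto simp: Y_def)
      show "(?g \<circ> X) \<longlonglongrightarrow> integral {a..b} f'"
        by (rule Lim_transform_eventually[OF lim])
          (use ev in eventually_elim, simp add: Y_def)
    qed
    show "open {-d<..<d}" "0 \<in> {-d<..<d}" using d by auto
  qed auto
qed

text \<open>Absolute continuity is bypassed by translation: the integral of \<open>G (x + s)\<close>
  over \<open>{a..b}\<close> is differentiated at \<open>s = 0\<close> in two ways. The Leibniz rule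
  gives the integral of \<open>F'\<close>; the antiderivative \<open>\<Phi>\<close> of the
  continuous function \<open>G\<close> gives \<open>G b - G a\<close>.\<close>

lemma FTC_lipschitz_ae:
  fixes F :: "real \<Rightarrow> real"
  assumes ab: "a \<le> b" and lip: "L-lipschitz_on {a..b} F" and N: "negligible N"
    and der: "\<And>x. x \<in> {a..b} - N \<Longrightarrow> (F has_real_derivative F' x) (at x)"
  shows "(F' has_integral (F b - F a)) {a..b}"
proof -
  \<comment> \<open>Constant continuation beyond the endpoints keeps the Lipschitz constant and
    makes the shifts meaningful.\<close>
  define G where "G = (\<lambda>x. F (max a (min b x)))"
  have L: "0 \<le> L" by (rule lipschitz_on_nonneg[OF lip])
  have Glip: "\<bar>G x - G y\<bar> \<le> L * \<bar>x - y\<bar>" for x y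
  proof -
    have "\<bar>G x - G y\<bar> \<le> L * \<bar>max a (min b x) - max a (min b y)\<bar>"
      using lipschitz_onD[OF lip, of "max a (min b x)" "max a (min b y)"] ab
      unfolding G_def by (simp add: dist_real_def)
    also have "\<dots> \<le> L * \<bar>x - y\<bar>" using L by (intro mult_left_mono) auto
    finally show ?thesis .
  qed
  then have "L-lipschitz_on UNIV G" using L by (intro lipschitz_onI) (auto simp: dist_real_def)
  then have Gc: "continuous_on A G" for A
    using lipschitz_on_continuous_on continuous_on_subset by blast
  define \<Phi> where "\<Phi> = (\<lambda>u. integral {a - 1..u} G)"
  have \<Phi>': "(\<Phi> has_real_derivative G x) (at x)" if "a - 1 < x" "x < b + 1" for x
  proof -
    have "(\<Phi> has_real_derivative G x) (at x within {a - 1..b + 1})"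
      unfolding \<Phi>_def by (rule integral_has_real_derivative[OF Gc]) (use that in auto)
    then show ?thesis using that by (simp add: at_within_Icc_at)
  qed
  have shift: "integral {a..b} (\<lambda>x. G (x + s)) = \<Phi> (b + s) - \<Phi> (a + s)" if "\<bar>s\<bar> < 1" for s
  proof (rule integral_unique, rule fundamental_theorem_of_calculus[OF ab])
    fix x assume x: "x \<in> {a..b}"
    have "((\<lambda>x. \<Phi> (x + s)) has_real_derivative G (x + s)) (at x)"
      using \<Phi>'[of "x + s"] x that by (auto simp: DERIV_shift)
    then show "((\<lambda>x. \<Phi> (x + s)) has_vector_derivative G (x + s)) (at x within {a..b})"
      by (auto simp: has_real_derivative_iff_has_vector_derivative intro: has_vector_derivative_at_within)
  qed
  \<comment> \<open>At the endpoints a derivative of \<open>F\<close> need not be one of its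
    constant continuation \<open>G\<close>.\<close>
  have N': "negligible (N \<union> {a, b})" using N by auto
  have 1: "((\<lambda>s. G (x + s)) has_real_derivative F' x) (at 0)" if x: "x \<in> {a..b} - (N \<union> {a, b})" for x
  proof -
    have "(G has_real_derivative F' x) (at x)"
    proof (rule has_field_derivative_transform_within_open[where S = "{a<..<b}"])
      show "(F has_real_derivative F' x) (at x)" using der x by blast
      show "F y = G y" if "y \<in> {a<..<b}" for y using that by (auto simp: G_def max_def min_def)
    qed (use x in auto)
    then show ?thesis by (simp add: DERIV_at_within_shift_lemma DERIV_def)
  qed
  have 2: "(\<lambda>x. G (x + s)) integrable_on {a..b}" for s
    by (intro integrable_continuous_real continuous_on_compose2[OF Gc[of UNIV]] continuous_intros) auto
  have 3: "\<bar>G (x + s) - G (x + 0)\<bar> \<le> L * \<bar>s - 0\<bar>" for s x using Glip[of "x + s" x] by simp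
  note lr = leibniz_rule_ae[of _ 1 0 "\<lambda>s x. G (x + s)", OF N' _ 2 3 1]
  have "F' integrable_on {a..b}" using lr(1) by simp
  moreover have "integral {a..b} F' = F b - F a"
  proof -
    have D1: "((\<lambda>s. integral {a..b} (\<lambda>x. G (x + s))) has_real_derivative integral {a..b} F') (at 0)"
      using lr(2) by simp
    have "((\<lambda>s. \<Phi> (s + b) - \<Phi> (s + a)) has_real_derivative G b - G a) (at 0)"
      using \<Phi>'[of b] \<Phi>'[of a] ab
      by (intro derivative_eq_intros refl) (auto simp: DERIV_shift[of \<Phi> _ 0, simplified])
    then have "((\<lambda>s. integral {a..b} (\<lambda>x. G (x + s))) has_real_derivative G b - G a) (at 0)"
      by (rule has_field_derivative_transform_within_open[where S = "{-1<..<1}"])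
        (use shift in \<open>auto simp: add.commute\<close>)
    then show ?thesis using DERIV_unique[OF D1] ab by (simp add: G_def)
  qed
  ultimately show ?thesis using integrable_integral by force
qed

section \<open>Closure properties of Lipschitz functions\<close>

definition Lip :: "'a::metric_space set \<Rightarrow> ('a \<Rightarrow> real) \<Rightarrow> bool" where
  "Lip S f \<longleftrightarrow> (\<exists>L. L-lipschitz_on S f)"

lemma Lip_continuous_on: "Lip S f \<Longrightarrow> continuous_on S f"
  unfolding Lip_def using lipschitz_on_continuous_on by blast

lemma Lip_subset: "Lip S f \<Longrightarrow> T \<subseteq> S \<Longrightarrow> Lip T f"
  unfolding Lip_def using lipschitz_on_subset by blast

lemma Lip_const: "Lip S (\<lambda>x. c)"
  unfolding Lip_def using lipschitz_on_constant by blast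

lemma Lip_add: "Lip S f \<Longrightarrow> Lip S g \<Longrightarrow> Lip S (\<lambda>x. f x + g x)"
  unfolding Lip_def using lipschitz_on_add by blast

lemma Lip_diff: "Lip S f \<Longrightarrow> Lip S g \<Longrightarrow> Lip S (\<lambda>x. f x - g x)"
  unfolding Lip_def using lipschitz_on_diff by blast

lemma Lip_minus: "Lip S f \<Longrightarrow> Lip S (\<lambda>x. - f x)"
  unfolding Lip_def by simp

lemma Lip_abs: "Lip S f \<Longrightarrow> Lip S (\<lambda>x. \<bar>f x\<bar>)"
  unfolding Lip_def lipschitz_on_def dist_real_def
  by (metis abs_triangle_ineq3 order_trans)

lemma Lip_compact_bounded:
  assumes "compact S" "Lip S f"
  obtains B where "0 \<le> B" "\<And>x. x \<in> S \<Longrightarrow> \<bar>f x\<bar> \<le> B"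
proof -
  have "bounded (f ` S)"
    by (intro compact_imp_bounded compact_continuous_image Lip_continuous_on assms)
  then obtain B where "\<And>x. x \<in> S \<Longrightarrow> \<bar>f x\<bar> \<le> B" unfolding bounded_iff by auto
  then have "\<And>x. x \<in> S \<Longrightarrow> \<bar>f x\<bar> \<le> max 0 B" by fastforce
  then show ?thesis using that[of "max 0 B"] by simp
qed

text \<open>Compactness supplies the bounds on the factors; a product of unbounded Lipschitz
  functions need not be Lipschitz.\<close>

lemma Lip_mult:
  assumes S: "compact S" and f: "Lip S f" and g: "Lip S g"
  shows "Lip S (\<lambda>x. f x * g x)"
proof -
  obtain B where B: "0 \<le> B" "\<And>x. x \<in> S \<Longrightarrow> \<bar>f x\<bar> \<le> B" using Lip_compact_bounded[OF S f] by blast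
  obtain C where C: "0 \<le> C" "\<And>x. x \<in> S \<Longrightarrow> \<bar>g x\<bar> \<le> C" using Lip_compact_bounded[OF S g] by blast
  obtain L M where L: "L-lipschitz_on S f" and M: "M-lipschitz_on S g" using f g unfolding Lip_def by blast
  have "(B * M + C * L)-lipschitz_on S (\<lambda>x. f x * g x)"
  proof (rule lipschitz_onI)
    fix x y assume xy: "x \<in> S" "y \<in> S"
    have "\<bar>f x * g x - f y * g y\<bar> = \<bar>f x * (g x - g y) + g y * (f x - f y)\<bar>"
      by (simp add: algebra_simps)
    also have "\<dots> \<le> \<bar>f x\<bar> * \<bar>g x - g y\<bar> + \<bar>g y\<bar> * \<bar>f x - f y\<bar>"
      by (metis abs_mult abs_triangle_ineq)
    also have "\<dots> \<le> B * (M * dist x y) + C * (L * dist x y)"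
      using B C xy lipschitz_onD[OF L xy] lipschitz_onD[OF M xy]
      by (intro add_mono mult_mono) (auto simp: dist_real_def)
    finally show "dist (f x * g x) (f y * g y) \<le> (B * M + C * L) * dist x y"
      by (simp add: dist_real_def algebra_simps)
  qed (use B C lipschitz_on_nonneg[OF L] lipschitz_on_nonneg[OF M] in simp)
  then show ?thesis unfolding Lip_def by blast
qed

lemma Lip_power2: "compact S \<Longrightarrow> Lip S f \<Longrightarrow> Lip S (\<lambda>x. (f x)\<^sup>2)"
  unfolding power2_eq_square by (rule Lip_mult)

lemma Lip_cmult: "Lip S f \<Longrightarrow> Lip S (\<lambda>x. c * f x)"
  unfolding Lip_def using lipschitz_on_cmult_real by blast

lemma Lip_sum: "(\<And>i. i \<in> I \<Longrightarrow> Lip S (f i)) \<Longrightarrow> Lip S (\<lambda>x. \<Sum>i\<in>I. f i x)"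
  by (induction I rule: infinite_finite_induct) (auto intro: Lip_const Lip_add)

lemma Lip_C1:
  assumes der: "\<And>x. x \<in> {c..d} \<Longrightarrow> (f has_real_derivative f' x) (at x within {c..d})"
    and cont: "continuous_on {c..d} f'"
  shows "Lip {c..d} f"
proof -
  have "bounded (f' ` {c..d})"
    by (intro compact_imp_bounded compact_continuous_image cont compact_Icc)
  then obtain B where "\<And>x. x \<in> {c..d} \<Longrightarrow> \<bar>f' x\<bar> \<le> B"
    by (auto simp: bounded_iff simp del: atLeastAtMost_iff)
  then have B: "\<And>x. x \<in> {c..d} \<Longrightarrow> \<bar>f' x\<bar> \<le> max 0 B" by fastforce
  have "(max 0 B)-lipschitz_on {c..d} f"
  proof (rule lipschitz_onI)
    fix x y assume xy: "x \<in> {c..d}" "y \<in> {c..d}"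
    have "norm (f x - f y) \<le> max 0 B * norm (x - y)"
      by (rule field_differentiable_bound[of "{c..d}" _ f']) (use xy B der in auto)
    then show "dist (f x) (f y) \<le> max 0 B * dist x y" by (simp add: dist_norm)
  qed auto
  then show ?thesis unfolding Lip_def ..
qed

lemma Lip_compose:
  assumes "Lip S g" "Lip T f" "g ` S \<subseteq> T"
  shows "Lip S (\<lambda>x. f (g x))"
  using assms lipschitz_on_compose2[of _ S g _ f] lipschitz_on_subset unfolding Lip_def by blast

text \<open>Integrating factor: \<open>exp (k * t) * \<Psi> t\<close> is again Lipschitz with
  nonpositive derivative off \<open>N\<close>, so the fundamental theorem bounds it by its initial
  value. The Lipschitz property excludes growth hidden in \<open>N\<close>, as for the Cantor
  function.\<close>

lemma lipschitz_exp_decay: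
  fixes \<Psi> :: "real \<Rightarrow> real"
  assumes lip: "Lip {0..T} \<Psi>" and N: "negligible N"
    and der: "\<And>t. t \<in> {0..T} - N \<Longrightarrow> \<exists>D. (\<Psi> has_real_derivative D) (at t) \<and> D \<le> - k * \<Psi> t"
    and t: "t \<in> {0..T}"
  shows "\<Psi> t \<le> \<Psi> 0 * exp (- k * t)"
proof -
  obtain D where D: "\<And>t. t \<in> {0..T} - N \<Longrightarrow> (\<Psi> has_real_derivative D t) (at t) \<and> D t \<le> - k * \<Psi> t"
    using der by metis
  let ?f = "\<lambda>t. exp (k * t) * \<Psi> t"
  let ?f' = "\<lambda>t. exp (k * t) * (k * \<Psi> t + D t)"
  have "Lip {0..T} (\<lambda>t. exp (k * t))"
    by (rule Lip_C1[where f' = "\<lambda>t. exp (k * t) * k"])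
      (auto intro!: derivative_eq_intros continuous_intros)
  then have "Lip {0..T} ?f" by (intro Lip_mult lip) auto
  then obtain M where flip: "M-lipschitz_on {0..T} ?f" unfolding Lip_def by blast
  have fd: "(?f has_real_derivative ?f' x) (at x)" if "x \<in> {0..t} - N" for x
  proof -
    have "(\<Psi> has_real_derivative D x) (at x)" using D[of x] that t by auto
    then show ?thesis by (auto intro!: derivative_eq_intros simp: algebra_simps)
  qed
  have "(?f' has_integral ?f t - ?f 0) {0..t}"
    by (rule FTC_lipschitz_ae[OF _ lipschitz_on_subset[OF flip] N fd]) (use t in auto)
  \<comment> \<open>The sign of \<open>?f'\<close> is known off \<open>N\<close> only, while the
    comparison of integrals is pointwise; setting the integrand to 0 on \<open>N\<close> changes no
    integral.\<close>
  then have hi: "((\<lambda>x. if x \<in> N then 0 else ?f' x) has_integral ?f t - ?f 0) {0..t}"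
    by (rule has_integral_spike[OF N, rotated]) auto
  have "?f t - ?f 0 \<le> 0"
  proof (rule has_integral_le[OF hi, of "\<lambda>x. 0"])
    show "(if x \<in> N then 0 else ?f' x) \<le> 0" if "x \<in> {0..t}" for x
      using D[of x] that t by (auto simp: mult_le_0_iff)
  qed auto
  then show ?thesis by (simp add: exp_minus field_simps)
qed

section \<open>Integrals depending on a parameter\<close>

lemma integral_abs_le_integral:
  fixes f :: "'a::euclidean_space \<Rightarrow> real"
  assumes "f integrable_on S" "g integrable_on S" "\<And>x. x \<in> S \<Longrightarrow> \<bar>f x\<bar> \<le> g x"
  shows "\<bar>integral S f\<bar> \<le> integral S g"
  using Henstock_Kurzweil_Integration.integral_norm_bound_integral[OF assms(1,2)] assms(3) by simp

lemma Lip_curried_left: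
  fixes f :: "'a::metric_space \<Rightarrow> 'b::metric_space \<Rightarrow> real"
  assumes "Lip (A \<times> B) (\<lambda>(t, x). f t x)" "t \<in> A"
  shows "Lip B (f t)"
proof -
  obtain L where L: "L-lipschitz_on (A \<times> B) (\<lambda>(t, x). f t x)" using assms(1) unfolding Lip_def by blast
  have "L-lipschitz_on B (f t)"
  proof (rule lipschitz_onI)
    show "dist (f t x) (f t y) \<le> L * dist x y" if "x \<in> B" "y \<in> B" for x y
      using lipschitz_onD[OF L, of "(t, x)" "(t, y)"] that assms(2) by (simp add: dist_Pair_Pair)
  qed (rule lipschitz_on_nonneg[OF L])
  then show ?thesis unfolding Lip_def ..
qed

lemma Lip_curried_right:
  fixes f :: "'a::metric_space \<Rightarrow> 'b::metric_space \<Rightarrow> real"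
  assumes "Lip (A \<times> B) (\<lambda>(t, x). f t x)"
  obtains L where "0 \<le> L"
    "\<And>s t x. s \<in> A \<Longrightarrow> t \<in> A \<Longrightarrow> x \<in> B \<Longrightarrow> \<bar>f s x - f t x\<bar> \<le> L * dist s t"
proof -
  obtain L where L: "L-lipschitz_on (A \<times> B) (\<lambda>(t, x). f t x)" using assms unfolding Lip_def by blast
  show ?thesis
  proof (rule that[of L])
    show "\<bar>f s x - f t x\<bar> \<le> L * dist s t" if "s \<in> A" "t \<in> A" "x \<in> B" for s t x
      using lipschitz_onD[OF L, of "(s, x)" "(t, x)"] that by (simp add: dist_Pair_Pair dist_real_def)
  qed (rule lipschitz_on_nonneg[OF L])
qed

lemma Lip_integral:
  fixes f :: "real \<Rightarrow> real \<Rightarrow> real"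
  assumes f: "Lip (A \<times> {a..b}) (\<lambda>(t, x). f t x)"
  shows "Lip A (\<lambda>t. integral {a..b} (f t))"
proof (cases "a \<le> b")
  case True
  obtain L where L: "0 \<le> L"
    "\<And>s t x. s \<in> A \<Longrightarrow> t \<in> A \<Longrightarrow> x \<in> {a..b} \<Longrightarrow> \<bar>f s x - f t x\<bar> \<le> L * dist s t"
    using Lip_curried_right[OF f] by blast
  have i: "f s integrable_on {a..b}" if "s \<in> A" for s
    by (intro integrable_continuous_real Lip_continuous_on Lip_curried_left[OF f] that)
  have "(L * (b - a))-lipschitz_on A (\<lambda>t. integral {a..b} (f t))"
  proof (rule lipschitz_onI)
    fix s t assume st: "s \<in> A" "t \<in> A"
    have "\<bar>integral {a..b} (\<lambda>x. f s x - f t x)\<bar> \<le> integral {a..b} (\<lambda>x. L * dist s t)"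
      using L st by (intro integral_abs_le_integral integrable_diff i integrable_const_ivl) auto
    then show "dist (integral {a..b} (f s)) (integral {a..b} (f t)) \<le> L * (b - a) * dist s t"
      using True i st by (simp add: dist_real_def integral_diff mult_ac)
  qed (use L True in simp)
  then show ?thesis unfolding Lip_def ..
qed (auto simp: Lip_const)

text \<open>Moving \<open>x\<close> costs the supremum \<open>B\<close>, moving \<open>t\<close>
  costs \<open>(b - a) * L\<close>. Joint regularity is wanted because \<open>W\<close> is such an
  integral and occurs both in a time-dependent density and in a flux.\<close>

lemma Lip_indefinite_integral:
  fixes f :: "real \<Rightarrow> real \<Rightarrow> real"
  assumes A: "compact A" and f: "Lip (A \<times> {a..b}) (\<lambda>(t, x). f t x)"
  shows "Lip (A \<times> {a..b}) (\<lambda>(t, x). integral {a..x} (f t))"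
proof -
  obtain L where L: "0 \<le> L"
    "\<And>s t x. s \<in> A \<Longrightarrow> t \<in> A \<Longrightarrow> x \<in> {a..b} \<Longrightarrow> \<bar>f s x - f t x\<bar> \<le> L * dist s t"
    using Lip_curried_right[OF f] by blast
  have "compact (A \<times> {a..b})" using A by (simp add: compact_Times)
  from Lip_compact_bounded[OF this f] obtain B where
    B0: "0 \<le> B" "\<And>z. z \<in> A \<times> {a..b} \<Longrightarrow> \<bar>case z of (t, x) \<Rightarrow> f t x\<bar> \<le> B"
    by blast
  have B: "0 \<le> B" "\<And>t x. t \<in> A \<Longrightarrow> x \<in> {a..b} \<Longrightarrow> \<bar>f t x\<bar> \<le> B"
    using B0(1) B0(2)[of "(t, x)" for t x] by simp_all
  have i: "f s integrable_on {c..d}" if "s \<in> A" "a \<le> c" "d \<le> b" for s c d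
    by (intro integrable_continuous_real continuous_on_subset[OF Lip_continuous_on[OF Lip_curried_left[OF f that(1)]]])
      (use that in auto)
  have *: "\<bar>integral {a..y} (f s) - integral {a..x} (f s)\<bar> \<le> B * (y - x)"
    if "s \<in> A" "a \<le> x" "x \<le> y" "y \<le> b" for s x y
  proof -
    have "integral {a..x} (f s) + integral {x..y} (f s) = integral {a..y} (f s)"
      using that by (intro Henstock_Kurzweil_Integration.integral_combine i) auto
    moreover have "\<bar>integral {x..y} (f s)\<bar> \<le> integral {x..y} (\<lambda>x. B)"
      using B that by (intro integral_abs_le_integral i integrable_const_ivl) auto
    ultimately show ?thesis using that by (simp add: mult.commute)
  qed
  have **: "\<bar>integral {a..x} (f s) - integral {a..x} (f t)\<bar> \<le> (b - a) * L * dist s t"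
    if "s \<in> A" "t \<in> A" "x \<in> {a..b}" for s t x
  proof -
    have "\<bar>integral {a..x} (\<lambda>x. f s x - f t x)\<bar> \<le> integral {a..x} (\<lambda>x. L * dist s t)"
      using L that by (intro integral_abs_le_integral integrable_diff i integrable_const_ivl) auto
    also have "\<dots> = (x - a) * (L * dist s t)" using that by simp
    also have "\<dots> \<le> (b - a) * (L * dist s t)" using that L by (intro mult_right_mono) auto
    finally show ?thesis using that i by (simp add: integral_diff mult_ac)
  qed
  have "((b - a) * L + B)-lipschitz_on (A \<times> {a..b}) (\<lambda>(t, x). integral {a..x} (f t))"
    if "a \<le> b"
  proof (rule lipschitz_onI, clarify)
    fix s x t y assume st: "s \<in> A" "x \<in> {a..b}" "t \<in> A" "y \<in> {a..b}"
    have "\<bar>integral {a..x} (f t) - integral {a..y} (f t)\<bar> \<le> B * dist x y"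
      using *[of t x y] *[of t y x] st by (cases "x \<le> y") (auto simp: dist_real_def abs_minus_commute)
    moreover have "dist s t \<le> dist (s, x) (t, y)" "dist x y \<le> dist (s, x) (t, y)"
      using dist_fst_le[of "(s, x)" "(t, y)"] dist_snd_le[of "(s, x)" "(t, y)"] by auto
    then have "(b - a) * L * dist s t \<le> (b - a) * L * dist (s, x) (t, y)"
      "B * dist x y \<le> B * dist (s, x) (t, y)"
      using that L B by (auto intro!: mult_left_mono)
    ultimately show "dist (integral {a..x} (f s)) (integral {a..y} (f t))
        \<le> ((b - a) * L + B) * dist (s, x) (t, y)"
      using **[OF st(1,3,2)] unfolding dist_real_def distrib_right by linarith
  qed (use that L B in simp)
  \<comment> \<open>The rectangle is empty in this case.\<close>
  moreover have "Lip (A \<times> {a..b}) (\<lambda>(t, x). integral {a..x} (f t))" if "\<not> a \<le> b"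
    unfolding Lip_def using that by (intro exI[of _ 0]) auto
  ultimately show ?thesis unfolding Lip_def by blast
qed

text \<open>The Leibniz rule treats the density \<open>f\<close>, the fundamental theorem the flux
  \<open>F\<close>; adding them turns a pointwise balance into the rate of the integral plus
  boundary fluxes. \<open>Q\<close> leaves open whether the balance is an equation or an inequality,
  and the function obtained is the sum of both derivatives.\<close>

lemma balance_law_ae:
  fixes f :: "real \<Rightarrow> real \<Rightarrow> real"
  assumes t: "0 < t" "t < T" and l: "0 \<le> l"
    and f: "Lip ({0..T} \<times> {0..l}) (\<lambda>(t, x). f t x)"
    and F: "Lip {0..l} F" and N: "negligible N"
    and der: "\<And>x. x \<in> {0..l} - N \<Longrightarrow> \<exists>a b. ((\<lambda>s. f s x) has_real_derivative a) (at t) \<and>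
      (F has_real_derivative b) (at x) \<and> Q x (a + b)"
  obtains a where "\<And>x. x \<in> {0..l} - N \<Longrightarrow> Q x (a x)" "a integrable_on {0..l}"
    "((\<lambda>s. integral {0..l} (f s)) has_real_derivative integral {0..l} a + F 0 - F l) (at t)"
proof -
  obtain a b where ab: "\<And>x. x \<in> {0..l} - N \<Longrightarrow> ((\<lambda>s. f s x) has_real_derivative a x) (at t)"
    "\<And>x. x \<in> {0..l} - N \<Longrightarrow> (F has_real_derivative b x) (at x)"
    "\<And>x. x \<in> {0..l} - N \<Longrightarrow> Q x (a x + b x)"
    using der by metis
  obtain L where L: "L-lipschitz_on {0..l} F" using F unfolding Lip_def by blast
  have b: "(b has_integral (F l - F 0)) {0..l}" by (rule FTC_lipschitz_ae[OF l L N ab(2)])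
  obtain M where M: "0 \<le> M" "\<And>s t x. s \<in> {0..T} \<Longrightarrow> t \<in> {0..T} \<Longrightarrow> x \<in> {0..l} \<Longrightarrow> \<bar>f s x - f t x\<bar> \<le> M * dist s t"
    using Lip_curried_right[OF f] by blast
  have st: "s \<in> {0..T}" if "\<bar>s - t\<bar> < min t (T - t)" for s
    using that by (simp add: abs_less_iff)
  have i: "f s integrable_on {0..l}" if "\<bar>s - t\<bar> < min t (T - t)" for s
    by (intro integrable_continuous_real Lip_continuous_on Lip_curried_left[OF f] st that)
  have li: "\<bar>f s x - f t x\<bar> \<le> M * \<bar>s - t\<bar>" if "\<bar>s - t\<bar> < min t (T - t)" "x \<in> {0..l}" for s x
    using M(2)[OF st[OF that(1)], of t x] that(2) t by (simp add: dist_real_def)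
  have d: "0 < min t (T - t)" using t by simp
  note lr = leibniz_rule_ae[where f = f and f' = a and t = t, OF N d i li ab(1)]
  have a: "a integrable_on {0..l}" by (rule lr(1))
  have "integral {0..l} (\<lambda>x. a x + b x) = integral {0..l} a + (F l - F 0)"
    using a b by (simp add: integral_add has_integral_integrable integral_unique[OF b])
  then have "((\<lambda>s. integral {0..l} (f s)) has_real_derivative
      integral {0..l} (\<lambda>x. a x + b x) + F 0 - F l) (at t)"
    using lr(2) by simp
  then show ?thesis using a b ab(3) by (intro that[of "\<lambda>x. a x + b x"]) (auto intro: Henstock_Kurzweil_Integration.integrable_add)
qed

lemma balance_law_le:
  fixes f :: "real \<Rightarrow> real \<Rightarrow> real"
  assumes "0 < t" "t < T" "0 \<le> l" "Lip ({0..T} \<times> {0..l}) (\<lambda>(t, x). f t x)" "Lip {0..l} F"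
    and N: "negligible N" and B: "B integrable_on {0..l}"
    and "\<And>x. x \<in> {0..l} - N \<Longrightarrow> \<exists>a b. ((\<lambda>s. f s x) has_real_derivative a) (at t) \<and>
      (F has_real_derivative b) (at x) \<and> a + b \<le> B x"
  shows "\<exists>D. ((\<lambda>s. integral {0..l} (f s)) has_real_derivative D) (at t) \<and>
    D \<le> F 0 - F l + integral {0..l} B"
proof -
  from balance_law_ae[where Q = "\<lambda>x z. z \<le> B x", OF assms(1-6,8)]
  obtain a where a: "\<And>x. x \<in> {0..l} - N \<Longrightarrow> a x \<le> B x" "a integrable_on {0..l}"
    "((\<lambda>s. integral {0..l} (f s)) has_real_derivative integral {0..l} a + F 0 - F l) (at t)"
    by metis
  \<comment> \<open>On \<open>N\<close> nothing is known about \<open>a\<close>, so it is replaced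
    there by \<open>B\<close> before integrals are compared.\<close>
  have "integral {0..l} (\<lambda>x. if x \<in> N then B x else a x) \<le> integral {0..l} B"
    by (intro integral_le integrable_spike[OF a(2) N] B) (use a(1) in auto)
  moreover have "integral {0..l} (\<lambda>x. if x \<in> N then B x else a x) = integral {0..l} a"
    by (rule integral_spike[OF N]) auto
  ultimately show ?thesis using a(3) by force
qed

lemma balance_law_eq:
  fixes f :: "real \<Rightarrow> real \<Rightarrow> real"
  assumes "0 < t" "t < T" "0 \<le> l" "Lip ({0..T} \<times> {0..l}) (\<lambda>(t, x). f t x)" "Lip {0..l} F"
    and N: "negligible N"
    and "\<And>x. x \<in> {0..l} - N \<Longrightarrow> \<exists>a b. ((\<lambda>s. f s x) has_real_derivative a) (at t) \<and>
      (F has_real_derivative b) (at x) \<and> a + b = B x"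
  shows "((\<lambda>s. integral {0..l} (f s)) has_real_derivative integral {0..l} B + F 0 - F l) (at t)"
proof -
  from balance_law_ae[where Q = "\<lambda>x z. z = B x", OF assms]
  obtain a where a: "\<And>x. x \<in> {0..l} - N \<Longrightarrow> a x = B x"
    "((\<lambda>s. integral {0..l} (f s)) has_real_derivative integral {0..l} a + F 0 - F l) (at t)"
    by metis
  have "integral {0..l} a = integral {0..l} B" by (rule integral_spike[OF N]) (use a(1) in auto)
  then show ?thesis using a(2) by simp
qed

section \<open>Null sets on the space-time rectangle and passage to all points\<close>

lemma AE_lebesgue_on_iff_negligible:
  fixes S :: "'a::euclidean_space set"
  assumes "S \<in> sets lebesgue"
  shows "(AE x in lebesgue_on S. P x) \<longleftrightarrow> (\<exists>N. negligible N \<and> (\<forall>x\<in>S - N. P x))"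
proof -
  have "(AE x in lebesgue_on S. P x) \<longleftrightarrow> (AE x in lebesgue. x \<in> S \<longrightarrow> P x)"
    using assms by (simp add: AE_restrict_space_iff)
  also have "\<dots> \<longleftrightarrow> (\<exists>N. negligible N \<and> {x. \<not> (x \<in> S \<longrightarrow> P x)} \<subseteq> N)"
    unfolding eventually_ae_filter by (auto simp: negligible_iff_null_sets)
  also have "\<dots> \<longleftrightarrow> (\<exists>N. negligible N \<and> (\<forall>x\<in>S - N. P x))" by blast
  finally show ?thesis .
qed

text \<open>Exceptional sets are taken slice by slice, \<open>M\<close> depending on
  \<open>t\<close>, since the energy argument fixes a time and integrates in space. The nested
  essential suprema of \<open>Linf_Linf_norm\<close> provide bounds in just this form.\<close>

definition ae_rectangle :: "real \<Rightarrow> real \<Rightarrow> (real \<Rightarrow> real \<Rightarrow> bool) \<Rightarrow> bool" where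
  "ae_rectangle T l Q \<longleftrightarrow> (\<exists>N. negligible N \<and>
     (\<forall>t\<in>{0<..<T} - N. \<exists>M. negligible M \<and> (\<forall>x\<in>{0<..<l} - M. Q t x)))"

lemma ae_rectangle_mono:
  assumes "ae_rectangle T l Q" "\<And>t x. t \<in> {0<..<T} \<Longrightarrow> x \<in> {0<..<l} \<Longrightarrow> Q t x \<Longrightarrow> Q' t x"
  shows "ae_rectangle T l Q'"
  using assms unfolding ae_rectangle_def by (metis DiffD1)

lemma ae_rectangle_conj:
  assumes "ae_rectangle T l Q" "ae_rectangle T l Q'"
  shows "ae_rectangle T l (\<lambda>t x. Q t x \<and> Q' t x)"
proof -
  obtain N where N: "negligible N"
    "\<And>t. t \<in> {0<..<T} - N \<Longrightarrow> \<exists>M. negligible M \<and> (\<forall>x\<in>{0<..<l} - M. Q t x)"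
    using assms(1) unfolding ae_rectangle_def by blast
  obtain N' where N': "negligible N'"
    "\<And>t. t \<in> {0<..<T} - N' \<Longrightarrow> \<exists>M. negligible M \<and> (\<forall>x\<in>{0<..<l} - M. Q' t x)"
    using assms(2) unfolding ae_rectangle_def by blast
  show ?thesis
    unfolding ae_rectangle_def
  proof (rule exI[of _ "N \<union> N'"], intro conjI ballI)
    show "negligible (N \<union> N')" using N(1) N'(1) by (rule negligible_Un)
    fix t assume "t \<in> {0<..<T} - (N \<union> N')"
    then have "t \<in> {0<..<T} - N" "t \<in> {0<..<T} - N'" by auto
    then obtain M M' where "negligible M" "\<forall>x\<in>{0<..<l} - M. Q t x"
      "negligible M'" "\<forall>x\<in>{0<..<l} - M'. Q' t x"
      using N(2) N'(2) by meson
    then show "\<exists>M. negligible M \<and> (\<forall>x\<in>{0<..<l} - M. Q t x \<and> Q' t x)"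
      by (intro exI[of _ "M \<union> M'"]) auto
  qed
qed

text \<open>Fubini for null sets. It is carried out for \<open>lborel\<close>, which in the plane is
  the product of its line versions; completion does not alter statements that hold almost
  everywhere.\<close>

lemma AE_lebesgue_on_rectangle:
  assumes "AE (t, x) in lebesgue_on ({0<..<T} \<times> {0<..<l}). P t x"
  shows "ae_rectangle T l P"
proof -
  have S: "{0<..<T} \<times> {0<..<l} \<in> sets lebesgue"
    by (intro borel_open[THEN sets_completionI_sets[of _ lborel, simplified]] open_Times) auto
  have "AE z in lebesgue. z \<in> {0<..<T} \<times> {0<..<l} \<longrightarrow> P (fst z) (snd z)"
    using assms S by (simp add: AE_restrict_space_iff case_prod_beta)
  then have "AE z in lborel \<Otimes>\<^sub>M lborel. z \<in> {0<..<T} \<times> {0<..<l} \<longrightarrow> P (fst z) (snd z)"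
    unfolding AE_completion_iff lborel_prod .
  then have "AE t in lborel. AE x in lborel. (t, x) \<in> {0<..<T} \<times> {0<..<l} \<longrightarrow> P t x"
    using lborel_pair.AE_pair by fastforce
  then have "AE t in lebesgue. AE x in lebesgue. (t, x) \<in> {0<..<T} \<times> {0<..<l} \<longrightarrow> P t x"
    unfolding AE_completion_iff .
  then have "AE t in lebesgue_on {0<..<T}. AE x in lebesgue_on {0<..<l}. P t x"
    by (simp add: AE_restrict_space_iff) (elim eventually_mono, auto)
  then show ?thesis by (simp add: ae_rectangle_def AE_lebesgue_on_iff_negligible)
qed

text \<open>The two essential suprema are opened one after the other. A non-measurable function has
  essential supremum infinity, so being bounded by it almost everywhere is true for such a function
  as well.\<close>

lemma Linf_Linf_norm_leD:
  assumes "Linf_Linf_norm T l g \<le> ennreal C" "0 \<le> C"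
  shows "ae_rectangle T l (\<lambda>t x. \<bar>g t x\<bar> \<le> C)"
proof -
  have "AE t in lebesgue_on {0<..<T}. Linf_norm l (g t) \<le> ennreal C"
    using esssup_AE[of "\<lambda>t. Linf_norm l (g t)" "lebesgue_on {0<..<T}"] assms(1)
    unfolding Linf_Linf_norm_def by (auto elim: eventually_mono)
  then have "AE t in lebesgue_on {0<..<T}. AE x in lebesgue_on {0<..<l}. \<bar>g t x\<bar> \<le> C"
  proof eventually_elim
    case (elim t)
    then show ?case
      using esssup_AE[of "\<lambda>x. ennreal \<bar>g t x\<bar>" "lebesgue_on {0<..<l}"] assms(2)
      unfolding Linf_norm_def by (auto elim!: eventually_mono simp flip: ennreal_le_iff)
  qed
  then show ?thesis by (simp add: ae_rectangle_def AE_lebesgue_on_iff_negligible)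
qed

text \<open>A null set contains no nonempty open set, so the points off \<open>N\<close> are dense
  and the closed condition passes to limits, endpoints included.\<close>

lemma continuous_le_of_le_ae:
  fixes f :: "real \<Rightarrow> real"
  assumes "continuous_on {a..b} f" "negligible N" "a < b"
    and "\<And>x. x \<in> {a<..<b} - N \<Longrightarrow> f x \<le> C" and x: "x \<in> {a..b}"
  shows "f x \<le> C"
proof -
  have near: "\<exists>y\<in>{a<..<b} - N. dist y x < e" if e: "e > 0" for e
  proof (rule ccontr)
    assume "\<not> ?thesis"
    then have "{a<..<b} \<inter> ball x e \<subseteq> N"
      by (metis DiffI IntE dist_commute mem_ball subsetI)
    then have "negligible ({a<..<b} \<inter> ball x e)" using assms(2) negligible_subset by blast
    moreover have "x \<in> closure {a<..<b}" using x assms(3) by simp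
    then obtain y where "y \<in> {a<..<b}" "dist y x < e"
      using e unfolding closure_approachable by blast
    then have "y \<in> {a<..<b} \<inter> ball x e" by (simp add: dist_commute)
    ultimately show False using open_not_negligible[of "{a<..<b} \<inter> ball x e"]
      by (metis empty_iff open_Int open_ball open_greaterThanLessThan)
  qed
  show ?thesis
  proof (rule ccontr)
    assume "\<not> f x \<le> C"
    then obtain e where e: "e > 0" "\<And>y. y \<in> {a..b} \<Longrightarrow> dist y x < e \<Longrightarrow> dist (f y) (f x) < f x - C"
      using assms(1) x unfolding continuous_on_iff by (metis diff_gt_0_iff_gt linorder_not_le)
    obtain y where "y \<in> {a<..<b} - N" "dist y x < e" using near e(1) by blast
    then show False using e(2)[of y] assms(4)[of y] by (auto simp: dist_real_def)
  qed
qed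


text \<open>Two passes: all \<open>x\<close> at almost every time, then all times at fixed
  \<open>x\<close>. Bounds on norms thereby reach the traces at the nodes.\<close>

lemma continuous_le_of_ae_rectangle:
  fixes f :: "real \<Rightarrow> real \<Rightarrow> real"
  assumes f: "continuous_on ({0..T} \<times> {0..l}) (\<lambda>z. f (fst z) (snd z))"
    and ae: "ae_rectangle T l (\<lambda>t x. f t x \<le> C)" and pos: "0 < T" "0 < l"
    and t: "t \<in> {0..T}" and x: "x \<in> {0..l}"
  shows "f t x \<le> C"
proof -
  obtain N where N: "negligible N"
    "\<And>t. t \<in> {0<..<T} - N \<Longrightarrow> \<exists>M. negligible M \<and> (\<forall>x\<in>{0<..<l} - M. f t x \<le> C)"
    using ae unfolding ae_rectangle_def by blast
  have 1: "f s x \<le> C" if s: "s \<in> {0<..<T} - N" for s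
  proof -
    obtain M where M: "negligible M" "\<And>x. x \<in> {0<..<l} - M \<Longrightarrow> f s x \<le> C" using N(2)[OF s] by blast
    have "continuous_on {0..l} (\<lambda>x. (s, x))"
      by (intro continuous_on_Pair continuous_on_const continuous_on_id)
    then have "continuous_on {0..l} (f s)"
      using continuous_on_compose2[OF f, of "{0..l}" "\<lambda>x. (s, x)"] s by force
    then show ?thesis by (rule continuous_le_of_le_ae[OF _ M(1) pos(2) M(2) x])
  qed
  have "continuous_on {0..T} (\<lambda>s. (s, x))"
    by (intro continuous_on_Pair continuous_on_const continuous_on_id)
  then have "continuous_on {0..T} (\<lambda>s. f s x)"
    using continuous_on_compose2[OF f, of "{0..T}" "\<lambda>s. (s, x)"] x by force
  then show ?thesis by (rule continuous_le_of_le_ae[OF _ N(1) pos(1) 1 t])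
qed

section \<open>Pressure law and pointwise estimates\<close>

lemma mean_value_Icc:
  fixes f :: "real \<Rightarrow> real"
  assumes "\<And>x. x \<in> {a..b} \<Longrightarrow> (f has_real_derivative f' x) (at x)" "x \<in> {a..b}" "y \<in> {a..b}"
  obtains z where "z \<in> {a..b}" "f y = f x + f' z * (y - x)"
proof -
  have "\<exists>z\<in>{a..b}. f y = f x + f' z * (y - x)" if "x \<in> {a..b}" "y \<in> {a..b}" "x < y" for x y
    using MVT2[OF that(3), of f f'] assms(1) that(1,2) by (fastforce simp: algebra_simps)
  from this[of x y] this[of y x] show ?thesis
    using that assms(2,3) by (cases x y rule: linorder_cases) (force simp: algebra_simps)+
qed

lemma taylor2_Icc:
  fixes f :: "real \<Rightarrow> real"
  assumes f: "\<And>x. x \<in> {a..b} \<Longrightarrow> (f has_real_derivative f' x) (at x)"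
    and f': "\<And>x. x \<in> {a..b} \<Longrightarrow> (f' has_real_derivative f'' x) (at x)"
    and x: "x \<in> {a..b}" and y: "y \<in> {a..b}"
  obtains z where "z \<in> {a..b}" "f y = f x + f' x * (y - x) + f'' z / 2 * (y - x)\<^sup>2"
proof (cases "y = x")
  case False
  let ?d = "\<lambda>m::nat. if m = 0 then f else if m = 1 then f' else f''"
  have "\<exists>t. (if y < x then y < t \<and> t < x else x < t \<and> t < y) \<and>
    f y = (\<Sum>m<2. ?d m x / fact m * (y - x) ^ m) + ?d 2 t / fact 2 * (y - x) ^ 2"
    by (rule Taylor[of 2 ?d f a b]) (use f f' x y False in \<open>auto simp: less_2_cases_iff\<close>)
  then obtain z where "if y < x then y < z \<and> z < x else x < z \<and> z < y"
    "f y = f x + f' x * (y - x) + f'' z / 2 * (y - x)\<^sup>2"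
    by (auto simp: numeral_2_eq_2)
  then show ?thesis using that[of z] x y by (auto split: if_splits)
qed (use that[of x] x in simp)

lemma continuous_Icc_bounds:
  fixes f :: "real \<Rightarrow> real"
  assumes "continuous_on {a..b} f" "\<And>x. x \<in> {a..b} \<Longrightarrow> 0 < f x"
  obtains m M where "0 < m" "0 < M" "\<And>x. x \<in> {a..b} \<Longrightarrow> m \<le> f x" "\<And>x. x \<in> {a..b} \<Longrightarrow> f x \<le> M"
proof (cases "a \<le> b")
  case True
  then have ne: "{a..b} \<noteq> {}" by simp
  obtain x where x: "x \<in> {a..b}" "\<forall>y\<in>{a..b}. f x \<le> f y"
    using continuous_attains_inf[OF compact_Icc ne assms(1)] by blast
  obtain y where y: "y \<in> {a..b}" "\<forall>z\<in>{a..b}. f z \<le> f y"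
    using continuous_attains_sup[OF compact_Icc ne assms(1)] by blast
  show ?thesis using that[of "f x" "f y"] x y assms(2) by blast
\<comment> \<open>If \<open>b < a\<close>, the interval is empty and any positive constants
  do.\<close>
qed (use that[of 1 1] in auto)

lemma smooth_on_reals_DERIV:
  assumes "smooth_on_reals S f" "x \<in> S"
  shows "((deriv ^^ k) f has_real_derivative (deriv ^^ Suc k) f x) (at x)"
  using assms by (simp add: smooth_on_reals_def DERIV_deriv_iff_real_differentiable)

lemma smooth_on_reals_continuous_on:
  assumes "smooth_on_reals S f" "A \<subseteq> S"
  shows "continuous_on A ((deriv ^^ k) f)"
  using smooth_on_reals_DERIV[OF assms(1)] assms(2)
  by (meson DERIV_isCont continuous_at_imp_continuous_on subsetD)

text \<open>The interval \<open>{?a..?b}\<close> lies in the positive axis and has both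
  \<open>\<rho>ref\<close> and \<open>x\<close> in its interior. The fundamental theorem for
  oriented integrals on it covers either order of the two points and gives a two-sided
  derivative.\<close>

lemma Ptilde_DERIV:
  assumes p: "smooth_on_reals {0<..} p" and ref: "\<rho>ref > 0" and x: "x > 0"
    and pos: "\<forall>r>0. deriv p r > 0"
  shows "(Ptilde p \<rho>ref has_real_derivative sqrt (deriv p x) / (sound_speed p \<rho>ref * x)) (at x)"
proof -
  let ?g = "\<lambda>s. sqrt (deriv p s) / (sound_speed p \<rho>ref * s)"
  let ?a = "min \<rho>ref x / 2" and ?b = "max \<rho>ref x + 1"
  have c: "sound_speed p \<rho>ref > 0" using pos ref by (simp add: sound_speed_def)
  have "continuous_on {?a..?b} (deriv p)"
    using smooth_on_reals_continuous_on[OF p, of "{?a..?b}" 1] ref x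
    by (auto simp: subset_iff min_def split: if_splits)
  then have "continuous_on {?a..?b} ?g"
    using c ref x by (intro continuous_intros) auto
  then have "((\<lambda>u. LBINT y=ereal \<rho>ref..ereal u. ?g y) has_vector_derivative ?g x) (at x within {?a..?b})"
    using ref x by (intro interval_integral_FTC2) auto
  then have "(Ptilde p \<rho>ref has_real_derivative ?g x) (at x within {?a..?b})"
    unfolding Ptilde_def[abs_def] has_real_derivative_iff_has_vector_derivative .
  then show ?thesis using ref x by (simp add: at_within_Icc_at)
qed

text \<open>All constants are extrema of positive continuous functions on the compact
  \<open>{lo..hi}\<close>: \<open>\<kappa>0\<close> and \<open>\<kappa>1\<close> bound the second
  derivative of \<open>P\<close>, \<open>K\<close> the third, and the source turns out to be linear
  damping \<open>- a * (s - r)\<close> with \<open>a\<close> between positive bounds. Multiplied by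
  the increment of the increasing function \<open>deriv P\<close>, it produces the last
  inequality.\<close>

lemma pressure_bounds:
  assumes p: "smooth_on_reals {0<..} p" and pos: "\<forall>r>0. deriv p r > 0"
    and P: "smooth_on_reals {0<..} P" and pP: "\<forall>r>0. deriv p r = r * deriv (deriv P) r"
    and mu: "\<mu> > 0" and ref: "\<rho>ref > 0" and lo: "lo > 0"
  obtains \<kappa>0 \<kappa>1 K \<eta>0 \<eta>1 where "0 < \<kappa>0" "0 < \<kappa>1" "0 < K" "0 < \<eta>0" "0 < \<eta>1"
    "\<And>r s. r \<in> {lo..hi} \<Longrightarrow> s \<in> {lo..hi} \<Longrightarrow> \<kappa>0 / 2 * (s - r)\<^sup>2 \<le> P s - P r - deriv P r * (s - r)"
    "\<And>r s. r \<in> {lo..hi} \<Longrightarrow> s \<in> {lo..hi} \<Longrightarrow> P s - P r - deriv P r * (s - r) \<le> \<kappa>1 / 2 * (s - r)\<^sup>2"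
    "\<And>r s. r \<in> {lo..hi} \<Longrightarrow> s \<in> {lo..hi} \<Longrightarrow> \<bar>deriv P s - deriv P r\<bar> \<le> \<kappa>1 * \<bar>s - r\<bar>"
    "\<And>r s. r \<in> {lo..hi} \<Longrightarrow> s \<in> {lo..hi} \<Longrightarrow>
      \<bar>deriv P s - deriv P r - deriv (deriv P) r * (s - r)\<bar> \<le> K * (s - r)\<^sup>2"
    "\<And>r s. r \<in> {lo..hi} \<Longrightarrow> s \<in> {lo..hi} \<Longrightarrow> \<bar>source_density p \<rho>ref \<mu> r s\<bar> \<le> \<eta>1 * \<bar>s - r\<bar>"
    "\<And>r s. r \<in> {lo..hi} \<Longrightarrow> s \<in> {lo..hi} \<Longrightarrow>
      (deriv P s - deriv P r) * source_density p \<rho>ref \<mu> r s \<le> - \<eta>0 * (s - r)\<^sup>2"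
proof -
  have P1: "(P has_real_derivative deriv P r) (at r)"
    and P2: "(deriv P has_real_derivative deriv (deriv P) r) (at r)"
    and P3: "(deriv (deriv P) has_real_derivative deriv (deriv (deriv P)) r) (at r)"
    and P4: "(deriv (deriv (deriv P)) has_real_derivative deriv (deriv (deriv (deriv P))) r) (at r)"
    if "r \<in> {lo..hi}" for r
    using smooth_on_reals_DERIV[OF P, of r 0] smooth_on_reals_DERIV[OF P, of r 1]
      smooth_on_reals_DERIV[OF P, of r 2] smooth_on_reals_DERIV[OF P, of r 3] that lo
    by (auto simp: numeral_2_eq_2 numeral_3_eq_3)
  have cont: "continuous_on {lo..hi} f" if "\<And>r. r \<in> {lo..hi} \<Longrightarrow> (f has_real_derivative f' r) (at r)"
    for f f' :: "real \<Rightarrow> real"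
    using that by (meson DERIV_isCont continuous_at_imp_continuous_on)
  have c: "sound_speed p \<rho>ref > 0" using pos ref by (simp add: sound_speed_def)
  have pos': "0 < deriv p r" if "r \<in> {lo..hi}" for r using pos that lo by auto
  have P2pos: "0 < deriv (deriv P) r" if "r \<in> {lo..hi}" for r
    using pP pos'[OF that] that lo by (auto simp: zero_less_mult_iff)
  obtain \<kappa>0 \<kappa>1 where k: "0 < \<kappa>0" "0 < \<kappa>1"
    "\<And>x. x \<in> {lo..hi} \<Longrightarrow> \<kappa>0 \<le> deriv (deriv P) x" "\<And>x. x \<in> {lo..hi} \<Longrightarrow> deriv (deriv P) x \<le> \<kappa>1"
    using continuous_Icc_bounds[OF cont[OF P3] P2pos] by blast
  \<comment> \<open>Adding 1 makes the function positive, as the extremum lemma requires.\<close>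
  have "continuous_on {lo..hi} (\<lambda>x. \<bar>deriv (deriv (deriv P)) x\<bar> + 1)"
    by (intro continuous_intros cont[OF P4])
  then obtain K0 where K: "0 < K0" "\<And>x. x \<in> {lo..hi} \<Longrightarrow> \<bar>deriv (deriv (deriv P)) x\<bar> + 1 \<le> K0"
    by (rule continuous_Icc_bounds) auto
  have pc: "continuous_on {lo..hi} (deriv p)"
    using smooth_on_reals_continuous_on[OF p, of "{lo..hi}" 1] lo by (auto simp: subset_iff)
  let ?g = "\<lambda>x. sqrt (deriv p x) / (sound_speed p \<rho>ref * x)"
  let ?A = "\<lambda>x. \<mu> * (sound_speed p \<rho>ref / sqrt (deriv p x)) * x"
  have gpos: "0 < ?g x" and Apos: "0 < ?A x" if "x \<in> {lo..hi}" for x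
    using pos'[OF that] that lo c mu by auto
  have gc: "continuous_on {lo..hi} ?g"
    using pc c lo by (intro continuous_intros) auto
  obtain g0 g1 where g: "0 < g0" "0 < g1" "\<And>x. x \<in> {lo..hi} \<Longrightarrow> g0 \<le> ?g x" "\<And>x. x \<in> {lo..hi} \<Longrightarrow> ?g x \<le> g1"
    using continuous_Icc_bounds[OF gc gpos] by blast
  have "\<forall>x\<in>{lo..hi}. sqrt (deriv p x) \<noteq> 0" using pos' by fastforce
  then have Ac: "continuous_on {lo..hi} ?A"
    by (intro continuous_intros pc)
  obtain A0 A1 where A: "0 < A0" "0 < A1" "\<And>x. x \<in> {lo..hi} \<Longrightarrow> A0 \<le> ?A x" "\<And>x. x \<in> {lo..hi} \<Longrightarrow> ?A x \<le> A1"
    using continuous_Icc_bounds[OF Ac Apos] by blast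
  \<comment> \<open>\<open>?g\<close> is the derivative of \<open>Ptilde\<close>, \<open>?A\<close>
    the prefactor of the source, and \<open>?g x * ?A x = \<mu>\<close>. The mean value theorem
    evaluates \<open>?g\<close> at an intermediate point instead of at \<open>s\<close>, so
    \<open>\<mu>\<close> is replaced by two-sided bounds.\<close>
  have src: "\<exists>a. g0 * A0 \<le> a \<and> a \<le> g1 * A1 \<and> source_density p \<rho>ref \<mu> r s = - a * (s - r)"
    if rs: "r \<in> {lo..hi}" "s \<in> {lo..hi}" for r s
  proof -
    obtain z where z: "z \<in> {lo..hi}" "Ptilde p \<rho>ref s = Ptilde p \<rho>ref r + ?g z * (s - r)"
      by (rule mean_value_Icc[OF _ rs, of "Ptilde p \<rho>ref" ?g]) (use Ptilde_DERIV[OF p ref _ pos] lo in auto)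
    show ?thesis
    proof (intro exI[of _ "?g z * ?A s"] conjI)
      show "g0 * A0 \<le> ?g z * ?A s"
        by (intro mult_mono g(3) A(3) z(1) rs) (use gpos[OF z(1)] A in auto)
      show "?g z * ?A s \<le> g1 * A1"
        by (intro mult_mono g(4) A(4) z(1) rs) (use Apos[OF rs(2)] g in auto)
      show "source_density p \<rho>ref \<mu> r s = - (?g z * ?A s) * (s - r)"
      proof -
        have e: "Ptilde p \<rho>ref r - Ptilde p \<rho>ref s = - (?g z * (s - r))" using z(2) by linarith
        show ?thesis unfolding source_density_def e by (simp only: mult_minus_left mult_minus_right mult_ac)
      qed
    qed
  qed
  have dP: "\<exists>a. \<kappa>0 \<le> a \<and> a \<le> \<kappa>1 \<and> deriv P s - deriv P r = a * (s - r)"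
    if rs: "r \<in> {lo..hi}" "s \<in> {lo..hi}" for r s
    using mean_value_Icc[OF P2 rs] k(3,4) by (metis add_diff_cancel_left')
  show ?thesis
  proof (rule that[of \<kappa>0 \<kappa>1 "K0" "\<kappa>0 * (g0 * A0)" "g1 * A1"])
    fix r s assume rs: "r \<in> {lo..hi}" "s \<in> {lo..hi}"
    obtain z where z: "z \<in> {lo..hi}" "P s = P r + deriv P r * (s - r) + deriv (deriv P) z / 2 * (s - r)\<^sup>2"
      using taylor2_Icc[OF P1 P2 rs] by blast
    show "\<kappa>0 / 2 * (s - r)\<^sup>2 \<le> P s - P r - deriv P r * (s - r)"
      using k(3)[OF z(1)] by (simp add: z(2) mult_right_mono)
    show "P s - P r - deriv P r * (s - r) \<le> \<kappa>1 / 2 * (s - r)\<^sup>2"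
      using k(4)[OF z(1)] by (simp add: z(2) mult_right_mono)
    obtain z where z: "z \<in> {lo..hi}"
      "deriv P s = deriv P r + deriv (deriv P) r * (s - r) + deriv (deriv (deriv P)) z / 2 * (s - r)\<^sup>2"
      using taylor2_Icc[OF P2 P3 rs] by blast
    have "\<bar>deriv (deriv (deriv P)) z / 2\<bar> * (s - r)\<^sup>2 \<le> K0 * (s - r)\<^sup>2"
      using K(2)[OF z(1)] by (intro mult_right_mono) auto
    then show "\<bar>deriv P s - deriv P r - deriv (deriv P) r * (s - r)\<bar> \<le> K0 * (s - r)\<^sup>2"
      by (simp add: z(2) abs_mult)
    obtain a where a: "\<kappa>0 \<le> a" "a \<le> \<kappa>1" "deriv P s - deriv P r = a * (s - r)"
      using dP[OF rs] by blast
    obtain b where b: "g0 * A0 \<le> b" "b \<le> g1 * A1" "source_density p \<rho>ref \<mu> r s = - b * (s - r)"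
      using src[OF rs] by blast
    have b0: "0 < b" using b(1) g A by (smt (verit) mult_pos_pos)
    show "\<bar>deriv P s - deriv P r\<bar> \<le> \<kappa>1 * \<bar>s - r\<bar>"
      using a k by (simp add: abs_mult mult_right_mono)
    show "\<bar>source_density p \<rho>ref \<mu> r s\<bar> \<le> g1 * A1 * \<bar>s - r\<bar>"
      using b b0 by (simp add: abs_mult mult_right_mono)
    have "\<kappa>0 * (g0 * A0) * (s - r)\<^sup>2 \<le> a * b * (s - r)\<^sup>2"
      by (intro mult_right_mono mult_mono) (use a b k g A in auto)
    then show "(deriv P s - deriv P r) * source_density p \<rho>ref \<mu> r s \<le> - (\<kappa>0 * (g0 * A0)) * (s - r)\<^sup>2"
      unfolding a b by (simp add: power2_eq_square algebra_simps)
  qed (use k K g A in auto)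
qed

section \<open>Elementary inequalities for friction, energy and correction\<close>

lemma friction_diff_bound:
  fixes a b :: real
  shows "\<bar>\<bar>b\<bar> * b - \<bar>a\<bar> * a\<bar> \<le> (\<bar>a\<bar> + \<bar>b\<bar>) * \<bar>b - a\<bar>"
proof -
  have "\<bar>b\<bar> * b - \<bar>a\<bar> * a = \<bar>b\<bar> * (b - a) + a * (\<bar>b\<bar> - \<bar>a\<bar>)" by (simp add: algebra_simps)
  also have "\<bar>\<dots>\<bar> \<le> \<bar>b\<bar> * \<bar>b - a\<bar> + \<bar>a\<bar> * \<bar>\<bar>b\<bar> - \<bar>a\<bar>\<bar>"
    using abs_triangle_ineq[of "\<bar>b\<bar> * (b - a)" "a * (\<bar>b\<bar> - \<bar>a\<bar>)"] by (simp add: abs_mult)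
  also have "\<dots> \<le> \<bar>b\<bar> * \<bar>b - a\<bar> + \<bar>a\<bar> * \<bar>b - a\<bar>"
    by (intro add_left_mono mult_left_mono) auto
  finally show ?thesis by (simp add: algebra_simps)
qed

text \<open>The friction law is the derivative of the convex function
  \<open>\<bar>v\<bar>^3 / 3\<close>. Its monotonicity gives the leading friction term of the energy
  rate a sign, so that this term is dropped without any smallness.\<close>

lemma friction_diff_mono:
  fixes a b :: real
  shows "0 \<le> (b - a) * (\<bar>b\<bar> * b - \<bar>a\<bar> * a)"
proof -
  have "\<bar>a\<bar> * a \<le> \<bar>b\<bar> * b" if "a \<le> b" for a b :: real
  proof -
    consider "0 \<le> a" | "a \<le> 0" "0 \<le> b" | "b \<le> 0" by linarith
    then show ?thesis
    proof cases
      case 1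
      then show ?thesis using that by (simp add: mult_mono)
    next
      case 2
      then have "\<bar>a\<bar> * a \<le> 0" "0 \<le> \<bar>b\<bar> * b" by (auto simp: mult_le_0_iff)
      then show ?thesis by linarith
    next
      case 3
      then show ?thesis using that mult_mono[of "- b" "- a" "- b" "- a"] by simp
    qed
  qed
  from this[of a b] this[of b a] show ?thesis
    by (cases "a \<le> b") (auto simp: zero_le_mult_iff)
qed

lemma two_abs_mult_le: "2 * (\<bar>a\<bar> * \<bar>b\<bar>) \<le> a\<^sup>2 + (b::real)\<^sup>2"
  using sum_squares_bound[of "\<bar>a\<bar>" "\<bar>b\<bar>"] by simp

text \<open>\<open>L\<close> stands for the source, \<open>dP\<close> for the difference of
  \<open>deriv P\<close>. Besides \<open>dP * L\<close> and the friction term quadratic in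
  \<open>w\<close>, every term is quadratic in \<open>(r, w)\<close> with a factor
  \<open>\<epsilon>\<close> from a velocity or a time derivative of the original state. In the
  constant, \<open>1 + K\<close> stems from the time derivatives, \<open>\<eta>1\<close> from the
  source, \<open>\<gamma>\<close> from friction.\<close>

lemma energy_rate_le:
  fixes r w :: real
  assumes eps: "0 < \<epsilon>" "\<epsilon> \<le> 1" and v: "\<bar>v\<bar> \<le> \<epsilon>" "\<bar>v + w\<bar> \<le> \<epsilon>" and t: "\<bar>\<rho>t\<bar> \<le> \<epsilon>" "\<bar>vt\<bar> \<le> \<epsilon>"
    and Q: "\<bar>Q\<bar> \<le> K * r\<^sup>2" and dP: "dP * L \<le> - \<eta>0 * r\<^sup>2" and L: "\<bar>L\<bar> \<le> \<eta>1 * \<bar>r\<bar>"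
    and nn: "0 \<le> K" "0 \<le> \<eta>1" "0 \<le> \<gamma>" "0 \<le> \<rho>h"
  shows "\<rho>t * (w\<^sup>2 / 2 + Q) + vt * r * w + ((v + w)\<^sup>2 / 2 - v\<^sup>2 / 2 + dP) * L
      - \<gamma> * (\<rho>h * w + v * r) * (\<bar>v + w\<bar> * (v + w) - \<bar>v\<bar> * v)
    \<le> - \<eta>0 * r\<^sup>2 + (1 + K + \<eta>1 + \<gamma>) * \<epsilon> * (r\<^sup>2 + w\<^sup>2)"
proof -
  let ?f = "\<bar>v + w\<bar> * (v + w) - \<bar>v\<bar> * v"
  have rw: "\<bar>r\<bar> * \<bar>w\<bar> \<le> (r\<^sup>2 + w\<^sup>2) / 2" using two_abs_mult_le[of r w] by simp
  have "\<rho>t * (w\<^sup>2 / 2 + Q) \<le> \<bar>\<rho>t\<bar> * \<bar>w\<^sup>2 / 2 + Q\<bar>" by (metis abs_ge_self abs_mult)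
  also have "\<dots> \<le> \<epsilon> * (w\<^sup>2 / 2 + K * r\<^sup>2)"
    using t Q eps abs_triangle_ineq[of "w\<^sup>2 / 2" Q] by (intro mult_mono) auto
  finally have 1: "\<rho>t * (w\<^sup>2 / 2 + Q) \<le> \<epsilon> * (w\<^sup>2 / 2 + K * r\<^sup>2)" .
  have "vt * r * w \<le> \<bar>vt\<bar> * (\<bar>r\<bar> * \<bar>w\<bar>)" by (metis abs_ge_self abs_mult mult.assoc)
  also have "\<dots> \<le> \<epsilon> * ((r\<^sup>2 + w\<^sup>2) / 2)" using t rw eps by (intro mult_mono) auto
  finally have 2: "vt * r * w \<le> \<epsilon> * ((r\<^sup>2 + w\<^sup>2) / 2)" .
  have "(v + w)\<^sup>2 / 2 - v\<^sup>2 / 2 = w * ((v + (v + w)) / 2)" by (simp add: power2_eq_square field_simps)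
  then have "((v + w)\<^sup>2 / 2 - v\<^sup>2 / 2) * L \<le> \<bar>w\<bar> * \<bar>(v + (v + w)) / 2\<bar> * \<bar>L\<bar>"
    by (metis abs_ge_self abs_mult)
  also have "\<dots> \<le> \<bar>w\<bar> * \<epsilon> * (\<eta>1 * \<bar>r\<bar>)" using v L eps by (intro mult_mono) auto
  also have "\<dots> = \<eta>1 * \<epsilon> * (\<bar>r\<bar> * \<bar>w\<bar>)" by simp
  also have "\<dots> \<le> \<eta>1 * \<epsilon> * ((r\<^sup>2 + w\<^sup>2) / 2)" using rw nn eps by (intro mult_left_mono) auto
  finally have 3: "((v + w)\<^sup>2 / 2 - v\<^sup>2 / 2 + dP) * L \<le> \<eta>1 * \<epsilon> * ((r\<^sup>2 + w\<^sup>2) / 2) - \<eta>0 * r\<^sup>2"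
    using dP by (simp add: algebra_simps)
  \<comment> \<open>In \<open>v * r * ?f\<close> the factor \<open>\<epsilon>\<close> is taken from
    \<open>v\<close>, so this crude bound suffices.\<close>
  have f: "\<bar>?f\<bar> \<le> 2 * \<bar>w\<bar>"
  proof -
    have "\<bar>?f\<bar> \<le> (\<bar>v\<bar> + \<bar>v + w\<bar>) * \<bar>w\<bar>" using friction_diff_bound[of "v + w" v] by simp
    also have "\<dots> \<le> 2 * \<bar>w\<bar>" using v eps by (intro mult_right_mono) auto
    finally show ?thesis .
  qed
  have "- (v * r * ?f) \<le> \<bar>v\<bar> * \<bar>r\<bar> * \<bar>?f\<bar>" by (metis abs_ge_minus_self abs_mult)
  also have "\<dots> \<le> \<epsilon> * \<bar>r\<bar> * (2 * \<bar>w\<bar>)" using v f eps by (intro mult_mono) auto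
  also have "\<dots> = 2 * \<epsilon> * (\<bar>r\<bar> * \<bar>w\<bar>)" by simp
  also have "\<dots> \<le> 2 * \<epsilon> * ((r\<^sup>2 + w\<^sup>2) / 2)" using rw eps by (intro mult_left_mono) auto
  finally have "- (v * r * ?f) \<le> \<epsilon> * (r\<^sup>2 + w\<^sup>2)" by simp
  moreover have "0 \<le> \<rho>h * (w * ?f)" using friction_diff_mono[of "v + w" v] nn by simp
  ultimately have "- ((\<rho>h * w + v * r) * ?f) \<le> \<epsilon> * (r\<^sup>2 + w\<^sup>2)" by (simp add: algebra_simps)
  then have "\<gamma> * - ((\<rho>h * w + v * r) * ?f) \<le> \<gamma> * (\<epsilon> * (r\<^sup>2 + w\<^sup>2))" using nn by (intro mult_left_mono)
  then have 4: "- (\<gamma> * (\<rho>h * w + v * r) * ?f) \<le> \<gamma> * \<epsilon> * (r\<^sup>2 + w\<^sup>2)" by (simp add: algebra_simps)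
  have 5: "\<epsilon> * (w\<^sup>2 / 2 + K * r\<^sup>2) + \<epsilon> * ((r\<^sup>2 + w\<^sup>2) / 2) + \<eta>1 * \<epsilon> * ((r\<^sup>2 + w\<^sup>2) / 2) + \<gamma> * \<epsilon> * (r\<^sup>2 + w\<^sup>2)
    \<le> (1 + K + \<eta>1 + \<gamma>) * \<epsilon> * (r\<^sup>2 + w\<^sup>2)"
  proof -
    have "0 \<le> \<epsilon> * r\<^sup>2 / 2 + K * \<epsilon> * w\<^sup>2 + \<eta>1 * \<epsilon> * ((r\<^sup>2 + w\<^sup>2) / 2)"
      using eps nn by simp
    then show ?thesis by (simp add: field_simps)
  qed
  show ?thesis using 1 2 3 4 5 by linarith
qed

text \<open>\<open>S\<close> stands for the network integral of \<open>\<bar>w\<bar>\<close>, which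
  controls the nonlocal quantities \<open>W\<close> and \<open>R\<close>; \<open>l\<close> will be
  the total length. The weights in Young's inequality are such that
  \<open>lo / (2 * l\<^sup>2) * S\<^sup>2\<close>, integrated over the network, consumes half of the
  gain \<open>lo * w\<^sup>2\<close> after Cauchy-Schwarz. The coefficient of
  \<open>r\<^sup>2\<close> may be large.\<close>

lemma correction_rate_le:
  fixes r w :: real
  assumes eps: "0 < \<epsilon>" and v: "\<bar>v\<bar> \<le> \<epsilon>" "\<bar>v + w\<bar> \<le> \<epsilon>"
    and dP: "\<bar>dP\<bar> \<le> \<kappa>1 * \<bar>r\<bar>" and L: "\<bar>L\<bar> \<le> \<eta>1 * \<bar>r\<bar>" and R: "\<bar>R\<bar> \<le> a * S" and W: "\<bar>W\<bar> \<le> 2 * S"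
    and nn: "0 \<le> \<eta>1" "0 \<le> S" and lo: "0 < lo" "lo \<le> \<rho>h" and l: "0 < l"
  shows "((v + w)\<^sup>2 / 2 - v\<^sup>2 / 2 + dP) * r - R * r - W * L - w * (\<rho>h * w + v * r)
    \<le> (\<kappa>1 + (a + 2 * \<eta>1)\<^sup>2 * l\<^sup>2 / (2 * lo)) * r\<^sup>2 + \<epsilon> * (r\<^sup>2 + w\<^sup>2) - lo * w\<^sup>2 + lo / (2 * l\<^sup>2) * S\<^sup>2"
proof -
  let ?\<Lambda> = "a + 2 * \<eta>1"
  have rw: "\<bar>r\<bar> * \<bar>w\<bar> \<le> (r\<^sup>2 + w\<^sup>2) / 2" using two_abs_mult_le[of r w] by simp
  \<comment> \<open>The terms \<open>v * r * w\<close> from enthalpy and mass flow cancel; what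
    remains is cubic, and \<open>\<bar>w\<bar> \<le> 2 * \<epsilon>\<close>.\<close>
  have "((v + w)\<^sup>2 / 2 - v\<^sup>2 / 2) * r - w * (v * r) = r * w * (w / 2)"
    by (simp add: power2_eq_square field_simps)
  also have "\<dots> \<le> \<bar>r\<bar> * \<bar>w\<bar> * \<bar>w / 2\<bar>" by (metis abs_ge_self abs_mult)
  also have "\<dots> \<le> (r\<^sup>2 + w\<^sup>2) / 2 * \<epsilon>" using rw v by (intro mult_mono) auto
  also have "\<dots> \<le> \<epsilon> * (r\<^sup>2 + w\<^sup>2)" using eps by simp
  finally have 1: "((v + w)\<^sup>2 / 2 - v\<^sup>2 / 2) * r - w * (v * r) \<le> \<epsilon> * (r\<^sup>2 + w\<^sup>2)" .
  have "dP * r \<le> \<bar>dP\<bar> * \<bar>r\<bar>" by (metis abs_ge_self abs_mult)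
  also have "\<dots> \<le> \<kappa>1 * \<bar>r\<bar> * \<bar>r\<bar>" using dP by (intro mult_right_mono) auto
  finally have 2: "dP * r \<le> \<kappa>1 * r\<^sup>2" by (simp add: power2_eq_square)
  have "- (R * r) \<le> \<bar>R\<bar> * \<bar>r\<bar>" by (metis abs_ge_minus_self abs_mult)
  also have "\<dots> \<le> a * S * \<bar>r\<bar>" using R by (intro mult_right_mono) auto
  finally have 3: "- (R * r) \<le> a * S * \<bar>r\<bar>" .
  have "- (W * L) \<le> \<bar>W\<bar> * \<bar>L\<bar>" by (metis abs_ge_minus_self abs_mult)
  also have "\<dots> \<le> 2 * S * (\<eta>1 * \<bar>r\<bar>)" using W L nn by (intro mult_mono) auto
  finally have 4: "- (R * r) - W * L \<le> ?\<Lambda> * S * \<bar>r\<bar>" using 3 by (simp add: algebra_simps)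
  have "?\<Lambda> * S * \<bar>r\<bar> \<le> ?\<Lambda>\<^sup>2 * l\<^sup>2 / (2 * lo) * r\<^sup>2 + lo / (2 * l\<^sup>2) * S\<^sup>2"
  proof -
    have "0 \<le> (?\<Lambda> * l * \<bar>r\<bar> - lo * S / l)\<^sup>2 / (2 * lo)" using lo by simp
    also have "\<dots> = ?\<Lambda>\<^sup>2 * l\<^sup>2 / (2 * lo) * r\<^sup>2 + lo / (2 * l\<^sup>2) * S\<^sup>2 - ?\<Lambda> * S * \<bar>r\<bar>"
      using lo l by (simp add: power2_diff power_mult_distrib power_divide) (simp add: field_simps power2_eq_square)
    finally show ?thesis by simp
  qed
  moreover have "lo * w\<^sup>2 \<le> \<rho>h * w\<^sup>2" using lo by (intro mult_right_mono) auto
  moreover have "((v + w)\<^sup>2 / 2 - v\<^sup>2 / 2 + dP) * r - R * r - W * L - w * (\<rho>h * w + v * r)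
    = (((v + w)\<^sup>2 / 2 - v\<^sup>2 / 2) * r - w * (v * r)) + dP * r + (- (R * r) - W * L) - \<rho>h * w\<^sup>2"
    by (simp add: algebra_simps power2_eq_square)
  ultimately show ?thesis using 1 2 4 unfolding distrib_right[of \<kappa>1] by linarith
qed

text \<open>The mixed term has no sign. Since \<open>\<epsilon> \<le> m / 2\<close>, it costs at
  most half of the \<open>m / 2\<close> supplied by the density and by convexity, which leaves
  \<open>m / 4\<close>.\<close>

lemma relative_energy_bounds:
  fixes r w :: real
  assumes v: "\<bar>v\<bar> \<le> \<epsilon>" and m: "m \<le> lo" "m \<le> \<kappa>0" "\<epsilon> \<le> m / 2" and rho: "lo \<le> \<rho>h" "\<rho>h \<le> hi"
    and Q: "\<kappa>0 / 2 * r\<^sup>2 \<le> Q" "Q \<le> \<kappa>1 / 2 * r\<^sup>2" and M: "hi \<le> M" "\<kappa>1 \<le> M"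
  shows "m / 4 * (r\<^sup>2 + w\<^sup>2) \<le> \<rho>h * w\<^sup>2 / 2 + r * v * w + Q"
    and "\<rho>h * w\<^sup>2 / 2 + r * v * w + Q \<le> (M + \<epsilon>) / 2 * (r\<^sup>2 + w\<^sup>2)"
proof -
  have "\<bar>r * v * w\<bar> = \<bar>v\<bar> * (\<bar>r\<bar> * \<bar>w\<bar>)" by (simp add: abs_mult)
  also have "\<dots> \<le> \<epsilon> * ((r\<^sup>2 + w\<^sup>2) / 2)"
    using v two_abs_mult_le[of r w] by (intro mult_mono) auto
  finally have c: "\<bar>r * v * w\<bar> \<le> \<epsilon> / 2 * r\<^sup>2 + \<epsilon> / 2 * w\<^sup>2" by (simp add: field_simps)
  have "m / 2 * w\<^sup>2 \<le> \<rho>h / 2 * w\<^sup>2" "m / 2 * r\<^sup>2 \<le> \<kappa>0 / 2 * r\<^sup>2"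
    using m rho by (auto intro!: mult_right_mono)
  moreover have "\<epsilon> / 2 * r\<^sup>2 \<le> m / 4 * r\<^sup>2" "\<epsilon> / 2 * w\<^sup>2 \<le> m / 4 * w\<^sup>2"
    by (rule mult_right_mono; use m in simp)+
  ultimately show "m / 4 * (r\<^sup>2 + w\<^sup>2) \<le> \<rho>h * w\<^sup>2 / 2 + r * v * w + Q"
    using c Q by (simp add: field_simps)
  have "\<rho>h / 2 * w\<^sup>2 \<le> M / 2 * w\<^sup>2" "\<kappa>1 / 2 * r\<^sup>2 \<le> M / 2 * r\<^sup>2"
    using M rho by (auto intro!: mult_right_mono)
  then show "\<rho>h * w\<^sup>2 / 2 + r * v * w + Q \<le> (M + \<epsilon>) / 2 * (r\<^sup>2 + w\<^sup>2)"
    using c Q by (simp add: field_simps)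
qed

section \<open>Relative energy on a star-shaped network\<close>

text \<open>Only the time derivatives of the original state carry the bound
  \<open>\<epsilon>\<close>: those of the observer enter the energy rate through differences, which
  the equations replace.\<close>

definition observer_pde ::
  "(real \<Rightarrow> real) \<Rightarrow> (real \<Rightarrow> real \<Rightarrow> real) \<Rightarrow> real \<Rightarrow> real \<Rightarrow> (real \<Rightarrow> real \<Rightarrow> real) \<Rightarrow> (real \<Rightarrow> real \<Rightarrow> real) \<Rightarrow>
   (real \<Rightarrow> real \<Rightarrow> real) \<Rightarrow> (real \<Rightarrow> real \<Rightarrow> real) \<Rightarrow> real \<Rightarrow> real \<Rightarrow> bool" where
  "observer_pde P src \<gamma> \<epsilon> \<rho> v \<rho>h vh t x \<longleftrightarrow> (
      \<exists>\<rho>t vt \<rho>ht vht mx hx mhx hhx.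
        ((\<lambda>s. \<rho> s x) has_real_derivative \<rho>t) (at t) \<and>
        ((\<lambda>s. v s x) has_real_derivative vt) (at t) \<and>
        ((\<lambda>s. \<rho>h s x) has_real_derivative \<rho>ht) (at t) \<and>
        ((\<lambda>s. vh s x) has_real_derivative vht) (at t) \<and>
        ((\<lambda>y. mass_flow (\<rho> t y) (v t y)) has_real_derivative mx) (at x) \<and>
        ((\<lambda>y. enthalpy P (\<rho> t y) (v t y)) has_real_derivative hx) (at x) \<and>
        ((\<lambda>y. mass_flow (\<rho>h t y) (vh t y)) has_real_derivative mhx) (at x) \<and>
        ((\<lambda>y. enthalpy P (\<rho>h t y) (vh t y)) has_real_derivative hhx) (at x) \<and>
        \<rho>t + mx = 0 \<and> vt + hx = - \<gamma> * \<bar>v t x\<bar> * v t x \<and>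
        \<rho>ht + mhx = src (\<rho> t x) (\<rho>h t x) \<and> vht + hhx = - \<gamma> * \<bar>vh t x\<bar> * vh t x \<and>
        \<bar>\<rho>t\<bar> \<le> \<epsilon> \<and> \<bar>vt\<bar> \<le> \<epsilon>)"

text \<open>Pressure law and source enter through inequalities with named constants, so that the
  decay constants can be read off independently of \<open>T\<close> and of the solutions.
  \<open>e0\<close> is the edge leading to the node with prescribed enthalpy; \<open>N\<close> is
  one null set of times for all edges.\<close>

locale star_observer =
  fixes E :: "'e set" and e0 :: 'e and l :: "'e \<Rightarrow> real" and T :: real
    and P :: "real \<Rightarrow> real" and src :: "real \<Rightarrow> real \<Rightarrow> real"
    and \<gamma> \<epsilon> lo hi \<kappa>0 \<kappa>1 K \<eta>0 \<eta>1 :: real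
    and \<rho> v \<rho>h vh :: "'e \<Rightarrow> real \<Rightarrow> real \<Rightarrow> real" and N :: "real set"
  assumes E: "finite E" "e0 \<in> E" and l_pos: "\<And>e. e \<in> E \<Longrightarrow> 0 < l e" and T: "0 < T"
    and \<gamma>: "0 \<le> \<gamma>" and \<epsilon>: "0 < \<epsilon>" "\<epsilon> \<le> 1" and lo: "0 < lo"
    and const_pos: "0 < \<kappa>0" "0 < \<kappa>1" "0 < K" "0 < \<eta>0" "0 < \<eta>1"
    and P1: "\<And>r. r \<in> {lo..hi} \<Longrightarrow> (P has_real_derivative deriv P r) (at r)"
    and P2: "\<And>r. r \<in> {lo..hi} \<Longrightarrow> (deriv P has_real_derivative deriv (deriv P) r) (at r)"
    and LipP: "Lip {lo..hi} P" "Lip {lo..hi} (deriv P)"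
    and entropy_bounds: "\<And>r s. r \<in> {lo..hi} \<Longrightarrow> s \<in> {lo..hi} \<Longrightarrow>
        \<kappa>0 / 2 * (s - r)\<^sup>2 \<le> P s - P r - deriv P r * (s - r)"
      "\<And>r s. r \<in> {lo..hi} \<Longrightarrow> s \<in> {lo..hi} \<Longrightarrow>
        P s - P r - deriv P r * (s - r) \<le> \<kappa>1 / 2 * (s - r)\<^sup>2"
    and dP_diff: "\<And>r s. r \<in> {lo..hi} \<Longrightarrow> s \<in> {lo..hi} \<Longrightarrow> \<bar>deriv P s - deriv P r\<bar> \<le> \<kappa>1 * \<bar>s - r\<bar>"
    and dP_taylor: "\<And>r s. r \<in> {lo..hi} \<Longrightarrow> s \<in> {lo..hi} \<Longrightarrow>
      \<bar>deriv P s - deriv P r - deriv (deriv P) r * (s - r)\<bar> \<le> K * (s - r)\<^sup>2"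
    and src_bound: "\<And>r s. r \<in> {lo..hi} \<Longrightarrow> s \<in> {lo..hi} \<Longrightarrow> \<bar>src r s\<bar> \<le> \<eta>1 * \<bar>s - r\<bar>"
    and src_damping: "\<And>r s. r \<in> {lo..hi} \<Longrightarrow> s \<in> {lo..hi} \<Longrightarrow>
      (deriv P s - deriv P r) * src r s \<le> - \<eta>0 * (s - r)\<^sup>2"
    and Lip_state: "\<And>e. e \<in> E \<Longrightarrow> Lip ({0..T} \<times> {0..l e}) (\<lambda>z. \<rho> e (fst z) (snd z))"
      "\<And>e. e \<in> E \<Longrightarrow> Lip ({0..T} \<times> {0..l e}) (\<lambda>z. v e (fst z) (snd z))"
      "\<And>e. e \<in> E \<Longrightarrow> Lip ({0..T} \<times> {0..l e}) (\<lambda>z. \<rho>h e (fst z) (snd z))"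
      "\<And>e. e \<in> E \<Longrightarrow> Lip ({0..T} \<times> {0..l e}) (\<lambda>z. vh e (fst z) (snd z))"
    and density: "\<And>e t x. e \<in> E \<Longrightarrow> t \<in> {0..T} \<Longrightarrow> x \<in> {0..l e} \<Longrightarrow> \<rho> e t x \<in> {lo..hi}"
      "\<And>e t x. e \<in> E \<Longrightarrow> t \<in> {0..T} \<Longrightarrow> x \<in> {0..l e} \<Longrightarrow> \<rho>h e t x \<in> {lo..hi}"
    and velocity: "\<And>e t x. e \<in> E \<Longrightarrow> t \<in> {0..T} \<Longrightarrow> x \<in> {0..l e} \<Longrightarrow> \<bar>v e t x\<bar> \<le> \<epsilon>"
      "\<And>e t x. e \<in> E \<Longrightarrow> t \<in> {0..T} \<Longrightarrow> x \<in> {0..l e} \<Longrightarrow> \<bar>vh e t x\<bar> \<le> \<epsilon>"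
    and N: "negligible N"
    and pde: "\<And>e t. e \<in> E \<Longrightarrow> t \<in> {0<..<T} - N \<Longrightarrow> \<exists>M. negligible M \<and> (\<forall>x\<in>{0<..<l e} - M.
      observer_pde P src \<gamma> \<epsilon> (\<rho> e) (v e) (\<rho>h e) (vh e) t x)"
    and outer_mass: "\<And>e t. e \<in> E \<Longrightarrow> e \<noteq> e0 \<Longrightarrow> t \<in> {0..T} \<Longrightarrow>
      mass_flow (\<rho>h e t (l e)) (vh e t (l e)) = mass_flow (\<rho> e t (l e)) (v e t (l e))"
    and outer_enthalpy: "\<And>t. t \<in> {0..T} \<Longrightarrow>
      enthalpy P (\<rho>h e0 t (l e0)) (vh e0 t (l e0)) = enthalpy P (\<rho> e0 t (l e0)) (v e0 t (l e0))"
    and inner_mass: "\<And>t. t \<in> {0..T} \<Longrightarrow> (\<Sum>e\<in>E. mass_flow (\<rho> e t 0) (v e t 0)) = 0"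
      "\<And>t. t \<in> {0..T} \<Longrightarrow> (\<Sum>e\<in>E. mass_flow (\<rho>h e t 0) (vh e t 0)) = 0"
    and inner_enthalpy: "\<And>e t. e \<in> E \<Longrightarrow> t \<in> {0..T} \<Longrightarrow>
        enthalpy P (\<rho> e t 0) (v e t 0) = enthalpy P (\<rho> e0 t 0) (v e0 t 0)"
      "\<And>e t. e \<in> E \<Longrightarrow> t \<in> {0..T} \<Longrightarrow>
        enthalpy P (\<rho>h e t 0) (vh e t 0) = enthalpy P (\<rho>h e0 t 0) (vh e0 t 0)"
begin

section \<open>Error variables, relative energy and their regularity\<close>

definition r where "r e t x = \<rho>h e t x - \<rho> e t x"
definition w where "w e t x = vh e t x - v e t x"
definition dm where "dm e t x = mass_flow (\<rho>h e t x) (vh e t x) - mass_flow (\<rho> e t x) (v e t x)"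
definition dh where "dh e t x = enthalpy P (\<rho>h e t x) (vh e t x) - enthalpy P (\<rho> e t x) (v e t x)"
definition df where "df e t x = \<bar>vh e t x\<bar> * vh e t x - \<bar>v e t x\<bar> * v e t x"

text \<open>The remainder of \<open>\<rho> * v\<^sup>2 / 2 + P \<rho>\<close> after its first-order
  Taylor polynomial at the original state, multiplied out.\<close>

definition entropy where
  "entropy e t x = \<rho>h e t x * (w e t x)\<^sup>2 / 2 + r e t x * v e t x * w e t x +
     (P (\<rho>h e t x) - P (\<rho> e t x) - deriv P (\<rho> e t x) * r e t x)"

text \<open>All edges share the value at the inner node, and on \<open>e0\<close> this is minus the
  integral of \<open>w\<close> from \<open>x\<close> to the outer end. Hence \<open>W\<close> is
  continuous on the network and zero at the one outer end where the mass flow is not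
  prescribed.\<close>

definition W where "W e t x = integral {0..x} (w e t) - integral {0..l e0} (w e0 t)"

definition S where "S t = (\<Sum>e\<in>E. integral {0..l e} (\<lambda>x. \<bar>w e t x\<bar>))"
definition X where "X t = (\<Sum>e\<in>E. integral {0..l e} (\<lambda>x. (r e t x)\<^sup>2))"
definition Y where "Y t = (\<Sum>e\<in>E. integral {0..l e} (\<lambda>x. (w e t x)\<^sup>2))"
definition D where "D = (\<Sum>e\<in>E. l e)"

lemma D_pos: "0 < D"
  unfolding D_def using E l_pos by (intro sum_pos) auto

lemma compact_rect [simp]: "compact ({0..T} \<times> {0..l e})"
  by (intro compact_Times compact_Icc)

lemmas Lip_intros = Lip_const Lip_add Lip_diff Lip_minus Lip_abs Lip_mult Lip_power2 Lip_state

lemma Lip_P: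
  assumes "e \<in> E"
  shows "Lip ({0..T} \<times> {0..l e}) (\<lambda>z. P (\<rho> e (fst z) (snd z)))"
    "Lip ({0..T} \<times> {0..l e}) (\<lambda>z. P (\<rho>h e (fst z) (snd z)))"
    "Lip ({0..T} \<times> {0..l e}) (\<lambda>z. deriv P (\<rho> e (fst z) (snd z)))"
    "Lip ({0..T} \<times> {0..l e}) (\<lambda>z. deriv P (\<rho>h e (fst z) (snd z)))"
  by (rule Lip_compose[OF Lip_state(1)[OF assms] LipP(1)] Lip_compose[OF Lip_state(3)[OF assms] LipP(1)]
      Lip_compose[OF Lip_state(1)[OF assms] LipP(2)] Lip_compose[OF Lip_state(3)[OF assms] LipP(2)];
      use density[OF assms] in force)+

lemma Lip_w: "e \<in> E \<Longrightarrow> Lip ({0..T} \<times> {0..l e}) (\<lambda>z. w e (fst z) (snd z))"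
  and Lip_r: "e \<in> E \<Longrightarrow> Lip ({0..T} \<times> {0..l e}) (\<lambda>z. r e (fst z) (snd z))"
  unfolding r_def w_def by (intro Lip_intros; assumption)+

lemma Lip_dm: "e \<in> E \<Longrightarrow> Lip ({0..T} \<times> {0..l e}) (\<lambda>z. dm e (fst z) (snd z))"
  unfolding dm_def mass_flow_def by (intro Lip_intros; (assumption | simp))

lemma Lip_dh: "e \<in> E \<Longrightarrow> Lip ({0..T} \<times> {0..l e}) (\<lambda>z. dh e (fst z) (snd z))"
  unfolding dh_def enthalpy_def divide_real_def by (intro Lip_intros Lip_P; (assumption | simp))

lemma Lip_df: "e \<in> E \<Longrightarrow> Lip ({0..T} \<times> {0..l e}) (\<lambda>z. df e (fst z) (snd z))"
  unfolding df_def by (intro Lip_intros; (assumption | simp))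

lemma Lip_entropy: "e \<in> E \<Longrightarrow> Lip ({0..T} \<times> {0..l e}) (\<lambda>z. entropy e (fst z) (snd z))"
  unfolding entropy_def divide_real_def
  by (intro Lip_intros Lip_P Lip_w Lip_r; (assumption | simp))

lemma Lip_time:
  assumes "Lip ({0..T} \<times> {0..l e}) (\<lambda>z. f (fst z) (snd z))" "t \<in> {0..T}"
  shows "Lip {0..l e} (f t)" "continuous_on {0..l e} (f t)" "f t integrable_on {0..l e}"
proof -
  show *: "Lip {0..l e} (f t)"
    using Lip_curried_left[of "{0..T}" "{0..l e}" f t] assms by (simp add: case_prod_beta')
  then show "continuous_on {0..l e} (f t)" by (rule Lip_continuous_on)
  then show "f t integrable_on {0..l e}" by (rule integrable_continuous_real)
qed

lemma Lip_W:
  assumes e: "e \<in> E"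
  shows "Lip ({0..T} \<times> {0..l e}) (\<lambda>z. W e (fst z) (snd z))"
proof -
  have "Lip ({0..T} \<times> {0..l e}) (\<lambda>z. integral {0..snd z} (w e (fst z)))"
    using Lip_indefinite_integral[of "{0..T}" 0 "l e" "w e"] Lip_w[OF e] by (simp add: case_prod_beta')
  moreover have "Lip {0..T} (\<lambda>t. integral {0..l e0} (w e0 t))"
    using Lip_integral[of "{0..T}" 0 "l e0" "w e0"] Lip_w[OF E(2)] by (simp add: case_prod_beta')
  then have "Lip ({0..T} \<times> {0..l e}) (\<lambda>z. integral {0..l e0} (w e0 (fst z)))"
  proof (rule Lip_compose[rotated, where g = fst])
    show "Lip ({0..T} \<times> {0..l e}) fst"
      unfolding Lip_def by (intro exI[of _ 1] lipschitz_onI) (simp_all add: dist_fst_le)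
  qed auto
  ultimately show ?thesis unfolding W_def by (intro Lip_diff)
qed

lemma W_deriv:
  assumes e: "e \<in> E" and t: "t \<in> {0..T}" and x: "0 < x" "x < l e"
  shows "(W e t has_real_derivative w e t x) (at x)"
proof -
  have "((\<lambda>x. integral {0..x} (w e t)) has_real_derivative w e t x) (at x within {0..l e})"
    by (rule integral_has_real_derivative) (use Lip_time(2)[OF Lip_w[OF e] t] x in auto)
  then have "((\<lambda>x. integral {0..x} (w e t)) has_real_derivative w e t x) (at x)"
    using x by (simp add: at_within_Icc_at)
  then show ?thesis unfolding W_def[abs_def] by (auto intro!: derivative_eq_intros)
qed

text \<open>Applied to \<open>f = w\<close> for \<open>W\<close> and to the friction difference
  \<open>f = df\<close> for \<open>R\<close>; both nonlocal quantities are thus controlled by one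
  number per time.\<close>

lemma integral_w_le_S:
  assumes e: "e \<in> E" and t: "t \<in> {0..T}" and x: "x \<in> {0..l e}"
    and f: "continuous_on {0..l e} f" "\<And>y. y \<in> {0..l e} \<Longrightarrow> \<bar>f y\<bar> \<le> c * \<bar>w e t y\<bar>" and c: "0 \<le> c"
  shows "\<bar>integral {0..x} f\<bar> \<le> c * S t"
proof -
  have aw: "(\<lambda>y. \<bar>w e t y\<bar>) integrable_on {0..l e}" if "e \<in> E" for e
    by (intro integrable_continuous_real continuous_intros Lip_time(2)[OF Lip_w[OF that] t])
  have "(\<lambda>y. c * \<bar>w e t y\<bar>) integrable_on {0..l e}"
    by (intro integrable_on_mult_right aw e)
  then have i: "(\<lambda>y. c * \<bar>w e t y\<bar>) integrable_on {0..x}"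
    by (rule integrable_on_subinterval) (use x in auto)
  have "\<bar>integral {0..x} f\<bar> \<le> integral {0..x} (\<lambda>y. c * \<bar>w e t y\<bar>)"
  proof (rule integral_abs_le_integral[OF _ i])
    show "f integrable_on {0..x}"
      by (intro integrable_continuous_real continuous_on_subset[OF f(1)]) (use x in auto)
  qed (use f(2) x in auto)
  also have "\<dots> \<le> integral {0..l e} (\<lambda>y. c * \<bar>w e t y\<bar>)"
    by (rule integral_subset_le) (use x c i aw[OF e] in \<open>auto intro!: integrable_on_mult_right\<close>)
  also have "\<dots> = c * integral {0..l e} (\<lambda>y. \<bar>w e t y\<bar>)" by simp
  also have "\<dots> \<le> c * S t"
    unfolding S_def using E e c
    by (intro mult_left_mono member_le_sum Henstock_Kurzweil_Integration.integral_nonneg aw) auto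
  finally show ?thesis .
qed

lemma S_nonneg: "t \<in> {0..T} \<Longrightarrow> 0 \<le> S t"
  unfolding S_def
  by (intro sum_nonneg Henstock_Kurzweil_Integration.integral_nonneg integrable_continuous_real
      continuous_intros Lip_time(2)[OF Lip_w]) auto

lemma W_bound:
  assumes e: "e \<in> E" and t: "t \<in> {0..T}" and x: "x \<in> {0..l e}"
  shows "\<bar>W e t x\<bar> \<le> 2 * S t"
  using integral_w_le_S[OF e t x Lip_time(2)[OF Lip_w[OF e] t], of 1]
    integral_w_le_S[OF E(2) t _ Lip_time(2)[OF Lip_w[OF E(2)] t], of "l e0" 1] l_pos[OF E(2)]
  unfolding W_def by simp

lemma velocity_h: "v e t x + w e t x = vh e t x" by (simp add: w_def)

lemma dh_eq: "dh e t x = (v e t x + w e t x)\<^sup>2 / 2 - (v e t x)\<^sup>2 / 2 + (deriv P (\<rho>h e t x) - deriv P (\<rho> e t x))"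
  by (simp add: dh_def enthalpy_def velocity_h)

lemma dm_eq: "dm e t x = \<rho>h e t x * w e t x + v e t x * r e t x"
  by (simp add: dm_def mass_flow_def w_def r_def algebra_simps)

lemma df_bound:
  assumes "e \<in> E" "t \<in> {0..T}" "x \<in> {0..l e}"
  shows "\<bar>df e t x\<bar> \<le> 2 * \<bar>w e t x\<bar>"
proof -
  have "\<bar>df e t x\<bar> \<le> (\<bar>v e t x\<bar> + \<bar>vh e t x\<bar>) * \<bar>w e t x\<bar>"
    unfolding df_def w_def by (rule friction_diff_bound)
  also have "\<dots> \<le> 2 * \<bar>w e t x\<bar>"
    using velocity[OF assms] \<epsilon> by (intro mult_right_mono) auto
  finally show ?thesis .
qed

text \<open>Time derivatives are kept for all four fields because the chain rule for
  \<open>entropy\<close> needs each of them; in space only those of \<open>dm\<close> and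
  \<open>dh\<close> occur.\<close>

definition error_pde where
  "error_pde e t x \<longleftrightarrow> (\<exists>\<rho>t vt \<rho>ht vht mx hx.
        ((\<lambda>s. \<rho> e s x) has_real_derivative \<rho>t) (at t) \<and>
        ((\<lambda>s. v e s x) has_real_derivative vt) (at t) \<and>
        ((\<lambda>s. \<rho>h e s x) has_real_derivative \<rho>ht) (at t) \<and>
        ((\<lambda>s. vh e s x) has_real_derivative vht) (at t) \<and>
        (dm e t has_real_derivative mx) (at x) \<and> (dh e t has_real_derivative hx) (at x) \<and>
        \<rho>ht - \<rho>t + mx = src (\<rho> e t x) (\<rho>h e t x) \<and> vht - vt + hx = - \<gamma> * df e t x \<and>
        \<bar>\<rho>t\<bar> \<le> \<epsilon> \<and> \<bar>vt\<bar> \<le> \<epsilon>)"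

lemma pde_diff:
  assumes e: "e \<in> E" and t: "t \<in> {0<..<T} - N"
  obtains M where "negligible M" "\<And>x. x \<in> {0..l e} - M \<Longrightarrow> 0 < x \<and> x < l e \<and> error_pde e t x"
proof -
  obtain M where M: "negligible M" and M': "\<And>x. x \<in> {0<..<l e} - M \<Longrightarrow>
      observer_pde P src \<gamma> \<epsilon> (\<rho> e) (v e) (\<rho>h e) (vh e) t x"
    using pde[OF e t] by blast
  show ?thesis
  \<comment> \<open>The endpoints join the null set because the balance laws are integrated over
    closed intervals.\<close>
  proof (rule that[of "M \<union> {0, l e}"])
    show "negligible (M \<union> {0, l e})" using M by auto
    fix x assume "x \<in> {0..l e} - (M \<union> {0, l e})"
    then have x: "0 < x" "x < l e" "x \<notin> M" by auto
    have "x \<in> {0<..<l e} - M" using x by simp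
    from M'[OF this, unfolded observer_pde_def] obtain \<rho>t vt \<rho>ht vht mx hx mhx hhx where
      d: "((\<lambda>s. \<rho> e s x) has_real_derivative \<rho>t) (at t)"
        "((\<lambda>s. v e s x) has_real_derivative vt) (at t)"
        "((\<lambda>s. \<rho>h e s x) has_real_derivative \<rho>ht) (at t)"
        "((\<lambda>s. vh e s x) has_real_derivative vht) (at t)"
      and m: "((\<lambda>y. mass_flow (\<rho> e t y) (v e t y)) has_real_derivative mx) (at x)"
        "((\<lambda>y. enthalpy P (\<rho> e t y) (v e t y)) has_real_derivative hx) (at x)"
        "((\<lambda>y. mass_flow (\<rho>h e t y) (vh e t y)) has_real_derivative mhx) (at x)"
        "((\<lambda>y. enthalpy P (\<rho>h e t y) (vh e t y)) has_real_derivative hhx) (at x)"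
      and eqs: "\<rho>t + mx = 0" "vt + hx = - \<gamma> * \<bar>v e t x\<bar> * v e t x"
        "\<rho>ht + mhx = src (\<rho> e t x) (\<rho>h e t x)" "vht + hhx = - \<gamma> * \<bar>vh e t x\<bar> * vh e t x"
        "\<bar>\<rho>t\<bar> \<le> \<epsilon>" "\<bar>vt\<bar> \<le> \<epsilon>"
      by (elim exE conjE) (rule that)
    have "(dm e t has_real_derivative mhx - mx) (at x)" "(dh e t has_real_derivative hhx - hx) (at x)"
      unfolding dm_def[abs_def] dh_def[abs_def] by (intro DERIV_diff m)+
    moreover have "\<rho>ht - \<rho>t + (mhx - mx) = src (\<rho> e t x) (\<rho>h e t x)" using eqs by linarith
    moreover have "vht - vt + (hhx - hx) = - \<gamma> * df e t x"
      using eqs by (simp add: df_def algebra_simps)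
    ultimately show "0 < x \<and> x < l e \<and> error_pde e t x"
      using d eqs(5,6) x unfolding error_pde_def by blast
  qed
qed

text \<open>\<open>dh\<close> and \<open>dm\<close> multiply the time derivatives of
  \<open>r\<close> and \<open>w\<close>, so adding the derivative of the flux \<open>dh * dm\<close>
  completes the error equations. Only their right-hand sides, source and friction, and second-order
  remainders are left to estimate.\<close>

lemma entropy_edge:
  assumes e: "e \<in> E" and t: "t \<in> {0<..<T} - N"
  shows "\<exists>d. ((\<lambda>s. integral {0..l e} (entropy e s)) has_real_derivative d) (at t) \<and>
    d \<le> dh e t 0 * dm e t 0 - dh e t (l e) * dm e t (l e) + integral {0..l e}
      (\<lambda>x. - \<eta>0 * (r e t x)\<^sup>2 + (1 + K + \<eta>1 + \<gamma>) * \<epsilon> * ((r e t x)\<^sup>2 + (w e t x)\<^sup>2))"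
proof -
  obtain M where M: "negligible M" and M': "\<And>x. x \<in> {0..l e} - M \<Longrightarrow> 0 < x \<and> x < l e \<and> error_pde e t x"
    using pde_diff[OF e t] by blast
  have t': "0 < t" "t < T" "t \<in> {0..T}" using t by auto
  show ?thesis
  proof (rule balance_law_le[where f = "entropy e" and F = "\<lambda>x. dh e t x * dm e t x" and N = M and T = T])
    show "Lip ({0..T} \<times> {0..l e}) (\<lambda>(t, x). entropy e t x)"
      using Lip_entropy[OF e] by (simp add: case_prod_beta')
    show "Lip {0..l e} (\<lambda>x. dh e t x * dm e t x)"
      by (intro Lip_mult compact_Icc Lip_time(1)[OF Lip_dh] Lip_time(1)[OF Lip_dm] e t')
    show "(\<lambda>x. - \<eta>0 * (r e t x)\<^sup>2 + (1 + K + \<eta>1 + \<gamma>) * \<epsilon> * ((r e t x)\<^sup>2 + (w e t x)\<^sup>2))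
        integrable_on {0..l e}"
      by (intro integrable_continuous_real continuous_intros Lip_time(2)[OF Lip_r] Lip_time(2)[OF Lip_w] e t')
    fix x assume x: "x \<in> {0..l e} - M"
    then have x': "x \<in> {0..l e}" by simp
    from M'[OF x, unfolded error_pde_def] obtain \<rho>t vt \<rho>ht vht mx hx where
      d: "((\<lambda>s. \<rho> e s x) has_real_derivative \<rho>t) (at t)"
        "((\<lambda>s. v e s x) has_real_derivative vt) (at t)"
        "((\<lambda>s. \<rho>h e s x) has_real_derivative \<rho>ht) (at t)"
        "((\<lambda>s. vh e s x) has_real_derivative vht) (at t)"
      and m: "(dm e t has_real_derivative mx) (at x)" "(dh e t has_real_derivative hx) (at x)"
      and eqs: "\<rho>ht - \<rho>t + mx = src (\<rho> e t x) (\<rho>h e t x)" "vht - vt + hx = - \<gamma> * df e t x"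
      and small: "\<bar>\<rho>t\<bar> \<le> \<epsilon>" "\<bar>vt\<bar> \<le> \<epsilon>"
      by blast
    note dens = density[OF e t'(3) x'] and vel = velocity[OF e t'(3) x']
    define Q where "Q = deriv P (\<rho>h e t x) - deriv P (\<rho> e t x) - deriv (deriv P) (\<rho> e t x) * r e t x"
    let ?L = "src (\<rho> e t x) (\<rho>h e t x)"
    \<comment> \<open>The last two terms pair the time derivatives of the original state with the
      Taylor remainders of enthalpy, \<open>w\<^sup>2 / 2 + Q\<close>, and of mass flow,
      \<open>r * w\<close>.\<close>
    let ?a = "dh e t x * (\<rho>ht - \<rho>t) + dm e t x * (vht - vt) + \<rho>t * ((w e t x)\<^sup>2 / 2 + Q) + vt * r e t x * w e t x"
    have chain: "((\<lambda>s. P (\<rho> e s x)) has_real_derivative deriv P (\<rho> e t x) * \<rho>t) (at t)"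
      "((\<lambda>s. P (\<rho>h e s x)) has_real_derivative deriv P (\<rho>h e t x) * \<rho>ht) (at t)"
      "((\<lambda>s. deriv P (\<rho> e s x)) has_real_derivative deriv (deriv P) (\<rho> e t x) * \<rho>t) (at t)"
      by (rule DERIV_chain2[OF P1 d(1)] DERIV_chain2[OF P1 d(3)] DERIV_chain2[OF P2 d(1)], rule dens)+
    have "((\<lambda>s. entropy e s x) has_real_derivative ?a) (at t)"
      unfolding entropy_def r_def w_def
      by (auto intro!: derivative_eq_intros d chain
        simp: dh_def dm_def enthalpy_def mass_flow_def Q_def r_def w_def power2_eq_square field_simps)
    moreover have "((\<lambda>x. dh e t x * dm e t x) has_real_derivative dh e t x * mx + hx * dm e t x) (at x)"
      using DERIV_mult[OF m(2,1)] by (simp add: algebra_simps)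
    moreover have "?a + (dh e t x * mx + hx * dm e t x) \<le>
      - \<eta>0 * (r e t x)\<^sup>2 + (1 + K + \<eta>1 + \<gamma>) * \<epsilon> * ((r e t x)\<^sup>2 + (w e t x)\<^sup>2)"
    proof -
      have "?a + (dh e t x * mx + hx * dm e t x) =
        dh e t x * (\<rho>ht - \<rho>t + mx) + dm e t x * (vht - vt + hx) + \<rho>t * ((w e t x)\<^sup>2 / 2 + Q) + vt * r e t x * w e t x"
        by (simp add: algebra_simps)
      also have "\<dots> = \<rho>t * ((w e t x)\<^sup>2 / 2 + Q) + vt * r e t x * w e t x + dh e t x * ?L - \<gamma> * dm e t x * df e t x"
        unfolding eqs by simp
      also have "\<dots> \<le> - \<eta>0 * (r e t x)\<^sup>2 + (1 + K + \<eta>1 + \<gamma>) * \<epsilon> * ((r e t x)\<^sup>2 + (w e t x)\<^sup>2)"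
        unfolding dh_eq dm_eq df_def velocity_h[of e t x, symmetric]
      proof (rule energy_rate_le)
        show "\<bar>Q\<bar> \<le> K * (r e t x)\<^sup>2" unfolding Q_def r_def by (rule dP_taylor[OF dens])
        show "(deriv P (\<rho>h e t x) - deriv P (\<rho> e t x)) * ?L \<le> - \<eta>0 * (r e t x)\<^sup>2"
          unfolding r_def by (rule src_damping[OF dens])
        show "\<bar>?L\<bar> \<le> \<eta>1 * \<bar>r e t x\<bar>" unfolding r_def by (rule src_bound[OF dens])
        show "\<bar>v e t x + w e t x\<bar> \<le> \<epsilon>" using vel by (simp add: velocity_h)
        show "0 \<le> \<rho>h e t x" using dens lo by simp
      qed (use small vel \<epsilon> \<gamma> const_pos in simp_all)
      finally show ?thesis .
    qed
    ultimately show "\<exists>a b. ((\<lambda>s. entropy e s x) has_real_derivative a) (at t) \<and>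
      ((\<lambda>x. dh e t x * dm e t x) has_real_derivative b) (at x) \<and>
      a + b \<le> - \<eta>0 * (r e t x)\<^sup>2 + (1 + K + \<eta>1 + \<gamma>) * \<epsilon> * ((r e t x)\<^sup>2 + (w e t x)\<^sup>2)"
      by blast
  qed (use t' M l_pos[OF e] in auto)
qed

text \<open>Integration in space upgrades the velocity equation from almost every to every
  \<open>x\<close>, so \<open>W\<close> is differentiable in time at each point.\<close>

lemma integral_w_time:
  assumes e: "e \<in> E" and t: "t \<in> {0<..<T} - N" and x: "x \<in> {0..l e}"
  shows "((\<lambda>s. integral {0..x} (w e s)) has_real_derivative
    - \<gamma> * integral {0..x} (df e t) + dh e t 0 - dh e t x) (at t)"
proof -
  obtain M where M: "negligible M" and M': "\<And>x. x \<in> {0..l e} - M \<Longrightarrow> 0 < x \<and> x < l e \<and> error_pde e t x"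
    using pde_diff[OF e t] by blast
  have t': "0 < t" "t < T" "t \<in> {0..T}" using t by auto
  have "((\<lambda>s. integral {0..x} (w e s)) has_real_derivative
    integral {0..x} (\<lambda>y. - \<gamma> * df e t y) + dh e t 0 - dh e t x) (at t)"
  proof (rule balance_law_eq[where N = M and T = T])
    have "Lip ({0..T} \<times> {0..l e}) (\<lambda>(t, x). w e t x)" using Lip_w[OF e] by (simp add: case_prod_beta')
    then show "Lip ({0..T} \<times> {0..x}) (\<lambda>(t, x). w e t x)" by (rule Lip_subset) (use x in auto)
    show "Lip {0..x} (dh e t)"
      by (rule Lip_subset[OF Lip_time(1)[OF Lip_dh[OF e] t'(3)]]) (use x in auto)
    fix y assume "y \<in> {0..x} - M"
    then have "y \<in> {0..l e} - M" using x by auto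
    from M'[OF this, unfolded error_pde_def] obtain vt vht hx where
      d: "((\<lambda>s. v e s y) has_real_derivative vt) (at t)" "((\<lambda>s. vh e s y) has_real_derivative vht) (at t)"
      and m: "(dh e t has_real_derivative hx) (at y)" and eqs: "vht - vt + hx = - \<gamma> * df e t y"
      by blast
    have "((\<lambda>s. w e s y) has_real_derivative vht - vt) (at t)"
      unfolding w_def by (intro DERIV_diff d)
    then show "\<exists>a b. ((\<lambda>s. w e s y) has_real_derivative a) (at t) \<and>
      (dh e t has_real_derivative b) (at y) \<and> a + b = - \<gamma> * df e t y"
      using m eqs by blast
  qed (use t' M x in auto)
  then show ?thesis by simp
qed

text \<open>The part of the time derivative of \<open>W\<close> that friction contributes.\<close>

definition R where "R e t x = \<gamma> * (integral {0..l e0} (df e0 t) - integral {0..x} (df e t))"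

text \<open>The enthalpy differences at the inner node agree on all edges and cancel between the two
  integrals in \<open>W\<close>; the one at the outer end of \<open>e0\<close> is zero. This is the
  reason for normalizing \<open>W\<close> at that end.\<close>

lemma W_time:
  assumes e: "e \<in> E" and t: "t \<in> {0<..<T} - N" and x: "x \<in> {0..l e}"
  shows "((\<lambda>s. W e s x) has_real_derivative R e t x - dh e t x) (at t)"
proof -
  have t': "t \<in> {0..T}" using t by auto
  have "l e0 \<in> {0..l e0}" using l_pos[OF E(2)] by simp
  from DERIV_diff[OF integral_w_time[OF e t x] integral_w_time[OF E(2) t this]]
  have "((\<lambda>s. W e s x) has_real_derivative
    (- \<gamma> * integral {0..x} (df e t) + dh e t 0 - dh e t x) -
    (- \<gamma> * integral {0..l e0} (df e0 t) + dh e0 t 0 - dh e0 t (l e0))) (at t)"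
    unfolding W_def .
  moreover have "dh e t 0 = dh e0 t 0" "dh e0 t (l e0) = 0"
    unfolding dh_def using inner_enthalpy[OF e t'] outer_enthalpy[OF t'] by simp_all
  ultimately show ?thesis by (simp add: R_def algebra_simps)
qed

lemma R_bound:
  assumes e: "e \<in> E" and t: "t \<in> {0..T}" and x: "x \<in> {0..l e}"
  shows "\<bar>R e t x\<bar> \<le> 4 * \<gamma> * S t"
proof -
  have "\<bar>integral {0..l e0} (df e0 t)\<bar> \<le> 2 * S t"
    by (rule integral_w_le_S[OF E(2) t _ Lip_time(2)[OF Lip_df[OF E(2)] t] df_bound[OF E(2) t]])
      (use l_pos[OF E(2)] in auto)
  moreover have "\<bar>integral {0..x} (df e t)\<bar> \<le> 2 * S t"
    by (rule integral_w_le_S[OF e t x Lip_time(2)[OF Lip_df[OF e] t] df_bound[OF e t]]) auto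
  ultimately have "\<bar>integral {0..l e0} (df e0 t) - integral {0..x} (df e t)\<bar> \<le> 4 * S t" by linarith
  from mult_left_mono[OF this \<gamma>] show ?thesis
    unfolding R_def abs_mult using \<gamma> by (simp add: mult_ac)
qed

text \<open>The coefficient of \<open>r\<^sup>2\<close> in \<open>correction_rate_le\<close> for
  \<open>a = 4 * \<gamma>\<close>, which comes from \<open>R_bound\<close>, and
  \<open>l = D\<close>.\<close>

definition A where "A = \<kappa>1 + (4 * \<gamma> + 2 * \<eta>1)\<^sup>2 * D\<^sup>2 / (2 * lo)"

text \<open>Where \<open>W\<close> multiplies a derivative, the mass balance combines the factors to
  the source; the derivatives of \<open>W\<close> itself are known. So no derivative of the errors
  survives.\<close>

lemma correction_edge:
  assumes e: "e \<in> E" and t: "t \<in> {0<..<T} - N"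
  shows "\<exists>d. ((\<lambda>s. integral {0..l e} (\<lambda>x. - (W e s x * r e s x))) has_real_derivative d) (at t) \<and>
    d \<le> - (W e t 0 * dm e t 0) - - (W e t (l e) * dm e t (l e)) + integral {0..l e}
      (\<lambda>x. A * (r e t x)\<^sup>2 + \<epsilon> * ((r e t x)\<^sup>2 + (w e t x)\<^sup>2) - lo * (w e t x)\<^sup>2 + lo / (2 * D\<^sup>2) * (S t)\<^sup>2)"
proof -
  obtain M where M: "negligible M" and M': "\<And>x. x \<in> {0..l e} - M \<Longrightarrow> 0 < x \<and> x < l e \<and> error_pde e t x"
    using pde_diff[OF e t] by blast
  have t': "0 < t" "t < T" "t \<in> {0..T}" using t by auto
  let ?B = "\<lambda>x. A * (r e t x)\<^sup>2 + \<epsilon> * ((r e t x)\<^sup>2 + (w e t x)\<^sup>2) - lo * (w e t x)\<^sup>2 + lo / (2 * D\<^sup>2) * (S t)\<^sup>2"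
  show ?thesis
  proof (rule balance_law_le[where f = "\<lambda>s x. - (W e s x * r e s x)" and F = "\<lambda>x. - (W e t x * dm e t x)"
        and N = M and T = T])
    show "Lip ({0..T} \<times> {0..l e}) (\<lambda>(s, x). - (W e s x * r e s x))"
      unfolding case_prod_beta' by (intro Lip_minus Lip_mult Lip_W Lip_r e compact_rect)
    show "Lip {0..l e} (\<lambda>x. - (W e t x * dm e t x))"
      by (intro Lip_minus Lip_mult compact_Icc Lip_time(1)[OF Lip_W] Lip_time(1)[OF Lip_dm] e t')
    show "?B integrable_on {0..l e}"
      by (intro integrable_continuous_real continuous_intros Lip_time(2)[OF Lip_r] Lip_time(2)[OF Lip_w] e t')
    fix x assume x: "x \<in> {0..l e} - M"
    then have x': "x \<in> {0..l e}" by simp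
    from M'[OF x, unfolded error_pde_def] obtain \<rho>t \<rho>ht mx where x'': "0 < x" "x < l e"
      and d: "((\<lambda>s. \<rho> e s x) has_real_derivative \<rho>t) (at t)"
        "((\<lambda>s. \<rho>h e s x) has_real_derivative \<rho>ht) (at t)"
      and m: "(dm e t has_real_derivative mx) (at x)"
      and eqs: "\<rho>ht - \<rho>t + mx = src (\<rho> e t x) (\<rho>h e t x)"
      by blast
    note dens = density[OF e t'(3) x'] and vel = velocity[OF e t'(3) x']
    let ?L = "src (\<rho> e t x) (\<rho>h e t x)"
    have rt: "((\<lambda>s. r e s x) has_real_derivative \<rho>ht - \<rho>t) (at t)"
      unfolding r_def by (intro DERIV_diff d)
    have "((\<lambda>s. - (W e s x * r e s x)) has_real_derivative
        - ((R e t x - dh e t x) * r e t x + (\<rho>ht - \<rho>t) * W e t x)) (at t)"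
      by (intro DERIV_minus DERIV_mult W_time[OF e t x'] rt)
    moreover have "((\<lambda>x. - (W e t x * dm e t x)) has_real_derivative
        - (w e t x * dm e t x + mx * W e t x)) (at x)"
      by (intro DERIV_minus DERIV_mult W_deriv[OF e t'(3) x''] m)
    moreover have "- ((R e t x - dh e t x) * r e t x + (\<rho>ht - \<rho>t) * W e t x) +
        - (w e t x * dm e t x + mx * W e t x) \<le> ?B x"
    proof -
      have "- ((R e t x - dh e t x) * r e t x + (\<rho>ht - \<rho>t) * W e t x) + - (w e t x * dm e t x + mx * W e t x)
        = dh e t x * r e t x - R e t x * r e t x - W e t x * (\<rho>ht - \<rho>t + mx) - w e t x * dm e t x"
        by (simp add: algebra_simps)
      also have "\<dots> \<le> ?B x"
        unfolding eqs dh_eq dm_eq A_def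
      proof (rule correction_rate_le)
        show "\<bar>deriv P (\<rho>h e t x) - deriv P (\<rho> e t x)\<bar> \<le> \<kappa>1 * \<bar>r e t x\<bar>"
          unfolding r_def by (rule dP_diff[OF dens])
        show "\<bar>?L\<bar> \<le> \<eta>1 * \<bar>r e t x\<bar>" unfolding r_def by (rule src_bound[OF dens])
        show "\<bar>v e t x + w e t x\<bar> \<le> \<epsilon>" using vel by (simp add: velocity_h)
        show "\<bar>R e t x\<bar> \<le> 4 * \<gamma> * S t" by (rule R_bound[OF e t'(3) x'])
        show "\<bar>W e t x\<bar> \<le> 2 * S t" by (rule W_bound[OF e t'(3) x'])
        show "lo \<le> \<rho>h e t x" using dens by simp
      qed (use vel \<epsilon> const_pos lo D_pos S_nonneg[OF t'(3)] in simp_all)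
      finally show ?thesis .
    qed
    ultimately show "\<exists>a b. ((\<lambda>s. - (W e s x * r e s x)) has_real_derivative a) (at t) \<and>
      ((\<lambda>x. - (W e t x * dm e t x)) has_real_derivative b) (at x) \<and> a + b \<le> ?B x"
      by blast
  qed (use t' M l_pos[OF e] in auto)
qed

section \<open>Summation over the network\<close>

definition err where "err t = X t + Y t"

lemma integrable_sq:
  assumes "e \<in> E" "t \<in> {0..T}"
  shows "(\<lambda>x. (r e t x)\<^sup>2) integrable_on {0..l e}" "(\<lambda>x. (w e t x)\<^sup>2) integrable_on {0..l e}"
  by (intro integrable_continuous_real continuous_intros Lip_time(2)[OF Lip_r] Lip_time(2)[OF Lip_w] assms)+

text \<open>The constant \<open>c\<close> makes room for multiples of \<open>(S t)\<^sup>2\<close>,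
  which do not depend on \<open>x\<close>.\<close>

lemma integral_quadratic:
  assumes "e \<in> E" "t \<in> {0..T}"
  shows "((\<lambda>x. a * (r e t x)\<^sup>2 + b * (w e t x)\<^sup>2 + c) has_integral
    a * integral {0..l e} (\<lambda>x. (r e t x)\<^sup>2) + b * integral {0..l e} (\<lambda>x. (w e t x)\<^sup>2) + c * l e) {0..l e}"
proof -
  have "((\<lambda>x. c) has_integral c * l e) {0..l e}"
    using has_integral_const_real[of c 0 "l e"] l_pos[OF assms(1)] by (simp add: mult.commute)
  then show ?thesis
    by (intro has_integral_add has_integral_mult_right integrable_integral integrable_sq assms)
qed

lemma sum_integral_quadratic:
  assumes "t \<in> {0..T}"
  shows "(\<Sum>e\<in>E. integral {0..l e} (\<lambda>x. a * (r e t x)\<^sup>2 + b * (w e t x)\<^sup>2 + c)) = a * X t + b * Y t + c * D"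
  unfolding X_def Y_def D_def
  by (simp add: integral_unique[OF integral_quadratic[OF _ assms]] sum.distrib sum_distrib_left)

lemma X_nonneg: "t \<in> {0..T} \<Longrightarrow> 0 \<le> X t" and Y_nonneg: "t \<in> {0..T} \<Longrightarrow> 0 \<le> Y t"
  unfolding X_def Y_def
  by (intro sum_nonneg Henstock_Kurzweil_Integration.integral_nonneg integrable_sq; simp)+

text \<open>Cauchy-Schwarz over the whole network, from Young's inequality with
  \<open>\<theta>\<close> the mean of \<open>\<bar>w\<bar>\<close>: the constant part then
  integrates to \<open>S t / 2\<close> and is absorbed.\<close>

lemma S_square_le:
  assumes t: "t \<in> {0..T}"
  shows "(S t)\<^sup>2 \<le> D * Y t"
proof (cases "S t = 0")
  case False
  then have S: "0 < S t" using S_nonneg[OF t] by simp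
  define \<theta> where "\<theta> = S t / D"
  have \<theta>: "0 < \<theta>" using S D_pos by (simp add: \<theta>_def)
  have aw: "(\<lambda>y. \<bar>w e t y\<bar>) integrable_on {0..l e}" if "e \<in> E" for e
    by (intro integrable_continuous_real continuous_intros Lip_time(2)[OF Lip_w[OF that] t])
  have "S t \<le> (\<Sum>e\<in>E. integral {0..l e} (\<lambda>x. 0 * (r e t x)\<^sup>2 + 1 / (2 * \<theta>) * (w e t x)\<^sup>2 + \<theta> / 2))"
    unfolding S_def
  proof (intro sum_mono integral_le aw)
    fix e x assume "e \<in> E"
    show "(\<lambda>x. 0 * (r e t x)\<^sup>2 + 1 / (2 * \<theta>) * (w e t x)\<^sup>2 + \<theta> / 2) integrable_on {0..l e}"
      using integral_quadratic[OF \<open>e \<in> E\<close> t] by blast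
    have "2 * (\<bar>w e t x\<bar> * \<bar>\<theta>\<bar>) \<le> (w e t x)\<^sup>2 + \<theta>\<^sup>2" by (rule two_abs_mult_le)
    then show "\<bar>w e t x\<bar> \<le> 0 * (r e t x)\<^sup>2 + 1 / (2 * \<theta>) * (w e t x)\<^sup>2 + \<theta> / 2"
      using \<theta> by (simp add: field_simps power2_eq_square)
  qed
  also have "\<dots> = 1 / (2 * \<theta>) * Y t + \<theta> / 2 * D"
    unfolding sum_integral_quadratic[OF t] by simp
  finally have "S t \<le> D * Y t / (2 * S t) + S t / 2"
    using S D_pos by (simp add: \<theta>_def field_simps)
  then have "S t / 2 \<le> D * Y t / (2 * S t)" by linarith
  then show ?thesis using S by (simp add: field_simps power2_eq_square)
qed (use Y_nonneg[OF t] D_pos in simp)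

definition correction where "correction t = (\<Sum>e\<in>E. integral {0..l e} (\<lambda>x. - (W e t x * r e t x)))"
definition energy where "energy t = (\<Sum>e\<in>E. integral {0..l e} (entropy e t))"

text \<open>The Young weights give both squares the same factor \<open>D\<close> once
  \<open>S_square_le\<close> has been applied.\<close>

lemma correction_bound:
  assumes t: "t \<in> {0..T}"
  shows "\<bar>correction t\<bar> \<le> D * err t"
proof -
  have "\<bar>correction t\<bar> \<le> (\<Sum>e\<in>E. \<bar>integral {0..l e} (\<lambda>x. - (W e t x * r e t x))\<bar>)"
    unfolding correction_def by (rule sum_abs)
  also have "\<dots> \<le> (\<Sum>e\<in>E. integral {0..l e} (\<lambda>x. D * (r e t x)\<^sup>2 + 0 * (w e t x)\<^sup>2 + (S t)\<^sup>2 / D))"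
  proof (intro sum_mono integral_abs_le_integral)
    fix e x assume e: "e \<in> E"
    show "(\<lambda>x. - (W e t x * r e t x)) integrable_on {0..l e}"
      by (intro integrable_continuous_real continuous_intros Lip_time(2)[OF Lip_W] Lip_time(2)[OF Lip_r] e t)
    show "(\<lambda>x. D * (r e t x)\<^sup>2 + 0 * (w e t x)\<^sup>2 + (S t)\<^sup>2 / D) integrable_on {0..l e}"
      using integral_quadratic[OF e t] by blast
    assume x: "x \<in> {0..l e}"
    have "\<bar>- (W e t x * r e t x)\<bar> \<le> 2 * S t * \<bar>r e t x\<bar>"
      using mult_right_mono[OF W_bound[OF e t x], of "\<bar>r e t x\<bar>"] by (simp add: abs_mult)
    also have "\<dots> \<le> D * (r e t x)\<^sup>2 + (S t)\<^sup>2 / D"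
    proof -
      have "0 \<le> (S t - D * \<bar>r e t x\<bar>)\<^sup>2 / D" using D_pos by simp
      also have "\<dots> = D * (r e t x)\<^sup>2 + (S t)\<^sup>2 / D - 2 * S t * \<bar>r e t x\<bar>"
        using D_pos by (simp add: power2_diff power_mult_distrib) (simp add: field_simps power2_eq_square)
      finally show ?thesis by simp
    qed
    finally show "\<bar>- (W e t x * r e t x)\<bar> \<le> D * (r e t x)\<^sup>2 + 0 * (w e t x)\<^sup>2 + (S t)\<^sup>2 / D" by simp
  qed
  also have "\<dots> = D * X t + (S t)\<^sup>2"
    using sum_integral_quadratic[OF t, of D 0] D_pos by simp
  also have "\<dots> \<le> D * err t"
    using S_square_le[OF t] by (simp add: err_def algebra_simps)
  finally show ?thesis .
qed

lemma energy_bounds: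
  assumes t: "t \<in> {0..T}" and m: "m \<le> lo" "m \<le> \<kappa>0" "\<epsilon> \<le> m / 2" and M: "hi \<le> M" "\<kappa>1 \<le> M"
  shows "m / 4 * err t \<le> energy t" "energy t \<le> (M + \<epsilon>) / 2 * err t"
proof -
  have bounds: "m / 4 * ((r e t x)\<^sup>2 + (w e t x)\<^sup>2) \<le> entropy e t x"
    "entropy e t x \<le> (M + \<epsilon>) / 2 * ((r e t x)\<^sup>2 + (w e t x)\<^sup>2)"
    if e: "e \<in> E" and x: "x \<in> {0..l e}" for e x
  proof -
    note d = density[OF e t x]
    have "lo \<le> \<rho>h e t x" "\<rho>h e t x \<le> hi" using d by auto
    note re = relative_energy_bounds[OF velocity(1)[OF e t x] m this _ _ M,
        of "r e t x" "P (\<rho>h e t x) - P (\<rho> e t x) - deriv P (\<rho> e t x) * r e t x" "w e t x",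
        OF entropy_bounds(1)[OF d, folded r_def] entropy_bounds(2)[OF d, folded r_def]]
    show "m / 4 * ((r e t x)\<^sup>2 + (w e t x)\<^sup>2) \<le> entropy e t x"
      "entropy e t x \<le> (M + \<epsilon>) / 2 * ((r e t x)\<^sup>2 + (w e t x)\<^sup>2)"
      unfolding entropy_def by (rule re)+
  qed
  have "m / 4 * err t = (\<Sum>e\<in>E. integral {0..l e} (\<lambda>x. m / 4 * (r e t x)\<^sup>2 + m / 4 * (w e t x)\<^sup>2 + 0))"
    unfolding sum_integral_quadratic[OF t] by (simp add: err_def algebra_simps)
  also have "\<dots> \<le> energy t"
    unfolding energy_def
  proof (intro sum_mono integral_le)
    fix e x assume e: "e \<in> E"
    show "(\<lambda>x. m / 4 * (r e t x)\<^sup>2 + m / 4 * (w e t x)\<^sup>2 + 0) integrable_on {0..l e}"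
      using integral_quadratic[OF e t] by blast
    show "entropy e t integrable_on {0..l e}" by (rule Lip_time(3)[OF Lip_entropy[OF e] t])
    show "m / 4 * (r e t x)\<^sup>2 + m / 4 * (w e t x)\<^sup>2 + 0 \<le> entropy e t x" if "x \<in> {0..l e}"
      using bounds(1)[OF e that] by (simp add: distrib_left)
  qed
  finally show "m / 4 * err t \<le> energy t" .
  have "energy t \<le> (\<Sum>e\<in>E. integral {0..l e} (\<lambda>x. (M + \<epsilon>) / 2 * (r e t x)\<^sup>2 + (M + \<epsilon>) / 2 * (w e t x)\<^sup>2 + 0))"
    unfolding energy_def
  proof (intro sum_mono integral_le)
    fix e x assume e: "e \<in> E"
    show "(\<lambda>x. (M + \<epsilon>) / 2 * (r e t x)\<^sup>2 + (M + \<epsilon>) / 2 * (w e t x)\<^sup>2 + 0) integrable_on {0..l e}"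
      using integral_quadratic[OF e t] by blast
    show "entropy e t integrable_on {0..l e}" by (rule Lip_time(3)[OF Lip_entropy[OF e] t])
    show "entropy e t x \<le> (M + \<epsilon>) / 2 * (r e t x)\<^sup>2 + (M + \<epsilon>) / 2 * (w e t x)\<^sup>2 + 0" if "x \<in> {0..l e}"
      using bounds(2)[OF e that] by (simp only: distrib_left add_0_right)
  qed
  also have "\<dots> = (M + \<epsilon>) / 2 * err t"
    unfolding sum_integral_quadratic[OF t] by (simp only: err_def distrib_left mult_zero_left add_0_right)
  finally show "energy t \<le> (M + \<epsilon>) / 2 * err t" .
qed

text \<open>At an outer end one factor vanishes: \<open>dm\<close> if \<open>e \<noteq> e0\<close>,
  and \<open>dh\<close> or \<open>W\<close> on \<open>e0\<close>. At the inner node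
  \<open>dh\<close> and \<open>W\<close> do not depend on the edge and can be pulled out of the sum
  of \<open>dm\<close>, which is zero by conservation of mass.\<close>

lemma boundary_terms:
  assumes t: "t \<in> {0..T}"
  shows "(\<Sum>e\<in>E. dh e t 0 * dm e t 0 - dh e t (l e) * dm e t (l e)) = 0"
    "(\<Sum>e\<in>E. - (W e t 0 * dm e t 0) - - (W e t (l e) * dm e t (l e))) = 0"
proof -
  have dm0: "(\<Sum>e\<in>E. dm e t 0) = 0"
    unfolding dm_def using inner_mass[OF t] by (simp add: sum_subtractf)
  have dh0: "dh e t 0 = dh e0 t 0" if "e \<in> E" for e
    unfolding dh_def using inner_enthalpy[OF that t] by simp
  have dml: "dm e t (l e) = 0" if "e \<in> E" "e \<noteq> e0" for e
    unfolding dm_def using outer_mass[OF that t] by simp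
  have dhl: "dh e0 t (l e0) = 0" unfolding dh_def using outer_enthalpy[OF t] by simp
  have Wl: "W e0 t (l e0) = 0" by (simp add: W_def)
  have "(\<Sum>e\<in>E. dh e t 0 * dm e t 0 - dh e t (l e) * dm e t (l e)) = (\<Sum>e\<in>E. dh e0 t 0 * dm e t 0)"
    by (rule sum.cong) (use dh0 dml dhl in force)+
  then show "(\<Sum>e\<in>E. dh e t 0 * dm e t 0 - dh e t (l e) * dm e t (l e)) = 0"
    using dm0 by (simp flip: sum_distrib_left)
  have "(\<Sum>e\<in>E. - (W e t 0 * dm e t 0) - - (W e t (l e) * dm e t (l e))) =
      (\<Sum>e\<in>E. integral {0..l e0} (w e0 t) * dm e t 0)"
  proof (rule sum.cong)
    fix e assume "e \<in> E"
    then have "W e t (l e) * dm e t (l e) = 0" using dml Wl by (cases "e = e0") auto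
    then show "- (W e t 0 * dm e t 0) - - (W e t (l e) * dm e t (l e)) = integral {0..l e0} (w e0 t) * dm e t 0"
      by (simp add: W_def)
  qed simp
  then show "(\<Sum>e\<in>E. - (W e t 0 * dm e t 0) - - (W e t (l e) * dm e t (l e))) = 0"
    using dm0 by (simp flip: sum_distrib_left)
qed

lemma energy_decay:
  assumes t: "t \<in> {0<..<T} - N"
  shows "\<exists>d. (energy has_real_derivative d) (at t) \<and>
    d \<le> - \<eta>0 * X t + (1 + K + \<eta>1 + \<gamma>) * \<epsilon> * err t"
proof -
  let ?c = "(1 + K + \<eta>1 + \<gamma>) * \<epsilon>"
  have t': "t \<in> {0..T}" using t by auto
  from bchoice[OF ballI[OF entropy_edge[OF _ t]]]
  obtain d where "\<forall>e\<in>E. ((\<lambda>s. integral {0..l e} (entropy e s)) has_real_derivative d e) (at t) \<and>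
    d e \<le> dh e t 0 * dm e t 0 - dh e t (l e) * dm e t (l e) + integral {0..l e}
      (\<lambda>x. - \<eta>0 * (r e t x)\<^sup>2 + ?c * ((r e t x)\<^sup>2 + (w e t x)\<^sup>2))"
    ..
  note d = this[THEN bspec, THEN conjunct1] this[THEN bspec, THEN conjunct2]
  have "(energy has_real_derivative (\<Sum>e\<in>E. d e)) (at t)"
    unfolding energy_def[abs_def] by (rule DERIV_sum) (rule d(1))
  moreover have "(\<Sum>e\<in>E. d e) \<le> (\<Sum>e\<in>E. dh e t 0 * dm e t 0 - dh e t (l e) * dm e t (l e)) +
      (\<Sum>e\<in>E. integral {0..l e} (\<lambda>x. (?c - \<eta>0) * (r e t x)\<^sup>2 + ?c * (w e t x)\<^sup>2 + 0))"
    unfolding sum.distrib[symmetric]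
    by (rule sum_mono, rule order_trans[OF d(2)]) (simp_all add: algebra_simps)
  ultimately show ?thesis
    unfolding boundary_terms[OF t'] sum_integral_quadratic[OF t']
    by (intro exI[of _ "\<Sum>e\<in>E. d e"]) (simp add: err_def algebra_simps)
qed

lemma correction_decay:
  assumes t: "t \<in> {0<..<T} - N"
  shows "\<exists>d. (correction has_real_derivative d) (at t) \<and> d \<le> A * X t + \<epsilon> * err t - lo / 2 * Y t"
proof -
  have t': "t \<in> {0..T}" using t by auto
  from bchoice[OF ballI[OF correction_edge[OF _ t]]]
  obtain d where "\<forall>e\<in>E.
      ((\<lambda>s. integral {0..l e} (\<lambda>x. - (W e s x * r e s x))) has_real_derivative d e) (at t) \<and>
    d e \<le> - (W e t 0 * dm e t 0) - - (W e t (l e) * dm e t (l e)) + integral {0..l e}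
      (\<lambda>x. A * (r e t x)\<^sup>2 + \<epsilon> * ((r e t x)\<^sup>2 + (w e t x)\<^sup>2) - lo * (w e t x)\<^sup>2 + lo / (2 * D\<^sup>2) * (S t)\<^sup>2)"
    ..
  note d = this[THEN bspec, THEN conjunct1] this[THEN bspec, THEN conjunct2]
  have eq: "A * (r e t x)\<^sup>2 + \<epsilon> * ((r e t x)\<^sup>2 + (w e t x)\<^sup>2) - lo * (w e t x)\<^sup>2 + lo / (2 * D\<^sup>2) * (S t)\<^sup>2 =
    (A + \<epsilon>) * (r e t x)\<^sup>2 + (\<epsilon> - lo) * (w e t x)\<^sup>2 + lo / (2 * D\<^sup>2) * (S t)\<^sup>2" for e x
    by (simp add: algebra_simps)
  have "(correction has_real_derivative (\<Sum>e\<in>E. d e)) (at t)"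
    unfolding correction_def[abs_def] by (rule DERIV_sum) (rule d(1))
  moreover have "(\<Sum>e\<in>E. d e) \<le> (\<Sum>e\<in>E. - (W e t 0 * dm e t 0) - - (W e t (l e) * dm e t (l e))) +
      (\<Sum>e\<in>E. integral {0..l e} (\<lambda>x. (A + \<epsilon>) * (r e t x)\<^sup>2 + (\<epsilon> - lo) * (w e t x)\<^sup>2 + lo / (2 * D\<^sup>2) * (S t)\<^sup>2))"
    unfolding sum.distrib[symmetric]
    by (rule sum_mono, rule d(2)[unfolded eq])
  then have "(\<Sum>e\<in>E. d e) \<le> (A + \<epsilon>) * X t + (\<epsilon> - lo) * Y t + lo / (2 * D\<^sup>2) * (S t)\<^sup>2 * D"
    unfolding boundary_terms[OF t'] sum_integral_quadratic[OF t'] by simp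
  moreover have "lo / (2 * D\<^sup>2) * (S t)\<^sup>2 * D \<le> lo / 2 * Y t"
  proof -
    have "lo / (2 * D\<^sup>2) * (S t)\<^sup>2 * D = lo / (2 * D) * (S t)\<^sup>2" using D_pos by (simp add: power2_eq_square)
    also have "\<dots> \<le> lo / (2 * D) * (D * Y t)"
      by (rule mult_left_mono[OF S_square_le[OF t']]) (use lo D_pos in simp)
    also have "\<dots> = lo / 2 * Y t" using D_pos by simp
    finally show ?thesis .
  qed
  moreover have "(A + \<epsilon>) * X t + (\<epsilon> - lo) * Y t + lo / 2 * Y t = A * X t + \<epsilon> * err t - lo / 2 * Y t"
    by (simp add: err_def field_simps)
  ultimately show ?thesis by (intro exI[of _ "\<Sum>e\<in>E. d e"] conjI) (assumption, linarith)
qed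

lemma Lip_energy: "Lip {0..T} energy"
  unfolding energy_def[abs_def]
  by (intro Lip_sum Lip_integral) (use Lip_entropy in \<open>simp add: case_prod_beta'\<close>)

lemma Lip_correction: "Lip {0..T} correction"
  unfolding correction_def[abs_def]
proof (intro Lip_sum Lip_integral)
  fix e assume "e \<in> E"
  then show "Lip ({0..T} \<times> {0..l e}) (\<lambda>(t, x). - (W e t x * r e t x))"
    unfolding case_prod_beta' by (intro Lip_minus Lip_mult Lip_W Lip_r compact_rect)
qed

text \<open>Weighted by \<open>\<delta>\<close>, the correction trades part of the density damping
  \<open>\<eta>0\<close> for velocity damping \<open>\<delta> * lo / 2\<close>; the conditions on
  \<open>k\<close> say that both stay ahead of the small terms by \<open>k\<close>. In the
  prefactor, \<open>C\<close> is the upper and \<open>m / 8 = m / 4 - m / 8\<close> the lower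
  constant comparing \<open>?\<Psi>\<close> with \<open>err\<close>.\<close>

lemma error_decay:
  assumes m: "0 < m" "m \<le> lo" "m \<le> \<kappa>0" "\<epsilon> \<le> m / 2" and M: "hi \<le> M" "\<kappa>1 \<le> M"
    and \<delta>: "0 < \<delta>" "\<delta> * D \<le> m / 8" and C: "(M + 1) / 2 + m / 8 \<le> C"
    and k: "0 < k" "\<delta> * A + (1 + K + \<eta>1 + \<gamma> + \<delta>) * \<epsilon> + k \<le> \<eta>0"
      "(1 + K + \<eta>1 + \<gamma> + \<delta>) * \<epsilon> + k \<le> \<delta> * lo / 2"
    and t: "t \<in> {0..T}"
  shows "err t \<le> 8 * C / m * err 0 * exp (- (k / C) * t)"
proof -
  let ?\<Psi> = "\<lambda>t. energy t + \<delta> * correction t"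
  have "(M + \<epsilon>) / 2 \<le> (M + 1) / 2" using \<epsilon>(2) by simp
  then have MC: "(M + \<epsilon>) / 2 + m / 8 \<le> C" using C by linarith
  have C0: "0 < C" using C M const_pos m by (smt (verit) divide_pos_pos)
  have err: "0 \<le> err t" if "t \<in> {0..T}" for t
    using X_nonneg[OF that] Y_nonneg[OF that] by (simp add: err_def)
  have corr: "\<bar>\<delta> * correction t\<bar> \<le> m / 8 * err t" if "t \<in> {0..T}" for t
  proof -
    have "\<bar>\<delta> * correction t\<bar> \<le> \<delta> * (D * err t)"
      using correction_bound[OF that] \<delta> by (simp add: abs_mult)
    also have "\<dots> \<le> m / 8 * err t"
      using mult_right_mono[OF \<delta>(2) err[OF that]] by (simp add: mult.assoc)
    finally show ?thesis .
  qed
  have lower: "m / 8 * err t \<le> ?\<Psi> t" if "t \<in> {0..T}" for t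
    using corr[OF that] energy_bounds(1)[OF that m(2-4) M] by (simp add: abs_le_iff)
  have upper: "?\<Psi> t \<le> C * err t" if "t \<in> {0..T}" for t
  proof -
    have "?\<Psi> t \<le> ((M + \<epsilon>) / 2 + m / 8) * err t"
      using corr[OF that] energy_bounds(2)[OF that m(2-4) M] unfolding distrib_right by (simp add: abs_le_iff)
    also have "\<dots> \<le> C * err t" by (rule mult_right_mono[OF MC err[OF that]])
    finally show ?thesis .
  qed
  have Lip: "Lip {0..T} ?\<Psi>" by (intro Lip_add Lip_cmult Lip_energy Lip_correction)
  \<comment> \<open>Two-sided time derivatives are available at interior times only.\<close>
  have neg: "negligible (N \<union> {0, T})" using N by auto
  have "?\<Psi> t \<le> ?\<Psi> 0 * exp (- (k / C) * t)"
  proof (rule lipschitz_exp_decay[OF Lip neg _ t])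
    fix t assume "t \<in> {0..T} - (N \<union> {0, T})"
    then have t: "t \<in> {0<..<T} - N" "t \<in> {0..T}" by auto
    obtain d where d: "(energy has_real_derivative d) (at t)"
      "d \<le> - \<eta>0 * X t + (1 + K + \<eta>1 + \<gamma>) * \<epsilon> * err t" using energy_decay[OF t(1)] by blast
    obtain d' where d': "(correction has_real_derivative d') (at t)"
      "d' \<le> A * X t + \<epsilon> * err t - lo / 2 * Y t" using correction_decay[OF t(1)] by blast
    have "(?\<Psi> has_real_derivative d + \<delta> * d') (at t)"
      by (intro DERIV_add DERIV_cmult d d')
    moreover have "d + \<delta> * d' \<le> - (k / C) * ?\<Psi> t"
    proof -
      let ?s = "(1 + K + \<eta>1 + \<gamma> + \<delta>) * \<epsilon>"
      have "d + \<delta> * d' \<le> (- \<eta>0 * X t + (1 + K + \<eta>1 + \<gamma>) * \<epsilon> * err t) + \<delta> * (A * X t + \<epsilon> * err t - lo / 2 * Y t)"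
        by (intro add_mono mult_left_mono d d') (use \<delta> in simp)
      also have "\<dots> = (\<delta> * A + ?s - \<eta>0) * X t + (?s - \<delta> * lo / 2) * Y t"
        by (simp add: err_def algebra_simps)
      also have "\<dots> \<le> - k * X t + - k * Y t"
        by (intro add_mono mult_right_mono X_nonneg Y_nonneg t) (use k in linarith)+
      also have "\<dots> = - (k / C) * (C * err t)" using C0 by (simp add: err_def algebra_simps)
      also have "\<dots> \<le> - (k / C) * ?\<Psi> t"
        using upper[OF t(2)] k C0 by (intro mult_left_mono_neg) auto
      finally show ?thesis .
    qed
    ultimately show "\<exists>D. (?\<Psi> has_real_derivative D) (at t) \<and> D \<le> - (k / C) * ?\<Psi> t" by blast
  qed
  also have "\<dots> \<le> C * err 0 * exp (- (k / C) * t)"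
    using upper[of 0] T by (intro mult_right_mono) auto
  finally have "m / 8 * err t \<le> C * err 0 * exp (- (k / C) * t)"
    using lower[OF t] by linarith
  then show ?thesis using m by (simp add: field_simps)
qed

end

text \<open>Passage from the Lebesgue integral on the open interval to the gauge integral on the
  closed one, on which the calculus above rests.\<close>

lemma L2_norm_square:
  fixes f :: "real \<Rightarrow> 'a::real_normed_vector"
  assumes g: "continuous_on {0..l} g" and eq: "\<And>x. x \<in> {0<..<l} \<Longrightarrow> (norm (f x))\<^sup>2 = g x"
  shows "(L2_norm l f)\<^sup>2 = integral {0..l} g"
proof -
  have "(L2_norm l f)\<^sup>2 = (LINT x|lebesgue_on {0<..<l}. (norm (f x))\<^sup>2)"
    unfolding L2_norm_def by (intro real_sqrt_pow2 Bochner_Integration.integral_nonneg) simp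
  also have "\<dots> = (LINT x|lebesgue_on {0<..<l}. g x)"
    by (rule Bochner_Integration.integral_cong) (auto simp: eq)
  also have "\<dots> = integral {0<..<l} g"
  proof (rule lebesgue_integral_eq_integral)
    have "g absolutely_integrable_on {0..l}"
      using absolutely_integrable_continuous_real[OF g] .
    then have "g absolutely_integrable_on {0<..<l}"
      by (rule set_integrable_subset) auto
    then show "integrable (lebesgue_on {0<..<l}) g"
      by (simp add: integrable_restrict_space set_integrable_def)
  qed simp
  also have "\<dots> = integral {0..l} g" by (rule integral_open_interval_real[symmetric])
  finally show ?thesis .
qed

section \<open>Exponential synchronization of the observer\<close>

lemma lipschitz_state_Lip:
  "lipschitz_state T l u \<Longrightarrow> Lip ({0..T} \<times> {0..l}) (\<lambda>z. u (fst z) (snd z))"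
  unfolding lipschitz_state_def Lip_def by (simp add: case_prod_beta')

lemma Linf_Linf_norm_bound_everywhere:
  assumes u: "lipschitz_state T l u" and norm: "Linf_Linf_norm T l u \<le> ennreal C" and "0 \<le> C"
    and "0 < T" "0 < l" "t \<in> {0..T}" "x \<in> {0..l}"
  shows "\<bar>u t x\<bar> \<le> C"
proof (rule continuous_le_of_ae_rectangle[where f = "\<lambda>t x. \<bar>u t x\<bar>"])
  show "continuous_on ({0..T} \<times> {0..l}) (\<lambda>z. \<bar>u (fst z) (snd z)\<bar>)"
    by (intro Lip_continuous_on Lip_abs lipschitz_state_Lip u)
  show "ae_rectangle T l (\<lambda>t x. \<bar>u t x\<bar> \<le> C)"
    by (rule Linf_Linf_norm_leD[OF norm]) fact
qed fact+

lemma observer_pde_ae: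
  assumes sol: "solves_ae P \<gamma> T l (\<lambda>t x. 0) (\<lambda>t x. 0) \<rho> v"
    and obs: "solves_ae P \<gamma> T l (\<lambda>t x. src (\<rho> t x) (\<rho>h t x)) (\<lambda>t x. 0) \<rho>h vh"
    and norm: "Linf_Linf_norm T l (\<lambda>t x. deriv (\<lambda>s. \<rho> s x) t)
      + Linf_Linf_norm T l (\<lambda>t x. deriv (\<lambda>s. v s x) t) \<le> ennreal C"
    and C: "0 \<le> C" "C \<le> \<epsilon>"
  shows "ae_rectangle T l (observer_pde P src \<gamma> \<epsilon> \<rho> v \<rho>h vh)"
proof -
  have n1: "Linf_Linf_norm T l (\<lambda>t x. deriv (\<lambda>s. \<rho> s x) t) \<le> ennreal C"
    using norm by (meson add_increasing2 order_trans zero_le le_iff_add)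
  have n2: "Linf_Linf_norm T l (\<lambda>t x. deriv (\<lambda>s. v s x) t) \<le> ennreal C"
    using norm by (metis add.commute le_iff_add order_trans)
  note ae = ae_rectangle_conj[OF
      ae_rectangle_conj[OF AE_lebesgue_on_rectangle[OF sol[unfolded solves_ae_def]]
        AE_lebesgue_on_rectangle[OF obs[unfolded solves_ae_def]]]
      ae_rectangle_conj[OF Linf_Linf_norm_leD[OF n1 C(1)] Linf_Linf_norm_leD[OF n2 C(1)]]]
  show ?thesis
  proof (rule ae_rectangle_mono[OF ae], goal_cases)
    case (1 t x)
    from 1(3)[THEN conjunct1, THEN conjunct1] obtain \<rho>t mx vt hx where u:
      "((\<lambda>s. \<rho> s x) has_real_derivative \<rho>t) (at t)"
      "((\<lambda>y. mass_flow (\<rho> t y) (v t y)) has_real_derivative mx) (at x)"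
      "((\<lambda>s. v s x) has_real_derivative vt) (at t)"
      "((\<lambda>y. enthalpy P (\<rho> t y) (v t y)) has_real_derivative hx) (at x)"
      "\<rho>t + mx = 0" "vt + hx = - \<gamma> * \<bar>v t x\<bar> * v t x + 0"
      by (elim exE conjE) (rule that)
    from 1(3)[THEN conjunct1, THEN conjunct2] obtain \<rho>ht mhx vht hhx where uh:
      "((\<lambda>s. \<rho>h s x) has_real_derivative \<rho>ht) (at t)"
      "((\<lambda>y. mass_flow (\<rho>h t y) (vh t y)) has_real_derivative mhx) (at x)"
      "((\<lambda>s. vh s x) has_real_derivative vht) (at t)"
      "((\<lambda>y. enthalpy P (\<rho>h t y) (vh t y)) has_real_derivative hhx) (at x)"
      "\<rho>ht + mhx = src (\<rho> t x) (\<rho>h t x)" "vht + hhx = - \<gamma> * \<bar>vh t x\<bar> * vh t x + 0"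
      by (elim exE conjE) (rule that)
    \<comment> \<open>The slopes provided by \<open>solves_ae\<close> are existential; uniqueness
      identifies them with \<open>deriv\<close>, to which the norm bounds refer.\<close>
    have small: "\<bar>\<rho>t\<bar> \<le> \<epsilon>" "\<bar>vt\<bar> \<le> \<epsilon>"
      using 1(3)[THEN conjunct2] DERIV_imp_deriv[OF u(1)] DERIV_imp_deriv[OF u(3)] C by auto
    show ?case
      unfolding observer_pde_def
      by (rule exI[of _ \<rho>t], rule exI[of _ vt], rule exI[of _ \<rho>ht], rule exI[of _ vht],
          rule exI[of _ mx], rule exI[of _ hx], rule exI[of _ mhx], rule exI[of _ hhx])
        (intro conjI small u uh u(6)[unfolded add_0_right] uh(6)[unfolded add_0_right])
  qed
qed

lemma network_L2_norm_square:
  assumes "\<And>e. e \<in> arcs G \<Longrightarrow> continuous_on {0..len e} (g e)"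
    and "\<And>e x. e \<in> arcs G \<Longrightarrow> x \<in> {0<..<len e} \<Longrightarrow> (norm (f e x))\<^sup>2 = g e x"
  shows "(network_L2_norm G len f)\<^sup>2 = (\<Sum>e\<in>arcs G. integral {0..len e} (g e))"
  unfolding network_L2_norm_def
  by (subst real_sqrt_pow2) (auto intro!: sum_nonneg sum.cong L2_norm_square assms)

lemma (in star_observer) err_eq_network_L2_norm:
  assumes "arcs G = E" "t \<in> {0..T}"
    and "\<And>e x. e \<in> E \<Longrightarrow> x \<in> {0..l e} \<Longrightarrow> f e x = (\<rho> e t x, v e t x) - (\<rho>h e t x, vh e t x)"
  shows "(network_L2_norm G l f)\<^sup>2 = err t"
proof -
  have "(network_L2_norm G l f)\<^sup>2 = (\<Sum>e\<in>arcs G. integral {0..l e} (\<lambda>x. (r e t x)\<^sup>2 + (w e t x)\<^sup>2))"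
  proof (rule network_L2_norm_square)
    fix e assume e: "e \<in> arcs G"
    show "continuous_on {0..l e} (\<lambda>x. (r e t x)\<^sup>2 + (w e t x)\<^sup>2)"
      using e assms(1,2) by (intro continuous_intros Lip_time(2)[OF Lip_r] Lip_time(2)[OF Lip_w]) auto
    show "(norm (f e x))\<^sup>2 = (r e t x)\<^sup>2 + (w e t x)\<^sup>2" if "x \<in> {0<..<l e}" for x
      using e that assms(1,3) by (simp add: norm_Pair r_def w_def power2_commute)
  qed
  also have "\<dots> = err t"
    using sum_integral_quadratic[OF assms(2), of 1 1 0] by (simp add: assms(1) err_def)
  finally show ?thesis .
qed

text \<open>Placing \<open>\<epsilon>\<close> first makes the required smallness independent of the
  solutions, and fixing \<open>C1\<close> and \<open>C2\<close> before \<open>T\<close> excludes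
  constants that merely exploit the boundedness of the time interval.\<close>

theorem theorem4p17:
  fixes G :: "('v, 'e) pre_digraph" and \<nu>0 \<nu>d :: 'v and len :: "'e \<Rightarrow> real"
    and p P :: "real \<Rightarrow> real" and \<gamma> \<mu> \<rho>ref \<rho>lo \<rho>hi vt :: real
  assumes "star_network G \<nu>0 len" and "\<nu>d \<in> boundary_nodes G \<nu>0"
    and "smooth_on_reals {0<..} p" and "strict_mono_on {0<..} p" and "\<forall>r>0. deriv p r > 0"
    and "smooth_on_reals {0<..} P" and "strictly_convex_on {0<..} P"
    and "\<forall>r>0. deriv p r = r * deriv (deriv P) r"
    and "\<gamma> \<ge> 0" and "\<mu> > 0" and "\<rho>ref > 0"
    and "\<rho>lo > 0" and "\<rho>hi > 0" and "vt > 0"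
    and A2: "\<forall>r\<in>{\<rho>lo..\<rho>hi}. r * deriv (deriv P) r \<ge> 4 * \<bar>vt\<bar>\<^sup>2"
  shows "\<exists>\<epsilon>>0. \<forall>Ct vbar. 0 < Ct \<and> Ct \<le> \<epsilon> \<and> 0 < vbar \<and> vbar \<le> \<epsilon> \<longrightarrow>
    (\<exists>C1>0. \<exists>C2>0. \<forall>T>0.
      \<forall>(\<rho> :: 'e \<Rightarrow> real \<Rightarrow> real \<Rightarrow> real) (v :: 'e \<Rightarrow> real \<Rightarrow> real \<Rightarrow> real)
       (\<rho>h :: 'e \<Rightarrow> real \<Rightarrow> real \<Rightarrow> real) (vh :: 'e \<Rightarrow> real \<Rightarrow> real \<Rightarrow> real)
       (\<rho>0 :: 'e \<Rightarrow> real \<Rightarrow> real) (v0 :: 'e \<Rightarrow> real \<Rightarrow> real)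
       (\<rho>h0 :: 'e \<Rightarrow> real \<Rightarrow> real) (vh0 :: 'e \<Rightarrow> real \<Rightarrow> real)
       (hb :: real \<Rightarrow> 'v \<Rightarrow> real) (mb :: real \<Rightarrow> 'v \<Rightarrow> real).
        (\<forall>e\<in>arcs G.
           \<comment> \<open>Lipschitz solutions of the original and of the observer system\<close>
           lipschitz_state T (len e) (\<rho> e) \<and> lipschitz_state T (len e) (v e) \<and>
           lipschitz_state T (len e) (\<rho>h e) \<and> lipschitz_state T (len e) (vh e) \<and>
           solves_ae P \<gamma> T (len e) (\<lambda>t x. 0) (\<lambda>t x. 0) (\<rho> e) (v e) \<and>
           solves_ae P \<gamma> T (len e) (\<lambda>t x. source_density p \<rho>ref \<mu> (\<rho> e t x) (\<rho>h e t x)) (\<lambda>t x. 0)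
             (\<rho>h e) (vh e) \<and>
           (\<forall>x\<in>{0..len e}. \<rho> e 0 x = \<rho>0 e x \<and> v e 0 x = v0 e x \<and>
              \<rho>h e 0 x = \<rho>h0 e x \<and> vh e 0 x = vh0 e x) \<and>
           \<comment> \<open>(A1)\<close>
           C0_W1inf T (len e) (\<rho> e) \<and> W1inf_Linf T (len e) (\<rho> e) \<and>
           C0_W1inf T (len e) (v e) \<and> W1inf_Linf T (len e) (v e) \<and>
           (\<forall>t\<in>{0..T}. \<forall>x\<in>{0..len e}.
              \<rho>lo \<le> \<rho> e t x \<and> \<rho> e t x \<le> \<rho>hi \<and> - vt \<le> v e t x \<and> v e t x \<le> vt) \<and>
           \<comment> \<open>(A3)\<close>
           C0_W1inf T (len e) (\<rho>h e) \<and> W1inf_Linf T (len e) (\<rho>h e) \<and>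
           C0_W1inf T (len e) (vh e) \<and> W1inf_Linf T (len e) (vh e) \<and>
           (\<forall>t\<in>{0..T}. \<forall>x\<in>{0..len e}.
              \<rho>lo \<le> \<rho>h e t x \<and> \<rho>h e t x \<le> \<rho>hi \<and> - vt \<le> vh e t x \<and> vh e t x \<le> vt) \<and>
           \<comment> \<open>(A4)\<close>
           Linf_Linf_norm T (len e) (\<lambda>t x. deriv (\<lambda>s. \<rho> e s x) t)
             + Linf_Linf_norm T (len e) (\<lambda>t x. deriv (\<lambda>s. v e s x) t) \<le> ennreal Ct \<and>
           Linf_Linf_norm T (len e) (v e) \<le> ennreal vbar \<and>
           Linf_Linf_norm T (len e) (vh e) \<le> ennreal vbar) \<and>
        boundary_conditions G len \<nu>0 \<nu>d P T hb mb \<rho> v \<and>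
        boundary_conditions G len \<nu>0 \<nu>d P T hb mb \<rho>h vh \<and>
        coupling_conditions G P T \<rho> v \<and> coupling_conditions G P T \<rho>h vh \<longrightarrow>
        (\<forall>t\<in>{0..T}.
           (network_L2_norm G len (\<lambda>e x. (\<rho> e t x, v e t x) - (\<rho>h e t x, vh e t x)))\<^sup>2
             \<le> C1 * (network_L2_norm G len (\<lambda>e x. (\<rho>0 e x, v0 e x) - (\<rho>h0 e x, vh0 e x)))\<^sup>2
                 * exp (- C2 * t)))"
proof -
  have fin: "finite (arcs G)"
    using assms(1) by (auto simp: star_network_def fin_digraph_def fin_digraph_axioms_def)
  have len: "0 < len e" if "e \<in> arcs G" for e using assms(1) that by (auto simp: star_network_def)
  have bij: "bij_betw (head G) (arcs G) (boundary_nodes G \<nu>0)"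
    using assms(1) by (simp add: star_network_def)
  then have "\<nu>d \<in> head G ` arcs G" using assms(2) by (simp add: bij_betw_def)
  then obtain e0 where e0: "e0 \<in> arcs G" "head G e0 = \<nu>d" by blast
  have other: "head G e \<in> boundary_nodes G \<nu>0 - {\<nu>d}" if "e \<in> arcs G" "e \<noteq> e0" for e
    using bij e0 that by (auto simp: bij_betw_def inj_on_def)
  let ?src = "source_density p \<rho>ref \<mu>"
  obtain \<kappa>0 \<kappa>1 K \<eta>0 \<eta>1 where pos: "0 < \<kappa>0" "0 < \<kappa>1" "0 < K" "0 < \<eta>0" "0 < \<eta>1"
    and bounds:
    "\<And>r s. r \<in> {\<rho>lo..\<rho>hi} \<Longrightarrow> s \<in> {\<rho>lo..\<rho>hi} \<Longrightarrow> \<kappa>0 / 2 * (s - r)\<^sup>2 \<le> P s - P r - deriv P r * (s - r)"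
    "\<And>r s. r \<in> {\<rho>lo..\<rho>hi} \<Longrightarrow> s \<in> {\<rho>lo..\<rho>hi} \<Longrightarrow> P s - P r - deriv P r * (s - r) \<le> \<kappa>1 / 2 * (s - r)\<^sup>2"
    "\<And>r s. r \<in> {\<rho>lo..\<rho>hi} \<Longrightarrow> s \<in> {\<rho>lo..\<rho>hi} \<Longrightarrow> \<bar>deriv P s - deriv P r\<bar> \<le> \<kappa>1 * \<bar>s - r\<bar>"
    "\<And>r s. r \<in> {\<rho>lo..\<rho>hi} \<Longrightarrow> s \<in> {\<rho>lo..\<rho>hi} \<Longrightarrow>
      \<bar>deriv P s - deriv P r - deriv (deriv P) r * (s - r)\<bar> \<le> K * (s - r)\<^sup>2"
    "\<And>r s. r \<in> {\<rho>lo..\<rho>hi} \<Longrightarrow> s \<in> {\<rho>lo..\<rho>hi} \<Longrightarrow> \<bar>?src r s\<bar> \<le> \<eta>1 * \<bar>s - r\<bar>"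
    "\<And>r s. r \<in> {\<rho>lo..\<rho>hi} \<Longrightarrow> s \<in> {\<rho>lo..\<rho>hi} \<Longrightarrow> (deriv P s - deriv P r) * ?src r s \<le> - \<eta>0 * (s - r)\<^sup>2"
    by (rule pressure_bounds[OF assms(3,5,6,8,10,11,12), where hi = \<rho>hi]) (rule that)
  have P1: "(P has_real_derivative deriv P r) (at r)"
    and P2: "(deriv P has_real_derivative deriv (deriv P) r) (at r)" if "r \<in> {\<rho>lo..\<rho>hi}" for r
    using smooth_on_reals_DERIV[OF assms(6), of r 0] smooth_on_reals_DERIV[OF assms(6), of r 1] that assms(12)
    by auto
  have sub: "{\<rho>lo..\<rho>hi} \<subseteq> {0<..}" using assms(12) by (auto simp: subset_iff)
  have LipP: "Lip {\<rho>lo..\<rho>hi} P" "Lip {\<rho>lo..\<rho>hi} (deriv P)"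
    by (rule Lip_C1[OF has_field_derivative_at_within[OF P1]];
        use smooth_on_reals_continuous_on[OF assms(6) sub, of 1] in simp)
      (rule Lip_C1[OF has_field_derivative_at_within[OF P2]];
        use smooth_on_reals_continuous_on[OF assms(6) sub, of 2] in \<open>simp add: numeral_2_eq_2\<close>)

  \<comment> \<open>\<open>L\<close> and \<open>\<alpha>\<close> anticipate the locale constants
    \<open>D\<close> and \<open>A\<close>, which are needed before \<open>T\<close> and the
    solutions are given.\<close>
  define L where "L = (\<Sum>e\<in>arcs G. len e)"
  define \<alpha> where "\<alpha> = \<kappa>1 + (4 * \<gamma> + 2 * \<eta>1)\<^sup>2 * L\<^sup>2 / (2 * \<rho>lo)"
  define B where "B = 1 + K + \<eta>1 + \<gamma>"
  define m where "m = min \<rho>lo \<kappa>0"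
  define M where "M = max \<rho>hi \<kappa>1"
  define C where "C = (M + 1) / 2 + m / 8"
  \<comment> \<open>The first bound keeps the correction below half of the energy's lower bound
    \<open>m / 4\<close>; the second spends at most half of \<open>\<eta>0\<close> on its terms in
    \<open>r\<^sup>2\<close>.\<close>
  define \<delta> where "\<delta> = min (m / (8 * L)) (\<eta>0 / (2 * \<alpha>))"
  \<comment> \<open>\<open>k\<close> is damping left for both errors. The choice of
    \<open>\<epsilon>\<close> gives at most \<open>k / 2\<close> of it to the small terms, so the
    rate is \<open>k / 2 / C\<close>; the bounds \<open>m / 2\<close> and 1 serve the mixed term of
    the energy and the friction estimates.\<close>
  define k where "k = min (\<eta>0 / 2) (\<delta> * \<rho>lo / 2)"
  define \<epsilon> where "\<epsilon> = min 1 (min (m / 2) (k / (2 * (B + \<delta>))))"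
  have L: "0 < L" unfolding L_def using fin e0 len by (intro sum_pos) auto
  have \<alpha>: "0 < \<alpha>" unfolding \<alpha>_def using pos assms(12) by (intro add_pos_nonneg) auto
  have B: "0 < B" using pos assms(9) by (simp add: B_def)
  have m: "0 < m" "m \<le> \<rho>lo" "m \<le> \<kappa>0" using pos assms(12) by (auto simp: m_def)
  have M: "\<rho>hi \<le> M" "\<kappa>1 \<le> M" "0 < M" using pos by (auto simp: M_def)
  have C: "0 < C" unfolding C_def using m M by (intro add_pos_pos divide_pos_pos) auto
  have \<delta>: "0 < \<delta>" "\<delta> * L \<le> m / 8" "\<delta> * \<alpha> \<le> \<eta>0 / 2"
  proof -
    show "0 < \<delta>" using m L \<alpha> pos by (simp add: \<delta>_def)
    have "\<delta> \<le> m / (8 * L)" "\<delta> \<le> \<eta>0 / (2 * \<alpha>)" by (auto simp: \<delta>_def)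
    then show "\<delta> * L \<le> m / 8" "\<delta> * \<alpha> \<le> \<eta>0 / 2" using L \<alpha> by (simp_all add: field_simps)
  qed
  have k: "0 < k" "k \<le> \<eta>0 / 2" "k \<le> \<delta> * \<rho>lo / 2" using pos \<delta> assms(12) by (auto simp: k_def)
  have \<epsilon>: "0 < \<epsilon>" "\<epsilon> \<le> 1" "\<epsilon> \<le> m / 2" "(B + \<delta>) * \<epsilon> \<le> k / 2"
  proof -
    show "0 < \<epsilon>" "\<epsilon> \<le> 1" using m k B \<delta> by (auto simp: \<epsilon>_def)
    show "\<epsilon> \<le> m / 2" unfolding \<epsilon>_def by (rule min.coboundedI2[OF min.cobounded1])
    have "\<epsilon> \<le> k / (2 * (B + \<delta>))" by (auto simp: \<epsilon>_def)
    then show "(B + \<delta>) * \<epsilon> \<le> k / 2" using B \<delta> by (simp add: field_simps)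
  qed
  show ?thesis
  proof (rule exI[of _ \<epsilon>], intro conjI allI impI, rule \<epsilon>(1), elim conjE, goal_cases)
    case (1 Ct vbar)
    note Ct = 1(1,2) and vbar = 1(3,4)
    show ?case
    proof (rule exI[of _ "8 * C / m"], rule conjI, use C m in simp,
        rule exI[of _ "k / 2 / C"], rule conjI, use C k in simp, intro allI impI ballI, goal_cases)
      case (1 T \<rho> v \<rho>h vh \<rho>0 v0 \<rho>h0 vh0 hb mb t)
      note T = 1(1) and t = 1(3)
      note edge = 1(2)[THEN conjunct1, THEN bspec]
      have bc: "boundary_conditions G len \<nu>0 \<nu>d P T hb mb \<rho> v"
        "boundary_conditions G len \<nu>0 \<nu>d P T hb mb \<rho>h vh"
        and cc: "coupling_conditions G P T \<rho> v" "coupling_conditions G P T \<rho>h vh"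
        using 1(2) by - (elim conjE, assumption)+
      have Lip: "lipschitz_state T (len e) (\<rho> e)" "lipschitz_state T (len e) (v e)"
        "lipschitz_state T (len e) (\<rho>h e)" "lipschitz_state T (len e) (vh e)"
        and sol: "solves_ae P \<gamma> T (len e) (\<lambda>t x. 0) (\<lambda>t x. 0) (\<rho> e) (v e)"
        "solves_ae P \<gamma> T (len e) (\<lambda>t x. ?src (\<rho> e t x) (\<rho>h e t x)) (\<lambda>t x. 0) (\<rho>h e) (vh e)"
        and init: "\<forall>x\<in>{0..len e}. \<rho> e 0 x = \<rho>0 e x \<and> v e 0 x = v0 e x \<and> \<rho>h e 0 x = \<rho>h0 e x \<and> vh e 0 x = vh0 e x"
        and dens: "\<forall>t\<in>{0..T}. \<forall>x\<in>{0..len e}. \<rho>lo \<le> \<rho> e t x \<and> \<rho> e t x \<le> \<rho>hi \<and> - vt \<le> v e t x \<and> v e t x \<le> vt"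
        "\<forall>t\<in>{0..T}. \<forall>x\<in>{0..len e}. \<rho>lo \<le> \<rho>h e t x \<and> \<rho>h e t x \<le> \<rho>hi \<and> - vt \<le> vh e t x \<and> vh e t x \<le> vt"
        and norms: "Linf_Linf_norm T (len e) (\<lambda>t x. deriv (\<lambda>s. \<rho> e s x) t)
             + Linf_Linf_norm T (len e) (\<lambda>t x. deriv (\<lambda>s. v e s x) t) \<le> ennreal Ct"
           "Linf_Linf_norm T (len e) (v e) \<le> ennreal vbar"
           "Linf_Linf_norm T (len e) (vh e) \<le> ennreal vbar"
        if "e \<in> arcs G" for e
        using edge[OF that] by - (elim conjE, assumption)+
      have "ae_rectangle T (len e) (observer_pde P ?src \<gamma> \<epsilon> (\<rho> e) (v e) (\<rho>h e) (vh e))"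
        if "e \<in> arcs G" for e
        by (rule observer_pde_ae[where C = Ct]) (use sol norms Ct that in simp_all)
      then have "\<forall>e\<in>arcs G. \<exists>N. negligible N \<and> (\<forall>t\<in>{0<..<T} - N. \<exists>M. negligible M \<and>
          (\<forall>x\<in>{0<..<len e} - M. observer_pde P ?src \<gamma> \<epsilon> (\<rho> e) (v e) (\<rho>h e) (vh e) t x))"
        unfolding ae_rectangle_def[symmetric] ..
      from bchoice[OF this] obtain N where N: "\<forall>e\<in>arcs G. negligible (N e) \<and> (\<forall>t\<in>{0<..<T} - N e. \<exists>M. negligible M \<and>
          (\<forall>x\<in>{0<..<len e} - M. observer_pde P ?src \<gamma> \<epsilon> (\<rho> e) (v e) (\<rho>h e) (vh e) t x))"
        ..
      \<comment> \<open>As there are finitely many edges, the union of their exceptional sets of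
        times is still negligible.\<close>
      interpret obs: star_observer "arcs G" e0 len T P ?src \<gamma> \<epsilon> \<rho>lo \<rho>hi \<kappa>0 \<kappa>1 K \<eta>0 \<eta>1 \<rho> v \<rho>h vh "\<Union>(N ` arcs G)"
      proof
        show "finite (arcs G)" "e0 \<in> arcs G" "0 < T" "0 \<le> \<gamma>" "0 < \<epsilon>" "\<epsilon> \<le> 1" "0 < \<rho>lo"
          "0 < \<kappa>0" "0 < \<kappa>1" "0 < K" "0 < \<eta>0" "0 < \<eta>1"
          "Lip {\<rho>lo..\<rho>hi} P" "Lip {\<rho>lo..\<rho>hi} (deriv P)"
          using fin e0 T assms(9,12) \<epsilon> pos LipP by simp_all
        show "negligible (\<Union>(N ` arcs G))" using fin N by (intro negligible_Union) auto
      next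
        fix t assume t: "t \<in> {0..T}"
        show "enthalpy P (\<rho>h e0 t (len e0)) (vh e0 t (len e0)) = enthalpy P (\<rho> e0 t (len e0)) (v e0 t (len e0))"
          using bc t e0 by (simp add: boundary_conditions_def)
        show "(\<Sum>e\<in>arcs G. mass_flow (\<rho> e t 0) (v e t 0)) = 0" "(\<Sum>e\<in>arcs G. mass_flow (\<rho>h e t 0) (vh e t 0)) = 0"
          using cc t by (simp_all add: coupling_conditions_def)
        fix e assume e: "e \<in> arcs G"
        show "enthalpy P (\<rho> e t 0) (v e t 0) = enthalpy P (\<rho> e0 t 0) (v e0 t 0)"
          "enthalpy P (\<rho>h e t 0) (vh e t 0) = enthalpy P (\<rho>h e0 t 0) (vh e0 t 0)"
          using cc t e e0(1) unfolding coupling_conditions_def by blast+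
        show "mass_flow (\<rho>h e t (len e)) (vh e t (len e)) = mass_flow (\<rho> e t (len e)) (v e t (len e))" if "e \<noteq> e0"
          using bc t e other[OF e that] by (simp add: boundary_conditions_def)
        fix x assume x: "x \<in> {0..len e}"
        show "\<rho> e t x \<in> {\<rho>lo..\<rho>hi}" "\<rho>h e t x \<in> {\<rho>lo..\<rho>hi}"
          using dens[OF e] t x by simp_all
        \<comment> \<open>The norms bound the velocities almost everywhere; continuity extends this
          to the closed rectangle.\<close>
        have "\<bar>v e t x\<bar> \<le> vbar" "\<bar>vh e t x\<bar> \<le> vbar"
          using Linf_Linf_norm_bound_everywhere[OF Lip(2)[OF e] norms(2)[OF e] _ T len[OF e] t x]
            Linf_Linf_norm_bound_everywhere[OF Lip(4)[OF e] norms(3)[OF e] _ T len[OF e] t x] vbar by simp_all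
        then show "\<bar>v e t x\<bar> \<le> \<epsilon>" "\<bar>vh e t x\<bar> \<le> \<epsilon>" using vbar by simp_all
      next
        fix e assume e: "e \<in> arcs G"
        show "0 < len e" by (rule len[OF e])
        show "Lip ({0..T} \<times> {0..len e}) (\<lambda>z. \<rho> e (fst z) (snd z))"
          "Lip ({0..T} \<times> {0..len e}) (\<lambda>z. v e (fst z) (snd z))"
          "Lip ({0..T} \<times> {0..len e}) (\<lambda>z. \<rho>h e (fst z) (snd z))"
          "Lip ({0..T} \<times> {0..len e}) (\<lambda>z. vh e (fst z) (snd z))"
          by (rule lipschitz_state_Lip, rule Lip[OF e])+
        fix t assume "t \<in> {0<..<T} - \<Union>(N ` arcs G)"
        then have "t \<in> {0<..<T} - N e" using e by blast
        then show "\<exists>M. negligible M \<and> (\<forall>x\<in>{0<..<len e} - M.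
            observer_pde P ?src \<gamma> \<epsilon> (\<rho> e) (v e) (\<rho>h e) (vh e) t x)"
          using N e by blast
      qed (fact P1 P2 bounds)+
      have consts_eq: "obs.D = L" "obs.A = \<alpha>"
        by (simp_all add: L_def \<alpha>_def obs.D_def obs.A_def)
      have decay: "obs.err t \<le> 8 * C / m * obs.err 0 * exp (- (k / 2 / C) * t)"
      proof (rule obs.error_decay[OF m \<epsilon>(3) M(1,2) \<delta>(1) _ _ _ _ _ t])
        show "(M + 1) / 2 + m / 8 \<le> C" by (simp add: C_def)
        show "0 < k / 2" using k by simp
      qed (use consts_eq \<delta> \<epsilon> k in \<open>simp_all add: B_def\<close>)
      have "(network_L2_norm G len (\<lambda>e x. (\<rho> e t x, v e t x) - (\<rho>h e t x, vh e t x)))\<^sup>2 = obs.err t"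
        by (rule obs.err_eq_network_L2_norm[OF refl t]) simp
      moreover have "(network_L2_norm G len (\<lambda>e x. (\<rho>0 e x, v0 e x) - (\<rho>h0 e x, vh0 e x)))\<^sup>2 = obs.err 0"
        by (rule obs.err_eq_network_L2_norm[OF refl]) (use init T in auto)
      ultimately show ?case using decay by simp
    qed
  qed
qed

end
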